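(* Let $q\in\mathbb{C}$ be a primitive root of unity of odd order $p\ge3$ and let $u_q(\mathfrak{sl}_2)$ be the small quantum group, i.e. the Hopf algebra over $\mathbb{C}$ generated by $E,F,K$ with relations $$KE=q^2EK,\quad KF=q^{-2}FK,\quad EF-FE=\frac{K-K^{-1}}{q-q^{-1}},\quad E^p=F^p=0,\quad K^p=1,$$ and coproduct $\Delta(E)=1\otimes E+E\otimes K$, $\Delta(F)=F\otimes1+K^{-1}\otimes F$, $\Delta(K)=K\otimes K$. Then $$H^2_{\mathrm{DY}}\bigl(u_q(\mathfrak{sl}_2)\text{-}\mathrm{mod}\bigr)=0.$$
   Context: The counit is $\varepsilon(E)=\varepsilon(F)=0$, $\varepsilon(K)=1$, and the antipode is $S(E)=-EK^{-1}$, $S(F)=-KF$, $S(K)=K^{-1}$. For a finite-dimensional Hopf algebra $H$, $H^\bullet_{\mathrm{DY}}(H\text{-}\mathrm{mod})$ denotes the Davydov--Yetter cohomology of the identity functor of the category of finite-dimensional $H$-modules, with trivial coefficients: the $n$-cochains are the natural endomorphisms $f_{X_1,\dots,X_n}$ of $X_1\otimes\cdots\otimes X_n$, with differential $$\delta^n(f)_{X_0,\dots,X_n}=\mathrm{id}_{X_0}\otimes f_{X_1,\dots,X_n}+\sum_{i=1}^n(-1)^if_{X_0,\dots,X_{i-1}\otimes X_i,\dots,X_n}+(-1)^{n+1}f_{X_0,\dots,X_{n-1}}\otimes\mathrm{id}_{X_n}.$$ Equivalently, the $n$-cochains form the centralizer in $H^{\otimes n}$ of the image of the iterated coproduct $H\to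 H^{\otimes n}$, with differential $\delta^n(\mathbf{x})=1\otimes\mathbf{x}+\sum_{i=1}^n(-1)^i(\mathrm{id}^{\otimes(i-1)}\otimes\Delta\otimes\mathrm{id}^{\otimes(n-i)})(\mathbf{x})+(-1)^{n+1}\mathbf{x}\otimes1$. *)

theory Defs
  imports
    "HOL-Library.Poly_Mapping"
    "HOL-Library.Product_Plus"
    "HOL-Algebra.QuotRing"
    "HOL-Algebra.Elementary_Groups"
    "Jordan_Normal_Form.Matrix"
begin

section \<open>Monoid algebras over the complex numbers\<close>

text \<open>
  For a monoid (written additively), \<open>'m \<Rightarrow>\<^sub>0 complex\<close> with the convolution product is its
  monoid algebra; \<open>monoid_alg\<close> packages it for HOL-Algebra.
\<close>

definition monoid_alg :: "('m::monoid_add \<Rightarrow>\<^sub>0 complex) ring" where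
  "monoid_alg = \<lparr>carrier = UNIV, monoid.mult = (*), one = 1, zero = 0, add = (+)\<rparr>"

definition scal :: "complex \<Rightarrow> ('m::monoid_add \<Rightarrow>\<^sub>0 complex)" where
  "scal c = Poly_Mapping.single 0 c"

text \<open>
  The tensor product of the monoid algebras of \<open>M\<close> and \<open>N\<close> is the monoid algebra of
  \<open>M \<times> N\<close>; \<open>tens x y\<close> is the pure tensor of \<open>x\<close> and \<open>y\<close>.
\<close>

definition tens :: "('m::monoid_add \<Rightarrow>\<^sub>0 complex) \<Rightarrow> ('n::monoid_add \<Rightarrow>\<^sub>0 complex) \<Rightarrow> ('m \<times> 'n \<Rightarrow>\<^sub>0 complex)" where
  "tens x y = (\<Sum>u\<in>Poly_Mapping.keys x. \<Sum>v\<in>Poly_Mapping.keys y.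
     Poly_Mapping.single (u, v) (Poly_Mapping.lookup x u * Poly_Mapping.lookup y v))"

section \<open>The free algebra on three generators\<close>

datatype gen = GE | GF | GK

datatype word = Word (letters: "gen list")

instantiation word :: monoid_add
begin

definition zero_word :: word where
  "zero_word = Word []"

definition plus_word :: "word \<Rightarrow> word \<Rightarrow> word" where
  "plus_word u v = Word (letters u @ letters v)"

instance
  by standard (simp_all add: zero_word_def plus_word_def)

end

type_synonym free_alg = "word \<Rightarrow>\<^sub>0 complex"
type_synonym free_alg2 = "word \<times> word \<Rightarrow>\<^sub>0 complex"

definition genr :: "gen \<Rightarrow> free_alg" where
  "genr g = Poly_Mapping.single (Word [g]) 1"

abbreviation gE :: free_alg where "gE \<equiv> genr GE"
abbreviation gF :: free_alg where "gF \<equiv> genr GF"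
abbreviation gK :: free_alg where "gK \<equiv> genr GK"

text \<open>
  The extension of an assignment of the generators to an algebra homomorphism into \<open>'a\<close>,
  where \<open>\<eta>\<close> is the structure map of the complex algebra \<open>'a\<close>.
\<close>

definition free_hom :: "(complex \<Rightarrow> 'a) \<Rightarrow> (gen \<Rightarrow> 'a) \<Rightarrow> free_alg \<Rightarrow> 'a::ring_1" where
  "free_hom \<eta> g x =
     (\<Sum>w\<in>Poly_Mapping.keys x. \<eta> (Poly_Mapping.lookup x w) * prod_list (map g (letters w)))"

section \<open>The small quantum group as a quotient of the free algebra\<close>

text \<open>Since \<open>gK ^ p = 1\<close> is imposed, the inverse of \<open>gK\<close> is represented by \<open>gK ^ (p - 1)\<close>.\<close>

definition Kinv :: "nat \<Rightarrow> free_alg" where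
  "Kinv p = gK ^ (p - 1)"

definition uq_relations :: "nat \<Rightarrow> complex \<Rightarrow> free_alg set" where
  "uq_relations p q =
     {gK * gE - scal (q^2) * gE * gK,
      gK * gF - scal (inverse (q^2)) * gF * gK,
      gE * gF - gF * gE - scal (1 / (q - inverse q)) * (gK - Kinv p),
      gE ^ p, gF ^ p, gK ^ p - 1}"

text \<open>HOL-Algebra ideals are two-sided.\<close>

definition uq_ideal :: "nat \<Rightarrow> complex \<Rightarrow> free_alg set" where
  "uq_ideal p q = genideal monoid_alg (uq_relations p q)"

definition uq :: "nat \<Rightarrow> complex \<Rightarrow> free_alg set ring" where
  "uq p q = monoid_alg Quot uq_ideal p q"

definition uq_class :: "nat \<Rightarrow> complex \<Rightarrow> free_alg \<Rightarrow> free_alg set" where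
  "uq_class p q x = uq_ideal p q +>\<^bsub>monoid_alg\<^esub> x"

text \<open>
  With \<open>T\<close> the free algebra and \<open>I\<close> the ideal of relations, the tensor square of \<open>T / I\<close> is
  \<open>(T \<otimes> T) / (I \<otimes> T + T \<otimes> I)\<close>.
\<close>

definition uq2_ideal :: "nat \<Rightarrow> complex \<Rightarrow> free_alg2 set" where
  "uq2_ideal p q = genideal monoid_alg
     ((\<lambda>x. tens x 1) ` uq_ideal p q \<union> (\<lambda>x. tens 1 x) ` uq_ideal p q)"

definition uq2 :: "nat \<Rightarrow> complex \<Rightarrow> free_alg2 set ring" where
  "uq2 p q = monoid_alg Quot uq2_ideal p q"

definition uq2_class :: "nat \<Rightarrow> complex \<Rightarrow> free_alg2 \<Rightarrow> free_alg2 set" where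
  "uq2_class p q x = uq2_ideal p q +>\<^bsub>monoid_alg\<^esub> x"

text \<open>
  The map induced on a quotient by a map \<open>f\<close> that is constant on cosets: the value at a coset
  is the common value of \<open>f\<close> on its elements.
\<close>

definition induced :: "('a \<Rightarrow> 'b) \<Rightarrow> 'a set \<Rightarrow> 'b" where
  "induced f A = the_elem (f ` A)"

fun comult_gen :: "nat \<Rightarrow> gen \<Rightarrow> free_alg2" where
  "comult_gen p GE = tens 1 gE + tens gE gK"
| "comult_gen p GF = tens gF 1 + tens (Kinv p) gF"
| "comult_gen p GK = tens gK gK"

definition comult :: "nat \<Rightarrow> complex \<Rightarrow> free_alg set \<Rightarrow> free_alg2 set" where
  "comult p q = induced (\<lambda>x. uq2_class p q (free_hom scal (comult_gen p) x))"

fun counit_gen :: "gen \<Rightarrow> complex" where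
  "counit_gen GE = 0"
| "counit_gen GF = 0"
| "counit_gen GK = 1"

definition counit :: "free_alg set \<Rightarrow> complex" where
  "counit = induced (free_hom id counit_gen)"

section \<open>Finite-dimensional modules and their tensor products\<close>

text \<open>
  \<open>kron A B\<close> is the matrix of the tensor product of two linear maps with respect to the
  lexicographically ordered product bases.
\<close>

definition kron :: "complex mat \<Rightarrow> complex mat \<Rightarrow> complex mat" where
  "kron A B = mat (dim_row A * dim_row B) (dim_col A * dim_col B)
     (\<lambda>(i, j). A $$ (i div dim_row B, j div dim_col B) * B $$ (i mod dim_row B, j mod dim_col B))"

definition kron_list :: "complex mat list \<Rightarrow> complex mat" where
  "kron_list As = foldr kron As (1\<^sub>m 1)"

definition msum :: "nat \<Rightarrow> ('i \<Rightarrow> complex mat) \<Rightarrow> 'i set \<Rightarrow> complex mat" where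
  "msum d f A = mat d d (\<lambda>ij. \<Sum>a\<in>A. f a $$ ij)"

text \<open>
  A module is a pair \<open>(d, \<rho>)\<close> of a dimension and a unital complex-algebra homomorphism from the
  small quantum group to the \<open>d \<times> d\<close> matrices. Every finite-dimensional module is isomorphic
  to one of this form.  The function \<open>\<rho>\<close> is \<open>undefined\<close> outside the carrier, so that modules
  with the same action are equal.
\<close>

type_synonym hmod = "nat \<times> (free_alg set \<Rightarrow> complex mat)"

definition modules :: "nat \<Rightarrow> complex \<Rightarrow> hmod set" where
  "modules p q = {(d, \<rho>).
     \<rho> \<in> Ring.ring_hom (uq p q) (ring_mat TYPE(complex) d ()) \<and>
     (\<forall>c. \<rho> (uq_class p q (scal c)) = c \<cdot>\<^sub>m 1\<^sub>m d) \<and>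
     \<rho> \<in> extensional (carrier (uq p q))}"

definition mod_hom :: "nat \<Rightarrow> complex \<Rightarrow> hmod \<Rightarrow> hmod \<Rightarrow> complex mat set" where
  "mod_hom p q X Y = {\<phi> \<in> carrier_mat (fst Y) (fst X).
     \<forall>h\<in>carrier (uq p q). \<phi> * snd X h = snd Y h * \<phi>}"

definition unit_mod :: "nat \<Rightarrow> complex \<Rightarrow> hmod" where
  "unit_mod p q = (1, \<lambda>h\<in>carrier (uq p q). counit h \<cdot>\<^sub>m 1\<^sub>m 1)"

text \<open>
  The action of the tensor square of the small quantum group on the tensor product of the
  underlying spaces of \<open>X\<close> and \<open>Y\<close>, lifted to the tensor square of the free algebra.
\<close>

definition tensor_rep :: "nat \<Rightarrow> complex \<Rightarrow> hmod \<Rightarrow> hmod \<Rightarrow> free_alg2 \<Rightarrow> complex mat" where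
  "tensor_rep p q X Y s = msum (fst X * fst Y)
     (\<lambda>(u, v). Poly_Mapping.lookup s (u, v) \<cdot>\<^sub>m
        kron (snd X (uq_class p q (Poly_Mapping.single u 1)))
             (snd Y (uq_class p q (Poly_Mapping.single v 1))))
     (Poly_Mapping.keys s)"

definition tensor_mod :: "nat \<Rightarrow> complex \<Rightarrow> hmod \<Rightarrow> hmod \<Rightarrow> hmod" where
  "tensor_mod p q X Y =
     (fst X * fst Y, \<lambda>h\<in>carrier (uq p q). induced (tensor_rep p q X Y) (comult p q h))"

fun tensor_list :: "nat \<Rightarrow> complex \<Rightarrow> hmod list \<Rightarrow> hmod" where
  "tensor_list p q [] = unit_mod p q"
| "tensor_list p q [X] = X"
| "tensor_list p q (X # Y # Xs) = tensor_mod p q X (tensor_list p q (Y # Xs))"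

section \<open>Davydov--Yetter cohomology of the identity functor\<close>

definition tuples :: "nat \<Rightarrow> complex \<Rightarrow> nat \<Rightarrow> hmod list set" where
  "tuples p q n = {Xs. length Xs = n \<and> set Xs \<subseteq> modules p q}"

text \<open>
  The natural endomorphisms of the functor sending \<open>X\<^sub>1, \<dots>, X\<^sub>n\<close> to
  \<open>X\<^sub>1 \<otimes> \<dots> \<otimes> X\<^sub>n\<close>. As the bracketing of Kronecker products is immaterial, the
  associators of the category are identity matrices.
\<close>

definition DY_cochains :: "nat \<Rightarrow> complex \<Rightarrow> nat \<Rightarrow> (hmod list \<Rightarrow> complex mat) set" where
  "DY_cochains p q n =
     {f \<in> (\<Pi>\<^sub>E Xs\<in>tuples p q n. mod_hom p q (tensor_list p q Xs) (tensor_list p q Xs)).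
       \<forall>Xs\<in>tuples p q n. \<forall>Ys\<in>tuples p q n. \<forall>\<phi>s.
         length \<phi>s = n \<longrightarrow> (\<forall>i<n. \<phi>s ! i \<in> mod_hom p q (Xs ! i) (Ys ! i)) \<longrightarrow>
         f Ys * kron_list \<phi>s = kron_list \<phi>s * f Xs}"

definition DY_cochain_group ::
    "nat \<Rightarrow> complex \<Rightarrow> nat \<Rightarrow> (hmod list \<Rightarrow> complex mat) monoid" where
  "DY_cochain_group p q n =
     \<lparr>carrier = DY_cochains p q n,
      monoid.mult = (\<lambda>f g. \<lambda>Xs\<in>tuples p q n. f Xs + g Xs),
      one = (\<lambda>Xs\<in>tuples p q n. 0\<^sub>m (fst (tensor_list p q Xs)) (fst (tensor_list p q Xs)))\<rparr>"

text \<open>\<open>merge p q i [X\<^sub>0, \<dots>, X\<^sub>n]\<close> is \<open>[X\<^sub>0, \<dots>, X\<^sub>i\<^sub>-\<^sub>1 \<otimes> X\<^sub>i, \<dots>, X\<^sub>n]\<close>, for \<open>1 \<le> i \<le> n\<close>.\<close>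

definition merge :: "nat \<Rightarrow> complex \<Rightarrow> nat \<Rightarrow> hmod list \<Rightarrow> hmod list" where
  "merge p q i Xs =
     take (i - 1) Xs @ tensor_mod p q (Xs ! (i - 1)) (Xs ! i) # drop (i + 1) Xs"

definition DY_diff :: "nat \<Rightarrow> complex \<Rightarrow> nat \<Rightarrow>
    (hmod list \<Rightarrow> complex mat) \<Rightarrow> (hmod list \<Rightarrow> complex mat)" where
  "DY_diff p q n f = (\<lambda>Xs\<in>tuples p q (n + 1).
     kron (1\<^sub>m (fst (hd Xs))) (f (tl Xs))
     + msum (fst (tensor_list p q Xs)) (\<lambda>i. (-1) ^ i \<cdot>\<^sub>m f (merge p q i Xs)) {1..n}
     + (-1) ^ (n + 1) \<cdot>\<^sub>m kron (f (butlast Xs)) (1\<^sub>m (fst (last Xs))))"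

definition DY_cocycles :: "nat \<Rightarrow> complex \<Rightarrow> nat \<Rightarrow> (hmod list \<Rightarrow> complex mat) set" where
  "DY_cocycles p q n =
     kernel (DY_cochain_group p q n) (DY_cochain_group p q (n + 1)) (DY_diff p q n)"

fun DY_coboundaries :: "nat \<Rightarrow> complex \<Rightarrow> nat \<Rightarrow> (hmod list \<Rightarrow> complex mat) set" where
  "DY_coboundaries p q 0 = {\<one>\<^bsub>DY_cochain_group p q 0\<^esub>}"
| "DY_coboundaries p q (Suc n) = DY_diff p q n ` DY_cochains p q n"

text \<open>Only the additive group of the cohomology space is recorded.\<close>

definition DY_cohomology ::
    "nat \<Rightarrow> complex \<Rightarrow> nat \<Rightarrow> (hmod list \<Rightarrow> complex mat) set monoid" where
  "DY_cohomology p q n =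
     (DY_cochain_group p q n)\<lparr>carrier := DY_cocycles p q n\<rparr> Mod DY_coboundaries p q n"

end

theory Submission
  imports Defs
begin

text \<open>
  Let \<open>H\<close> be the small quantum group, with basis the monomials \<open>F ^ i * K ^ j * E ^ k\<close> for
  \<open>i, j, k < p\<close>. By naturality a 2-cochain is determined by its value on the cyclic vector of
  \<open>R \<otimes> R\<close>, where \<open>R\<close> is the regular module, so it is the action of an element of
  \<open>H \<otimes> H\<close> that commutes with the image of the coproduct (\<open>cochain2_formula\<close>,
  \<open>cochain2_invariant\<close>). The regular module is constructed explicitly, which also gives the linear
  independence of the monomials.

  Read on the dual algebra of \<open>H\<close>, a cochain is a Hochschild cochain with trivial coefficients.
  The coproduct of a monomial does not see the relation between \<open>E\<close> and \<open>F\<close>, so the dual algebra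
  is a truncated quantum plane together with \<open>p\<close> orthogonal idempotents, dual to the powers of
  \<open>K\<close> (\<open>dualmult_formula\<close>). A cocycle can be normalised to vanish on these idempotents
  (\<open>normalise_cocycle\<close>). Commutation with the coproduct of \<open>K\<close> and the oddness of \<open>p\<close> then leave
  only the bidegrees \<open>(p, 0)\<close> and \<open>(0, p)\<close> in \<open>F\<close> and \<open>E\<close> (\<open>reduced_support\<close>), where the
  complex does have non-trivial classes. Commutation with the coproducts of \<open>E\<close> and \<open>F\<close> excludes
  them (\<open>typeF_vanishes\<close>, \<open>typeE_vanishes\<close>).

  Hence an invariant cocycle is \<open>1 \<otimes> x - \<Delta> x + x \<otimes> 1\<close> for some \<open>x\<close> of degree zero, and it
  remains to see that \<open>x\<close> is central. Invariance makes \<open>[x, E]\<close> and \<open>[x, F]\<close> skew-primitive, so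
  that \<open>[x, E] = l E\<close> and \<open>[x, F] = m F\<close> (\<open>xE_eq\<close>, \<open>yF_eq\<close>). Following a highest weight vector
  through Verma modules from weight \<open>1\<close> to weight \<open>q\<^sup>-\<^sup>2\<close> and back shows \<open>p m = 0\<close>
  (\<open>F_eigenvalue_zero\<close>), and then the relation for \<open>E F - F E\<close> gives \<open>l = 0\<close>
  (\<open>E_eigenvalue_zero\<close>). So \<open>x\<close> acts on modules by a natural endomorphism, which is a 1-cochain
  with the given coboundary.
\<close>

section \<open>Monoid algebras, tensors and two-sided ideals\<close>

definition smul :: "complex \<Rightarrow> ('m::monoid_add \<Rightarrow>\<^sub>0 complex) \<Rightarrow> ('m \<Rightarrow>\<^sub>0 complex)"
    (infixr \<open>\<cdot>\<close> 75) where
  "c \<cdot> x = scal c * x"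

lemma poly_mapping_additive_induct:
  fixes x :: "'m \<Rightarrow>\<^sub>0 complex"
  assumes "\<And>u a. P (Poly_Mapping.single u a)" and "\<And>x y. P x \<Longrightarrow> P y \<Longrightarrow> P (x + y)"
  shows "P x"
proof (induction x rule: update_induct)
  case const
  show ?case using assms(1)[of undefined 0] by simp
next
  case (update f a b)
  have "Poly_Mapping.update a b f = f + Poly_Mapping.single a b"
    using update(1)
    by (intro poly_mapping_eqI)
       (auto simp: lookup_update lookup_add lookup_single when_def in_keys_iff)
  then show ?case using assms update by simp
qed

lemma single_conv_smul: "Poly_Mapping.single u a = a \<cdot> Poly_Mapping.single u 1"
  for u :: "'m::monoid_add"
  by (simp add: smul_def scal_def mult_single)

lemma scal_add: "scal (a + b) = scal a + scal b"
  and scal_mult: "scal (a * b) = scal a * scal b"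
  and scal_0: "scal 0 = 0"
  and scal_1: "scal 1 = 1"
  by (simp_all add: scal_def single_add mult_single)

lemma scal_central: "x * scal c = scal c * x"
proof (induction x rule: poly_mapping_additive_induct)
  case (1 u a) then show ?case by (simp add: scal_def mult_single mult.commute)
next
  case (2 x y) then show ?case by (simp add: algebra_simps)
qed

lemma smul_mult_left [simp]: "(c \<cdot> x) * y = c \<cdot> (x * y)"
  by (simp add: smul_def mult.assoc)

lemma smul_mult_right [simp]: "x * (c \<cdot> y) = c \<cdot> (x * y)"
  by (simp add: smul_def mult.assoc[symmetric] scal_central)

lemma smul_smul [simp]: "a \<cdot> b \<cdot> x = (a * b) \<cdot> x"
  by (simp add: smul_def scal_mult mult.assoc)

lemma smul_zero [simp]: "0 \<cdot> x = 0" "c \<cdot> 0 = 0"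
  by (simp_all add: smul_def scal_0)

lemma smul_one [simp]: "1 \<cdot> x = x"
  by (simp add: smul_def scal_1)

lemma smul_add: "c \<cdot> (x + y) = c \<cdot> x + c \<cdot> y"
  and smul_diff: "c \<cdot> (x - y) = c \<cdot> x - c \<cdot> y"
  by (simp_all add: smul_def algebra_simps)

lemma smul_minus: "c \<cdot> (- x) = - (c \<cdot> x)"
  by (simp add: smul_def)

lemma add_smul: "(a + b) \<cdot> x = a \<cdot> x + b \<cdot> x"
  by (simp add: smul_def scal_add algebra_simps)

lemma minus_smul: "(- a) \<cdot> x = - (a \<cdot> x)"
proof -
  have "(- a) \<cdot> x + a \<cdot> x = 0" by (simp add: add_smul[symmetric])
  then show ?thesis by (simp add: eq_neg_iff_add_eq_0)
qed

lemma diff_smul: "(a - b) \<cdot> x = a \<cdot> x - b \<cdot> x"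
  using add_smul[of a "- b" x] by (simp add: minus_smul)

lemma smul_sum: "c \<cdot> (\<Sum>i\<in>S. f i) = (\<Sum>i\<in>S. c \<cdot> f i)"
  by (simp add: smul_def sum_distrib_left)

lemma sum_smul: "(\<Sum>i\<in>S. a i) \<cdot> x = (\<Sum>i\<in>S. a i \<cdot> x)"
  by (induction S rule: infinite_finite_induct) (simp_all add: add_smul)

lemma scal_conv_smul: "scal c = c \<cdot> 1"
  by (simp add: smul_def)

lemma lookup_tens:
  "Poly_Mapping.lookup (tens x y) (u, v) = Poly_Mapping.lookup x u * Poly_Mapping.lookup y v"
proof -
  have "Poly_Mapping.lookup (tens x y) (u, v) =
     (\<Sum>u'\<in>Poly_Mapping.keys x. \<Sum>v'\<in>Poly_Mapping.keys y.
       (if u' = u then if v' = v then Poly_Mapping.lookup x u * Poly_Mapping.lookup y v else 0 else 0))"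
    unfolding tens_def lookup_sum by (intro sum.cong) (auto simp: lookup_single when_def)
  also have "\<dots> = (\<Sum>u'\<in>Poly_Mapping.keys x. if u' = u then
       (\<Sum>v'\<in>Poly_Mapping.keys y. if v' = v then Poly_Mapping.lookup x u * Poly_Mapping.lookup y v else 0) else 0)"
    by (intro sum.cong) auto
  also have "\<dots> = Poly_Mapping.lookup x u * Poly_Mapping.lookup y v"
    by (auto simp: sum.delta in_keys_iff)
  finally show ?thesis .
qed

lemma tens_add_left: "tens (x + x') y = tens x y + tens x' y"
  and tens_add_right: "tens x (y + y') = tens x y + tens x y'"
  and tens_diff_left: "tens (x - x') y = tens x y - tens x' y"
  and tens_diff_right: "tens x (y - y') = tens x y - tens x y'"
  and tens_0_left [simp]: "tens 0 y = 0"
  and tens_0_right [simp]: "tens x 0 = 0"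
  by (rule poly_mapping_eqI; clarsimp simp: lookup_tens lookup_add lookup_minus algebra_simps)+

lemma tens_single:
  "tens (Poly_Mapping.single u a) (Poly_Mapping.single v b) = Poly_Mapping.single (u, v) (a * b)"
  by (rule poly_mapping_eqI) (clarsimp simp: lookup_tens lookup_single when_def)

lemma tens_mult: "tens x y * tens x' y' = tens (x * x') (y * y')"
proof (induction x rule: poly_mapping_additive_induct)
  case (2 x1 x2) then show ?case by (simp add: tens_add_left distrib_right)
next
  case (1 u a)
  show ?case
  proof (induction y rule: poly_mapping_additive_induct)
    case (2 y1 y2) then show ?case by (simp add: tens_add_right distrib_right)
  next
    case (1 v b)
    show ?case
    proof (induction x' rule: poly_mapping_additive_induct)
      case (2 x1 x2) then show ?case by (simp add: tens_add_left distrib_left)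
    next
      case (1 u' a')
      show ?case
      proof (induction y' rule: poly_mapping_additive_induct)
        case (2 y1 y2) then show ?case by (simp add: tens_add_right distrib_left)
      next
        case (1 v' b')
        show ?case by (simp add: tens_single mult_single mult.commute mult.left_commute)
      qed
    qed
  qed
qed

lemma tens_one: "tens 1 1 = 1"
  using tens_single[of 0 1 0 1] by (simp add: zero_prod_def[symmetric])

lemma tens_smul_left [simp]: "tens (c \<cdot> x) y = c \<cdot> tens x y"
  and tens_smul_right [simp]: "tens x (c \<cdot> y) = c \<cdot> tens x y"
proof -
  have s1: "tens (scal c) 1 = scal c" and s2: "tens 1 (scal c) = scal c"
    using tens_single[of 0 c 0 1] tens_single[of 0 1 0 c]
    by (simp_all add: scal_def zero_prod_def[symmetric])
  show "tens (c \<cdot> x) y = c \<cdot> tens x y"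
    using tens_mult[of "scal c" 1 x y] by (simp add: smul_def s1)
  show "tens x (c \<cdot> y) = c \<cdot> tens x y"
    using tens_mult[of 1 "scal c" x y] by (simp add: smul_def s2)
qed

lemma tens_power: "tens x y ^ n = tens (x ^ n) (y ^ n)"
  by (induction n) (simp_all add: tens_one tens_mult)

lemma tens_sum_left: "tens (\<Sum>i\<in>S. f i) y = (\<Sum>i\<in>S. tens (f i) y)"
  by (induction S rule: infinite_finite_induct) (simp_all add: tens_add_left)

lemma tens_sum_right: "tens x (\<Sum>i\<in>S. f i) = (\<Sum>i\<in>S. tens x (f i))"
  by (induction S rule: infinite_finite_induct) (simp_all add: tens_add_right)

definition two_sided :: "'a::ring_1 set \<Rightarrow> bool" where
  "two_sided J \<longleftrightarrow> 0 \<in> J \<and> (\<forall>x\<in>J. \<forall>y\<in>J. x + y \<in> J) \<and> (\<forall>x\<in>J. \<forall>r. r * x \<in> J \<and> x * r \<in> J)"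

definition cg :: "'a::ring_1 set \<Rightarrow> 'a \<Rightarrow> 'a \<Rightarrow> bool" where
  "cg J x y \<longleftrightarrow> x - y \<in> J"

lemma ring_monoid_alg: "ring (monoid_alg :: ('m::monoid_add \<Rightarrow>\<^sub>0 complex) ring)"
proof (rule ringI)
  show "abelian_group (monoid_alg :: ('m \<Rightarrow>\<^sub>0 complex) ring)"
    by (rule abelian_groupI)
       (auto simp: monoid_alg_def algebra_simps intro: exI[of _ "- x" for x] left_minus)
  show "Group.monoid (monoid_alg :: ('m \<Rightarrow>\<^sub>0 complex) ring)"
    by (rule monoidI) (auto simp: monoid_alg_def algebra_simps)
qed (auto simp: monoid_alg_def algebra_simps)

lemma monoid_alg_simps [simp]:
  "carrier monoid_alg = UNIV" "(x \<otimes>\<^bsub>monoid_alg\<^esub> y) = x * y" "(x \<oplus>\<^bsub>monoid_alg\<^esub> y) = x + y"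
  "\<one>\<^bsub>monoid_alg\<^esub> = 1" "\<zero>\<^bsub>monoid_alg\<^esub> = 0"
  by (simp_all add: monoid_alg_def)

lemma minus_monoid_alg [simp]: "\<ominus>\<^bsub>monoid_alg\<^esub> x = - x"
proof -
  interpret ring "monoid_alg :: ('a \<Rightarrow>\<^sub>0 complex) ring" by (rule ring_monoid_alg)
  show ?thesis by (rule minus_equality) simp_all
qed

lemma diff_monoid_alg [simp]: "x \<ominus>\<^bsub>monoid_alg\<^esub> y = x - y"
  by (simp add: a_minus_def)

lemma ideal_iff_two_sided: "ideal J monoid_alg \<longleftrightarrow> two_sided J"
proof
  assume "ideal J monoid_alg"
  then interpret ideal J monoid_alg .
  show "two_sided J"
    unfolding two_sided_def
    using additive_subgroup.zero_closed[OF is_additive_subgroup]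
      additive_subgroup.a_closed[OF is_additive_subgroup] I_l_closed I_r_closed by simp
next
  assume J: "two_sided J"
  have neg: "- x \<in> J" if "x \<in> J" for x
    using J that unfolding two_sided_def by (metis mult_minus1)
  show "ideal J monoid_alg"
  proof (rule idealI[OF ring_monoid_alg])
    show "subgroup J (add_monoid monoid_alg)"
    proof (rule subgroup.intro)
      fix x assume x: "x \<in> J"
      have "inv\<^bsub>add_monoid monoid_alg\<^esub> x = - x"
        using minus_monoid_alg[of x] unfolding a_inv_def .
      then show "inv\<^bsub>add_monoid monoid_alg\<^esub> x \<in> J"
        using neg[OF x] by (simp only:)
    qed (use J in \<open>auto simp: two_sided_def\<close>)
  qed (use J in \<open>auto simp: two_sided_def\<close>)
qed

context
  fixes J :: "'a::ring_1 set"
  assumes J: "two_sided J"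
begin

lemma two_sided_add: "x \<in> J \<Longrightarrow> y \<in> J \<Longrightarrow> x + y \<in> J"
  and two_sided_zero: "0 \<in> J"
  and two_sided_lmult: "x \<in> J \<Longrightarrow> r * x \<in> J"
  and two_sided_rmult: "x \<in> J \<Longrightarrow> x * r \<in> J"
  using J by (auto simp: two_sided_def)

lemma two_sided_neg: "x \<in> J \<Longrightarrow> - x \<in> J"
  using two_sided_lmult[of x "-1"] by simp

lemma two_sided_diff: "x \<in> J \<Longrightarrow> y \<in> J \<Longrightarrow> x - y \<in> J"
  using two_sided_add[of x "- y"] two_sided_neg by simp

lemma two_sided_sum: "(\<And>i. i \<in> S \<Longrightarrow> f i \<in> J) \<Longrightarrow> (\<Sum>i\<in>S. f i) \<in> J"
  by (induction S rule: infinite_finite_induct) (auto intro: two_sided_add two_sided_zero)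

lemma cg_refl: "cg J x x"
  by (simp add: cg_def two_sided_zero)

lemma cg_sym: "cg J x y \<Longrightarrow> cg J y x"
  using two_sided_neg[of "x - y"] by (simp add: cg_def)

lemma cg_trans: "cg J x y \<Longrightarrow> cg J y z \<Longrightarrow> cg J x z"
  using two_sided_add[of "x - y" "y - z"] by (simp add: cg_def)

lemma cg_add: "cg J x y \<Longrightarrow> cg J x' y' \<Longrightarrow> cg J (x + x') (y + y')"
  using two_sided_add[of "x - y" "x' - y'"] by (simp add: cg_def algebra_simps)

lemma cg_minus: "cg J x y \<Longrightarrow> cg J (- x) (- y)"
  using two_sided_neg[of "x - y"] by (simp add: cg_def)

lemma cg_diff: "cg J x y \<Longrightarrow> cg J x' y' \<Longrightarrow> cg J (x - x') (y - y')"
  using two_sided_diff[of "x - y" "x' - y'"] by (simp add: cg_def algebra_simps)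

lemma cg_mult: "cg J x y \<Longrightarrow> cg J x' y' \<Longrightarrow> cg J (x * x') (y * y')"
  using two_sided_add[OF two_sided_rmult[of "x - y" x'] two_sided_lmult[of "x' - y'" y]]
  by (simp add: cg_def algebra_simps)

lemma cg_sum: "(\<And>i. i \<in> S \<Longrightarrow> cg J (f i) (g i)) \<Longrightarrow> cg J (\<Sum>i\<in>S. f i) (\<Sum>i\<in>S. g i)"
  using two_sided_sum[of S "\<lambda>i. f i - g i"] by (simp add: cg_def sum_subtractf)

lemma cg_power: "cg J x y \<Longrightarrow> cg J (x ^ n) (y ^ n)"
  by (induction n) (auto intro: cg_refl cg_mult)

end

lemma cg_smul: "two_sided J \<Longrightarrow> cg J x y \<Longrightarrow> cg J (c \<cdot> x) (c \<cdot> y)"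
  unfolding smul_def by (intro cg_mult cg_refl)

text \<open>
  The quotient algebras depend on \<open>p\<close> and \<open>q\<close> and are carrier sets, not types. Calculating with
  representatives modulo an ideal keeps the type class operations of the monoid algebra.
\<close>

locale cong_ideal =
  fixes J :: "('m::monoid_add \<Rightarrow>\<^sub>0 complex) set"
  assumes two_sided: "two_sided J"
begin

lemmas crefl [simp, intro] = cg_refl[OF two_sided]
lemmas csym = cg_sym[OF two_sided]
lemmas ctrans [trans] = cg_trans[OF two_sided]
lemmas cmult = cg_mult[OF two_sided]
lemmas cadd = cg_add[OF two_sided]
lemmas cdiff = cg_diff[OF two_sided]
lemmas csmul = cg_smul[OF two_sided]
lemmas csum = cg_sum[OF two_sided]
lemmas cpower = cg_power[OF two_sided]

lemma cmult_l: "cg J x y \<Longrightarrow> cg J (z * x) (z * y)"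
  and cmult_r: "cg J x y \<Longrightarrow> cg J (x * z) (y * z)"
  by (auto intro: cmult)

section \<open>Calculations with q-commuting elements\<close>

lemma qcomm_power:
  assumes "cg J (y * x) (r \<cdot> (x * y))"
  shows "cg J (y ^ m * x ^ n) (r ^ (m * n) \<cdot> (x ^ n * y ^ m))"
proof -
  have one: "cg J (y * x ^ n) (r ^ n \<cdot> (x ^ n * y))" for n
  proof (induction n)
    case (Suc n)
    have "y * x ^ Suc n = (y * x ^ n) * x" by (simp only: power_Suc2 mult.assoc)
    also have "cg J \<dots> ((r ^ n \<cdot> (x ^ n * y)) * x)" by (rule cmult_r[OF Suc])
    also have "(r ^ n \<cdot> (x ^ n * y)) * x = r ^ n \<cdot> (x ^ n * (y * x))" by (simp add: mult.assoc)
    also have "cg J \<dots> (r ^ n \<cdot> (x ^ n * (r \<cdot> (x * y))))" by (intro csmul cmult_l assms)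
    also have "r ^ n \<cdot> (x ^ n * (r \<cdot> (x * y))) = r ^ Suc n \<cdot> (x ^ Suc n * y)"
      by (simp only: smul_mult_right smul_smul power_Suc2 mult.assoc mult.commute)
    finally show ?case .
  qed simp
  show ?thesis
  proof (induction m)
    case (Suc m)
    have "y ^ Suc m * x ^ n = y * (y ^ m * x ^ n)" by (simp add: mult.assoc)
    also have "cg J \<dots> (y * (r ^ (m * n) \<cdot> (x ^ n * y ^ m)))" by (rule cmult_l[OF Suc])
    also have "\<dots> = r ^ (m * n) \<cdot> ((y * x ^ n) * y ^ m)" by (simp add: mult.assoc)
    also have "cg J \<dots> (r ^ (m * n) \<cdot> ((r ^ n \<cdot> (x ^ n * y)) * y ^ m))"
      by (intro csmul cmult_r one)
    also have "\<dots> = r ^ (Suc m * n) \<cdot> (x ^ n * y ^ Suc m)"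
      by (simp add: mult.assoc power_add mult.commute)
    finally show ?case .
  qed simp
qed

end

fun gauss_binom :: "complex \<Rightarrow> nat \<Rightarrow> nat \<Rightarrow> complex" where
  "gauss_binom r n 0 = 1"
| "gauss_binom r 0 (Suc k) = 0"
| "gauss_binom r (Suc n) (Suc k) = gauss_binom r n k + r ^ Suc k * gauss_binom r n (Suc k)"

lemma gauss_binom_eq_0: "n < k \<Longrightarrow> gauss_binom r n k = 0"
  by (induction r n k rule: gauss_binom.induct) auto

lemma gauss_binom_self [simp]: "gauss_binom r n n = 1"
  by (induction n) (simp_all add: gauss_binom_eq_0)

lemma gauss_binom_prod:
  "k \<le> n \<Longrightarrow> gauss_binom r n k * (\<Prod>i<k. 1 - r ^ Suc i) = (\<Prod>i<k. 1 - r ^ (n - i))"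
proof (induction r n k rule: gauss_binom.induct)
  case (3 r n k)
  then have k: "k \<le> n" by simp
  let ?P = "\<Prod>i<k. 1 - r ^ (n - i)"
  have "r ^ Suc k * r ^ (n - k) = r ^ Suc n"
    using k by (simp flip: power_add)
  then have e: "(1 - r ^ Suc k) + r ^ Suc k * (1 - r ^ (n - k)) = 1 - r ^ Suc n"
    by (simp only: right_diff_distrib) simp
  have a: "gauss_binom r n k * (\<Prod>i<k. 1 - r ^ Suc i) = ?P" using 3(1) k by simp
  have b: "gauss_binom r n (Suc k) * (\<Prod>i<Suc k. 1 - r ^ Suc i) = ?P * (1 - r ^ (n - k))"
  proof (cases "k = n")
    case True
    then show ?thesis by (simp add: gauss_binom_eq_0)
  next
    case False
    then show ?thesis using 3(2) k by simp
  qed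
  have "gauss_binom r (Suc n) (Suc k) * (\<Prod>i<Suc k. 1 - r ^ Suc i)
    = (1 - r ^ Suc k) * (gauss_binom r n k * (\<Prod>i<k. 1 - r ^ Suc i))
      + r ^ Suc k * (gauss_binom r n (Suc k) * (\<Prod>i<Suc k. 1 - r ^ Suc i))"
    by (simp add: algebra_simps)
  also have "\<dots> = ?P * ((1 - r ^ Suc k) + r ^ Suc k * (1 - r ^ (n - k)))"
    unfolding a b by (simp add: algebra_simps)
  also have "\<dots> = (\<Prod>i<Suc k. 1 - r ^ (Suc n - i))"
    unfolding e prod.lessThan_Suc_shift by simp
  finally show ?case .
qed auto

lemma gauss_binom_root_of_unity:
  assumes "r ^ p = 1" and "\<And>k. 0 < k \<Longrightarrow> k < p \<Longrightarrow> r ^ k \<noteq> 1" and "0 < k" "k < p"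
  shows "gauss_binom r p k = 0"
proof -
  have "(\<Prod>i<k. 1 - r ^ (p - i)) = 0"
    using assms by (intro prod_zero bexI[of _ 0]) auto
  moreover have "(\<Prod>i<k. 1 - r ^ Suc i) \<noteq> 0"
    using assms by (auto simp del: power_Suc)
  ultimately show ?thesis
    using gauss_binom_prod[of k p r] assms(4) by (metis less_imp_le mult_eq_0_iff)
qed

context cong_ideal
begin

lemma gauss_binomial:
  assumes "cg J (y * x) (r \<cdot> (x * y))"
  shows "cg J ((x + y) ^ n) (\<Sum>k\<le>n. gauss_binom r n k \<cdot> (x ^ (n - k) * y ^ k))"
proof (induction n)
  case (Suc n)
  let ?G = "gauss_binom r"
  let ?t = "\<lambda>n k. x ^ (n - k) * y ^ k"
  have step: "cg J ((?G n k \<cdot> ?t n k) * (x + y))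
      ((r ^ k * ?G n k) \<cdot> ?t (Suc n) k + ?G n k \<cdot> ?t (Suc n) (Suc k))" if "k \<le> n" for k
  proof -
    have "(?G n k \<cdot> ?t n k) * (x + y)
      = ?G n k \<cdot> (x ^ (n - k) * (y ^ k * x ^ 1)) + ?G n k \<cdot> (x ^ (n - k) * y ^ Suc k)"
      by (simp add: distrib_left smul_add mult.assoc power_Suc2 del: power_Suc)
    also have "cg J \<dots> (?G n k \<cdot> (x ^ (n - k) * (r ^ (k * 1) \<cdot> (x ^ 1 * y ^ k)))
        + ?G n k \<cdot> (x ^ (n - k) * y ^ Suc k))"
      by (intro cadd csmul cmult_l qcomm_power assms crefl)
    also have "x ^ (n - k) * (r ^ (k * 1) \<cdot> (x ^ 1 * y ^ k)) = r ^ k \<cdot> ?t (Suc n) k"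
      using that by (simp add: Suc_diff_le power_Suc2 mult.assoc del: power_Suc)
    finally show ?thesis by (simp add: mult.commute)
  qed
  have "(x + y) ^ Suc n = (x + y) ^ n * (x + y)" by (rule power_Suc2)
  also have "cg J \<dots> ((\<Sum>k\<le>n. ?G n k \<cdot> ?t n k) * (x + y))" by (rule cmult_r[OF Suc])
  also have "\<dots> = (\<Sum>k\<le>n. (?G n k \<cdot> ?t n k) * (x + y))" by (rule sum_distrib_right)
  also have "cg J \<dots> (\<Sum>k\<le>n. (r ^ k * ?G n k) \<cdot> ?t (Suc n) k + ?G n k \<cdot> ?t (Suc n) (Suc k))"
    by (intro csum step) simp
  also have "\<dots> = (\<Sum>k\<le>n. (r ^ k * ?G n k) \<cdot> ?t (Suc n) k) + (\<Sum>k\<le>n. ?G n k \<cdot> ?t (Suc n) (Suc k))"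
    by (rule sum.distrib)
  also have "(\<Sum>k\<le>n. (r ^ k * ?G n k) \<cdot> ?t (Suc n) k)
      = (\<Sum>k\<le>Suc n. (r ^ k * ?G n k) \<cdot> ?t (Suc n) k)"
    by (simp add: gauss_binom_eq_0)
  also have "\<dots> = x ^ Suc n + (\<Sum>k\<le>n. (r ^ Suc k * ?G n (Suc k)) \<cdot> ?t (Suc n) (Suc k))"
    by (simp only: sum.atMost_Suc_shift) simp
  also have "\<dots> + (\<Sum>k\<le>n. ?G n k \<cdot> ?t (Suc n) (Suc k))
      = x ^ Suc n + (\<Sum>k\<le>n. ?G (Suc n) (Suc k) \<cdot> ?t (Suc n) (Suc k))"
    by (simp add: sum.distrib[symmetric] add_smul add.commute add.assoc)
  also have "\<dots> = (\<Sum>k\<le>Suc n. ?G (Suc n) k \<cdot> ?t (Suc n) k)"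
    by (simp only: sum.atMost_Suc_shift) simp
  finally show ?case .
qed simp

end


section \<open>Commutation relations of the small quantum group\<close>

text \<open>The exponents \<open>(i, j, k)\<close> of a monomial \<open>F ^ i * K ^ j * E ^ k\<close>.\<close>

type_synonym expo = "nat \<times> nat \<times> nat"

locale small_q =
  fixes p :: nat and q :: complex
  assumes odd_p: "odd p" and p_ge: "p \<ge> 3" and q_p: "q ^ p = 1"
    and q_prim: "\<And>k. 0 < k \<Longrightarrow> k < p \<Longrightarrow> q ^ k \<noteq> 1"
begin

abbreviation Q :: complex where "Q \<equiv> q ^ 2"
abbreviation Qi :: complex where "Qi \<equiv> inverse (q ^ 2)"
abbreviation c0 :: complex where "c0 \<equiv> 1 / (q - inverse q)"
abbreviation Ki :: free_alg where "Ki \<equiv> Kinv p"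

text \<open>
  The two geometric sums that occur in the commutators of \<open>E\<close> with powers of \<open>F\<close>; both are
  quantum integers up to a power of \<open>q\<close>.
\<close>

definition Sp :: "nat \<Rightarrow> complex" where "Sp n = (\<Sum>r<n. Q ^ r)"
definition Sm :: "nat \<Rightarrow> complex" where "Sm n = (\<Sum>r<n. Qi ^ r)"

lemma q_nz: "q \<noteq> 0"
  using q_p p_ge by (cases "q = 0") (auto simp: power_0_left)

lemma q_power_eq_1_iff: "q ^ k = 1 \<longleftrightarrow> p dvd k"
proof
  assume a: "q ^ k = 1"
  have "q ^ k = q ^ (p * (k div p)) * q ^ (k mod p)"
    by (simp flip: power_add)
  then have "q ^ (k mod p) = 1" using a by (simp add: power_mult q_p)
  moreover have "k mod p < p" using p_ge by simp
  ultimately show "p dvd k" using q_prim[of "k mod p"] by (auto simp: dvd_eq_mod_eq_0)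
next
  assume "p dvd k"
  then show "q ^ k = 1" by (auto simp: power_mult q_p)
qed

lemma p_dvd_double: "p dvd 2 * k \<longleftrightarrow> p dvd k"
  using odd_p by (simp add: coprime_dvd_mult_right_iff)

lemma Q_power_eq_1_iff: "Q ^ k = 1 \<longleftrightarrow> p dvd k"
  by (simp add: power_mult[symmetric] q_power_eq_1_iff p_dvd_double)

lemma Qi_power_eq_1_iff: "Qi ^ k = 1 \<longleftrightarrow> p dvd k"
  by (metis Q_power_eq_1_iff inverse_1 inverse_eq_iff_eq power_inverse)

lemma Q_p [simp]: "Q ^ p = 1" and Qi_p [simp]: "Qi ^ p = 1"
  by (simp_all only: Q_power_eq_1_iff Qi_power_eq_1_iff dvd_refl)

lemma Qi_power_eq_iff: "Qi ^ a = Qi ^ b \<longleftrightarrow> a mod p = b mod p"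
proof -
  have *: "Qi ^ a = Qi ^ b \<longleftrightarrow> a mod p = b mod p" if "a \<le> b" for a b
  proof -
    have "Qi ^ b = Qi ^ a * Qi ^ (b - a)" using that by (simp flip: power_add)
    moreover have "Qi ^ a \<noteq> 0" using q_nz by simp
    ultimately have "Qi ^ a = Qi ^ b \<longleftrightarrow> Qi ^ (b - a) = 1" by (metis mult_cancel_left1)
    also have "\<dots> \<longleftrightarrow> p dvd b - a" by (rule Qi_power_eq_1_iff)
    also have "\<dots> \<longleftrightarrow> a mod p = b mod p"
      using that by (metis mod_eq_dvd_iff_nat)
    finally show ?thesis .
  qed
  show ?thesis using *[of a b] *[of b a] by (cases "a \<le> b") auto
qed

lemma Q_Qi [simp]: "Q * Qi = 1" "Qi * Q = 1"
  using q_nz by simp_all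

lemma Qi_pred: "Qi ^ (p - 1) = Q"
proof -
  have "Qi ^ (p - 1) * Qi = Qi ^ p"
    using p_ge by (metis Suc_diff_1 less_le_trans power_Suc2 zero_less_numeral)
  then have "Qi ^ (p - 1) * Qi * Q = Q" by simp
  then show ?thesis by (simp add: mult.assoc)
qed

lemma Q_ne_1: "Q \<noteq> 1" and Qi_ne_1: "Qi \<noteq> 1"
  using Q_power_eq_1_iff[of 1] Qi_power_eq_1_iff[of 1] p_ge by auto

lemma c0_nz: "c0 \<noteq> 0"
proof -
  have "q - inverse q \<noteq> 0"
  proof
    assume "q - inverse q = 0"
    then have "q * q = 1" using q_nz by (metis eq_iff_diff_eq_0 right_inverse)
    then show False using Q_ne_1 by (simp add: power2_eq_square)
  qed
  then show ?thesis by simp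
qed

lemma Sp_0 [simp]: "Sp 0 = 0" and Sm_0 [simp]: "Sm 0 = 0"
  and Sp_1: "Sp (Suc 0) = 1" and Sm_1: "Sm (Suc 0) = 1"
  and Sp_Suc: "Sp (Suc n) = 1 + Q * Sp n" and Sm_Suc: "Sm (Suc n) = 1 + Qi * Sm n"
  by (simp_all add: Sp_def Sm_def sum.lessThan_Suc_shift sum_distrib_left del: sum.lessThan_Suc)

lemma Sp_geometric: "(1 - Q) * Sp n = 1 - Q ^ n" and Sm_geometric: "(1 - Qi) * Sm n = 1 - Qi ^ n"
  by (simp_all add: Sp_def Sm_def one_diff_power_eq)

lemma Sp_p [simp]: "Sp p = 0" and Sm_p [simp]: "Sm p = 0"
  using Sp_geometric[of p] Sm_geometric[of p] Q_ne_1 Qi_ne_1 by simp_all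

lemma Sm_nz: "0 < n \<Longrightarrow> n < p \<Longrightarrow> Sm n \<noteq> 0"
  using Sm_geometric[of n] Qi_power_eq_1_iff[of n] by (auto dest: nat_dvd_not_less)

lemma Sm_pred: "Sm (p - 1) = - Q" and Sp_pred: "Sp (p - 1) = - Qi"
proof -
  have p: "Suc (p - 1) = p" using p_ge by simp
  have "1 + Qi * Sm (p - 1) = 0" "1 + Q * Sp (p - 1) = 0"
    using Sm_Suc[of "p - 1"] Sp_Suc[of "p - 1"] p by simp_all
  then have "Q * (1 + Qi * Sm (p - 1)) = 0" "Qi * (1 + Q * Sp (p - 1)) = 0" by simp_all
  then show "Sm (p - 1) = - Q" "Sp (p - 1) = - Qi"
    by (simp_all only: distrib_left mult.assoc[symmetric] Q_Qi) (simp_all add: add_eq_0_iff2)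
qed

fun pbw :: "expo \<Rightarrow> free_alg" where
  "pbw (i, j, k) = gF ^ i * gK ^ j * gE ^ k"

end

text \<open>
  The first three relations alone give the commutators of the powers of \<open>E\<close> and \<open>F\<close>. They are
  stated modulo an arbitrary ideal containing these relations, because they are needed both in the
  quantum group and, before \<open>E ^ p = 0\<close> is known, in the construction of its regular module.
\<close>

locale qrel_ideal = small_q p q + cong_ideal J for p q and J :: "free_alg set" +
  assumes KE: "cg J (gK * gE) (q\<^sup>2 \<cdot> (gE * gK))"
    and KF: "cg J (gK * gF) (inverse (q\<^sup>2) \<cdot> (gF * gK))"
    and EF: "cg J (gE * gF) (gF * gE + (1 / (q - inverse q)) \<cdot> (gK - Kinv p))"
begin

lemma KE_power: "cg J (gK ^ m * gE ^ n) (Q ^ (m * n) \<cdot> (gE ^ n * gK ^ m))"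
  and KF_power: "cg J (gK ^ m * gF ^ n) (Qi ^ (m * n) \<cdot> (gF ^ n * gK ^ m))"
  by (intro qcomm_power KE KF)+

lemma EK_power: "cg J (gE ^ n * gK ^ m) (Qi ^ (m * n) \<cdot> (gK ^ m * gE ^ n))"
proof -
  have "cg J (Qi ^ (m * n) \<cdot> (gK ^ m * gE ^ n)) (Qi ^ (m * n) \<cdot> Q ^ (m * n) \<cdot> (gE ^ n * gK ^ m))"
    by (rule csmul[OF KE_power])
  also have "\<dots> = gE ^ n * gK ^ m"
    using q_nz by (simp flip: power_mult_distrib)
  finally show ?thesis by (rule csym)
qed

lemma KF_step: "cg J (gK ^ m * gF) (Qi ^ m \<cdot> (gF * gK ^ m))"
  using KF_power[of m 1] by simp

lemma EK_step: "cg J (gE * gK ^ m) (Qi ^ m \<cdot> (gK ^ m * gE))"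
  using EK_power[of 1 m] by simp

lemma E_F_power:
  "cg J (gE * gF ^ n)
     (gF ^ n * gE + c0 \<cdot> (Sm n \<cdot> (gF ^ (n - 1) * gK) - Sp n \<cdot> (gF ^ (n - 1) * Ki)))"
proof (induction n)
  case (Suc n)
  have a: "cg J (gF ^ (n - 1) * gK * gF) (Qi \<cdot> (gF ^ n * gK))" if "n > 0"
  proof -
    have "cg J (gF ^ (n - 1) * (gK ^ 1 * gF)) (gF ^ (n - 1) * (Qi ^ 1 \<cdot> (gF * gK ^ 1)))"
      by (intro cmult_l KF_step)
    also have "\<dots> = Qi \<cdot> (gF ^ (n - 1) * gF * gK)" by (simp add: mult.assoc)
    also have "gF ^ (n - 1) * gF = gF ^ n" using that by (simp flip: power_Suc2)
    finally show ?thesis by (simp add: mult.assoc)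
  qed
  have b: "cg J (gF ^ (n - 1) * Ki * gF) (Q \<cdot> (gF ^ n * Ki))" if "n > 0"
  proof -
    have "cg J (gF ^ (n - 1) * (gK ^ (p - 1) * gF)) (gF ^ (n - 1) * (Qi ^ (p - 1) \<cdot> (gF * gK ^ (p - 1))))"
      by (intro cmult_l KF_step)
    also have "\<dots> = Q \<cdot> (gF ^ (n - 1) * gF * Ki)" by (simp add: mult.assoc Qi_pred Kinv_def del: One_nat_def)
    also have "gF ^ (n - 1) * gF = gF ^ n" using that by (simp flip: power_Suc2)
    finally show ?thesis by (simp add: mult.assoc Kinv_def)
  qed
  have ab: "cg J (Sm n \<cdot> (gF ^ (n - 1) * gK * gF) - Sp n \<cdot> (gF ^ (n - 1) * Ki * gF))
      (Sm n \<cdot> (Qi \<cdot> (gF ^ n * gK)) - Sp n \<cdot> (Q \<cdot> (gF ^ n * Ki)))"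
  proof (cases "n = 0")
    case False
    then show ?thesis using a b by (intro cdiff csmul) auto
  qed simp
  have "gE * gF ^ Suc n = (gE * gF ^ n) * gF" by (simp only: power_Suc2 mult.assoc)
  also have "cg J \<dots>
      ((gF ^ n * gE + c0 \<cdot> (Sm n \<cdot> (gF ^ (n - 1) * gK) - Sp n \<cdot> (gF ^ (n - 1) * Ki))) * gF)"
    by (rule cmult_r[OF Suc])
  also have "\<dots> = gF ^ n * (gE * gF) + c0 \<cdot> (Sm n \<cdot> (gF ^ (n - 1) * gK * gF) - Sp n \<cdot> (gF ^ (n - 1) * Ki * gF))"
    by (simp add: algebra_simps)
  also have "cg J \<dots> (gF ^ n * (gF * gE + c0 \<cdot> (gK - Ki))
       + c0 \<cdot> (Sm n \<cdot> (Qi \<cdot> (gF ^ n * gK)) - Sp n \<cdot> (Q \<cdot> (gF ^ n * Ki))))"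
    by (intro cadd cmult_l EF csmul ab)
  also have "\<dots> = gF ^ Suc n * gE
      + c0 \<cdot> (Sm (Suc n) \<cdot> (gF ^ (Suc n - 1) * gK) - Sp (Suc n) \<cdot> (gF ^ (Suc n - 1) * Ki))"
    by (simp add: Sm_Suc Sp_Suc add_smul smul_add smul_diff algebra_simps power_commutes
          del: smul_smul) (simp add: algebra_simps, simp add: power_commutes flip: mult.assoc)
  finally show ?case .
qed simp

lemma E_power_F:
  "cg J (gE ^ n * gF)
     (gF * gE ^ n + c0 \<cdot> (Sm n \<cdot> (gK * gE ^ (n - 1)) - Sp n \<cdot> (Ki * gE ^ (n - 1))))"
proof (induction n)
  case (Suc n)
  have a: "cg J (gE * (gK * gE ^ (n - 1))) (Qi \<cdot> (gK * gE ^ n))" if "n > 0"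
  proof -
    have "cg J ((gE * gK ^ 1) * gE ^ (n - 1)) ((Qi ^ 1 \<cdot> (gK ^ 1 * gE)) * gE ^ (n - 1))"
      by (intro cmult_r EK_step)
    also have "\<dots> = Qi \<cdot> (gK * (gE * gE ^ (n - 1)))" by (simp add: mult.assoc)
    also have "gE * gE ^ (n - 1) = gE ^ n" using that by (simp flip: power_Suc)
    finally show ?thesis by (simp add: mult.assoc)
  qed
  have b: "cg J (gE * (Ki * gE ^ (n - 1))) (Q \<cdot> (Ki * gE ^ n))" if "n > 0"
  proof -
    have "cg J ((gE * gK ^ (p - 1)) * gE ^ (n - 1)) ((Qi ^ (p - 1) \<cdot> (gK ^ (p - 1) * gE)) * gE ^ (n - 1))"
      by (intro cmult_r EK_step)
    also have "\<dots> = Q \<cdot> (Ki * (gE * gE ^ (n - 1)))" by (simp add: mult.assoc Qi_pred Kinv_def del: One_nat_def)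
    also have "gE * gE ^ (n - 1) = gE ^ n" using that by (simp flip: power_Suc)
    finally show ?thesis by (simp add: mult.assoc Kinv_def)
  qed
  have ab: "cg J (Sm n \<cdot> (gE * (gK * gE ^ (n - 1))) - Sp n \<cdot> (gE * (Ki * gE ^ (n - 1))))
      (Sm n \<cdot> (Qi \<cdot> (gK * gE ^ n)) - Sp n \<cdot> (Q \<cdot> (Ki * gE ^ n)))"
  proof (cases "n = 0")
    case False
    then show ?thesis using a b by (intro cdiff csmul) auto
  qed simp
  have "gE ^ Suc n * gF = gE * (gE ^ n * gF)" by (simp add: mult.assoc)
  also have "cg J \<dots>
      (gE * (gF * gE ^ n + c0 \<cdot> (Sm n \<cdot> (gK * gE ^ (n - 1)) - Sp n \<cdot> (Ki * gE ^ (n - 1)))))"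
    by (rule cmult_l[OF Suc])
  also have "\<dots> = (gE * gF) * gE ^ n + c0 \<cdot> (Sm n \<cdot> (gE * (gK * gE ^ (n - 1))) - Sp n \<cdot> (gE * (Ki * gE ^ (n - 1))))"
    by (simp add: algebra_simps)
  also have "cg J \<dots> ((gF * gE + c0 \<cdot> (gK - Ki)) * gE ^ n
       + c0 \<cdot> (Sm n \<cdot> (Qi \<cdot> (gK * gE ^ n)) - Sp n \<cdot> (Q \<cdot> (Ki * gE ^ n))))"
    by (intro cadd cmult_r EF csmul ab)
  also have "\<dots> = gF * gE ^ Suc n
      + c0 \<cdot> (Sm (Suc n) \<cdot> (gK * gE ^ (Suc n - 1)) - Sp (Suc n) \<cdot> (Ki * gE ^ (Suc n - 1)))"
    by (simp add: Sm_Suc Sp_Suc add_smul smul_add smul_diff algebra_simps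
          del: smul_smul) (simp add: algebra_simps)
  finally show ?case .
qed simp

lemma F_pbw: "gF * pbw (i, j, k) = pbw (Suc i, j, k)"
  and pbw_E: "pbw (i, j, k) * gE = pbw (i, j, Suc k)"
  by (simp_all add: mult.assoc power_commutes)

lemma K_pbw: "cg J (gK ^ m * pbw (i, j, k)) (Qi ^ (m * i) \<cdot> pbw (i, m + j, k))"
proof -
  have "gK ^ m * pbw (i, j, k) = (gK ^ m * gF ^ i) * (gK ^ j * gE ^ k)" by (simp add: mult.assoc)
  also have "cg J \<dots> ((Qi ^ (m * i) \<cdot> (gF ^ i * gK ^ m)) * (gK ^ j * gE ^ k))"
    by (intro cmult_r KF_power)
  finally show ?thesis by (simp add: mult.assoc power_add)
qed

lemma pbw_K: "cg J (pbw (i, j, k) * gK ^ m) (Qi ^ (m * k) \<cdot> pbw (i, j + m, k))"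
proof -
  have "pbw (i, j, k) * gK ^ m = gF ^ i * gK ^ j * (gE ^ k * gK ^ m)" by (simp add: mult.assoc)
  also have "cg J \<dots> (gF ^ i * gK ^ j * (Qi ^ (m * k) \<cdot> (gK ^ m * gE ^ k)))"
    by (intro cmult_l EK_power)
  finally show ?thesis by (simp add: mult.assoc power_add)
qed

lemma E_pbw:
  "cg J (gE * pbw (i, j, k)) (Qi ^ j \<cdot> pbw (i, j, Suc k)
     + c0 \<cdot> (Sm i \<cdot> pbw (i - 1, Suc j, k) - Sp i \<cdot> pbw (i - 1, j + (p - 1), k)))"
proof -
  have Kp: "gK ^ (j + (p - 1)) = Ki * gK ^ j"
    by (simp add: Kinv_def add.commute flip: power_add)
  have "gE * pbw (i, j, k) = (gE * gF ^ i) * (gK ^ j * gE ^ k)" by (simp add: mult.assoc)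
  also have "cg J \<dots>
      ((gF ^ i * gE + c0 \<cdot> (Sm i \<cdot> (gF ^ (i - 1) * gK) - Sp i \<cdot> (gF ^ (i - 1) * Ki))) * (gK ^ j * gE ^ k))"
    by (intro cmult_r E_F_power)
  also have "\<dots> = gF ^ i * (gE * gK ^ j) * gE ^ k
      + c0 \<cdot> (Sm i \<cdot> pbw (i - 1, Suc j, k) - Sp i \<cdot> pbw (i - 1, j + (p - 1), k))"
    by (simp add: distrib_right left_diff_distrib mult.assoc Kp smul_diff
          del: One_nat_def)
  also have "cg J \<dots> (gF ^ i * (Qi ^ j \<cdot> (gK ^ j * gE)) * gE ^ k
      + c0 \<cdot> (Sm i \<cdot> pbw (i - 1, Suc j, k) - Sp i \<cdot> pbw (i - 1, j + (p - 1), k)))"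
    by (intro cadd cmult_r cmult_l EK_step crefl)
  finally show ?thesis by (simp add: mult.assoc)
qed

lemma pbw_F:
  "cg J (pbw (i, j, k) * gF) (Qi ^ j \<cdot> pbw (Suc i, j, k)
     + c0 \<cdot> (Sm k \<cdot> pbw (i, Suc j, k - 1) - Sp k \<cdot> pbw (i, j + (p - 1), k - 1)))"
proof -
  have "pbw (i, j, k) * gF = gF ^ i * gK ^ j * (gE ^ k * gF)" by (simp add: mult.assoc)
  also have "cg J \<dots> (gF ^ i * gK ^ j *
      (gF * gE ^ k + c0 \<cdot> (Sm k \<cdot> (gK * gE ^ (k - 1)) - Sp k \<cdot> (Ki * gE ^ (k - 1)))))"
    by (intro cmult_l E_power_F)
  also have "\<dots> = gF ^ i * (gK ^ j * gF) * gE ^ k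
      + c0 \<cdot> (Sm k \<cdot> pbw (i, Suc j, k - 1) - Sp k \<cdot> pbw (i, j + (p - 1), k - 1))"
    by (simp add: distrib_left right_diff_distrib mult.assoc Kinv_def power_add smul_diff
          power_Suc2 del: power_Suc)
  also have "cg J \<dots> (gF ^ i * (Qi ^ j \<cdot> (gF * gK ^ j)) * gE ^ k
      + c0 \<cdot> (Sm k \<cdot> pbw (i, Suc j, k - 1) - Sp k \<cdot> pbw (i, j + (p - 1), k - 1)))"
    by (intro cadd cmult_r cmult_l KF_step crefl)
  also have "\<dots> = Qi ^ j \<cdot> pbw (Suc i, j, k)
      + c0 \<cdot> (Sm k \<cdot> pbw (i, Suc j, k - 1) - Sp k \<cdot> pbw (i, j + (p - 1), k - 1))"
    by (simp add: mult.assoc power_Suc2 del: power_Suc)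
  finally show ?thesis .
qed

end


section \<open>Kronecker products\<close>

lemma dim_kron [simp]:
  "dim_row (kron A B) = dim_row A * dim_row B" "dim_col (kron A B) = dim_col A * dim_col B"
  by (simp_all add: kron_def)

lemma kron_carrier [simp, intro]:
  "A \<in> carrier_mat a b \<Longrightarrow> B \<in> carrier_mat c d \<Longrightarrow> kron A B \<in> carrier_mat (a * c) (b * d)"
  by (auto simp: kron_def)

lemma kron_index:
  "i < dim_row A * dim_row B \<Longrightarrow> j < dim_col A * dim_col B \<Longrightarrow>
   kron A B $$ (i, j) = A $$ (i div dim_row B, j div dim_col B) * B $$ (i mod dim_row B, j mod dim_col B)"
  by (simp add: kron_def)

lemma div_mod_less:
  fixes k a b :: nat
  assumes "k < a * b" shows "k div b < a" "k mod b < b"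
proof -
  have "b > 0" using assms by (cases b) auto
  then show "k div b < a" "k mod b < b" using assms by (simp_all add: less_mult_imp_div_less)
qed

lemma mult_add_less:
  fixes i j a b :: nat
  assumes "i < a" "j < b" shows "i * b + j < a * b"
proof -
  have "i * b + j < Suc i * b" using assms by simp
  also have "\<dots> \<le> a * b" using assms by (intro mult_le_mono1) simp
  finally show ?thesis .
qed

lemma sum_div_mod:
  fixes g :: "nat \<Rightarrow> nat \<Rightarrow> complex"
  shows "(\<Sum>k<a * b. g (k div b) (k mod b)) = (\<Sum>i<a. \<Sum>j<b. g i j)"
proof -
  have "(\<Sum>k<a * b. g (k div b) (k mod b)) = (\<Sum>(i, j)\<in>{..<a} \<times> {..<b}. g i j)"
    by (rule sum.reindex_bij_witness[where i = "\<lambda>(i, j). i * b + j" and j = "\<lambda>k. (k div b, k mod b)"])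
       (auto simp: div_mod_less mult_add_less)
  then show ?thesis by (simp add: sum.cartesian_product)
qed

lemma mult_mat_index:
  "i < dim_row A \<Longrightarrow> j < dim_col B \<Longrightarrow> dim_col A = dim_row B \<Longrightarrow>
    (A * B) $$ (i, j) = (\<Sum>k<dim_row B. A $$ (i, k) * B $$ (k, j))"
  by (simp add: scalar_prod_def lessThan_atLeast0)

lemma kron_mult:
  assumes "A \<in> carrier_mat a b" "B \<in> carrier_mat c d" "C \<in> carrier_mat b e" "D \<in> carrier_mat d f"
  shows "kron A B * kron C D = kron (A * C) (B * D)"
proof (rule eq_matI)
  note dims = carrier_matD[OF assms(1)] carrier_matD[OF assms(2)] carrier_matD[OF assms(3)]
    carrier_matD[OF assms(4)]
  fix i j assume ij: "i < dim_row (kron (A * C) (B * D))" "j < dim_col (kron (A * C) (B * D))"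
  then have i: "i < a * c" and j: "j < e * f" by (simp_all add: dims)
  have "(kron A B * kron C D) $$ (i, j) = (\<Sum>k<b * d. kron A B $$ (i, k) * kron C D $$ (k, j))"
    using i j by (subst mult_mat_index) (simp_all add: dims)
  also have "\<dots> = (\<Sum>k<b * d. (A $$ (i div c, k div d) * C $$ (k div d, j div f))
       * (B $$ (i mod c, k mod d) * D $$ (k mod d, j mod f)))"
    using i j by (intro sum.cong) (simp_all add: kron_index dims)
  also have "\<dots> = (\<Sum>k1<b. \<Sum>k2<d. (A $$ (i div c, k1) * C $$ (k1, j div f))
       * (B $$ (i mod c, k2) * D $$ (k2, j mod f)))"
    by (rule sum_div_mod)
  also have "\<dots> = (A * C) $$ (i div c, j div f) * (B * D) $$ (i mod c, j mod f)"
    using div_mod_less[OF i] div_mod_less[OF j]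
    by (simp add: mult_mat_index dims sum_product del: index_mult_mat(1))
  also have "\<dots> = kron (A * C) (B * D) $$ (i, j)"
    using i j by (simp add: kron_index dims del: index_mult_mat(1))
  finally show "(kron A B * kron C D) $$ (i, j) = kron (A * C) (B * D) $$ (i, j)" .
qed (use assms in auto)

lemma kron_assoc: "kron (kron A B) C = kron A (kron B C)"
proof (rule eq_matI)
  fix i j assume "i < dim_row (kron A (kron B C))" "j < dim_col (kron A (kron B C))"
  then have i: "i < dim_row A * (dim_row B * dim_row C)" "i < dim_row A * dim_row B * dim_row C"
    and j: "j < dim_col A * (dim_col B * dim_col C)" "j < dim_col A * dim_col B * dim_col C"
    by (simp_all add: mult.assoc)
  note [simp] = div_mod_less[OF i(1)] div_mod_less[OF j(1)] div_mod_less[OF i(2)] div_mod_less[OF j(2)]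
  have dm: "k div c mod b = k mod (b * c) div c" "k div c div b = k div (b * c)"
      "k mod (b * c) mod c = k mod c" if "k mod (b * c) < b * c" for k b c :: nat
  proof -
    have "c > 0" using that by (cases c) auto
    moreover have "k mod (b * c) = c * (k div c mod b) + k mod c"
      by (metis mod_mult2_eq mult.commute)
    ultimately show "k div c mod b = k mod (b * c) div c" "k mod (b * c) mod c = k mod c" by simp_all
    show "k div c div b = k div (b * c)" by (metis div_mult2_eq mult.commute)
  qed
  show "kron (kron A B) C $$ (i, j) = kron A (kron B C) $$ (i, j)"
    using i j dm[of i "dim_row B" "dim_row C"] dm[of j "dim_col B" "dim_col C"]
    by (simp add: kron_index)
qed (simp_all add: mult.assoc)

lemma kron_add_left:
  "A \<in> carrier_mat a b \<Longrightarrow> A' \<in> carrier_mat a b \<Longrightarrow> kron (A + A') B = kron A B + kron A' B"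
  by (rule eq_matI) (auto simp: kron_index div_mod_less distrib_right)

lemma kron_add_right:
  "B \<in> carrier_mat a b \<Longrightarrow> B' \<in> carrier_mat a b \<Longrightarrow> kron A (B + B') = kron A B + kron A B'"
  by (rule eq_matI) (auto simp: kron_index div_mod_less distrib_left)

lemma kron_diff_left:
  "A \<in> carrier_mat a b \<Longrightarrow> A' \<in> carrier_mat a b \<Longrightarrow> kron (A - A') M = kron A M - kron A' M"
  by (rule eq_matI) (auto simp: kron_index div_mod_less left_diff_distrib)

lemma kron_diff_right:
  "A \<in> carrier_mat a b \<Longrightarrow> A' \<in> carrier_mat a b \<Longrightarrow> kron M (A - A') = kron M A - kron M A'"
  by (rule eq_matI) (auto simp: kron_index div_mod_less right_diff_distrib)

lemma kron_smult_left: "kron (c \<cdot>\<^sub>m A) B = c \<cdot>\<^sub>m kron A B"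
  and kron_smult_right: "kron A (c \<cdot>\<^sub>m B) = c \<cdot>\<^sub>m kron A B"
  by (rule eq_matI; auto simp: kron_index div_mod_less)+

lemma kron_one: "kron (1\<^sub>m a) (1\<^sub>m b) = 1\<^sub>m (a * b)"
proof (rule eq_matI)
  fix i j assume "i < dim_row (1\<^sub>m (a * b) :: complex mat)" "j < dim_col (1\<^sub>m (a * b) :: complex mat)"
  then have ij: "i < a * b" "j < a * b" by simp_all
  have "(i div b = j div b \<and> i mod b = j mod b) = (i = j)"
    by (metis div_mult_mod_eq)
  then show "kron (1\<^sub>m a) (1\<^sub>m b) $$ (i, j) = (1\<^sub>m (a * b) :: complex mat) $$ (i, j)"
    using ij div_mod_less[OF ij(1)] div_mod_less[OF ij(2)]
    by (auto simp: kron_index)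
qed simp_all

lemma kron_unit: "kron A (1\<^sub>m 1) = A"
  by (rule eq_matI) (auto simp: kron_index)

lemma kron_zero_left: "kron (0\<^sub>m a b) B = 0\<^sub>m (a * dim_row B) (b * dim_col B)"
  and kron_zero_right: "kron A (0\<^sub>m a b) = 0\<^sub>m (dim_row A * a) (dim_col A * b)"
  by (rule eq_matI; auto simp: kron_index div_mod_less)+

definition ucol :: "nat \<Rightarrow> nat \<Rightarrow> complex mat" where
  "ucol n i = mat n 1 (\<lambda>(r, _). if r = i then 1 else 0)"

lemma ucol_carrier [simp, intro]: "ucol n i \<in> carrier_mat n 1"
  and dim_ucol [simp]: "dim_row (ucol n i) = n" "dim_col (ucol n i) = 1"
  by (simp_all add: ucol_def)

lemma ucol_index [simp]: "r < n \<Longrightarrow> ucol n i $$ (r, 0) = (if r = i then 1 else 0)"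
  by (simp add: ucol_def)

lemma mult_ucol_index:
  assumes "A \<in> carrier_mat m n" "r < m" "i < n"
  shows "(A * ucol n i) $$ (r, 0) = A $$ (r, i)"
proof -
  have "(A * ucol n i) $$ (r, 0) = (\<Sum>k<n. A $$ (r, k) * ucol n i $$ (k, 0))"
    using assms by (subst mult_mat_index) auto
  also have "\<dots> = (\<Sum>k<n. if k = i then A $$ (r, i) else 0)"
    by (intro sum.cong) auto
  finally have "(A * ucol n i) $$ (r, 0) = (\<Sum>k<n. if k = i then A $$ (r, i) else 0)" .
  then show ?thesis using assms by simp
qed

lemma mat_eq_ucolI:
  assumes "A \<in> carrier_mat m n" "B \<in> carrier_mat m n" "\<And>i. i < n \<Longrightarrow> A * ucol n i = B * ucol n i"
  shows "A = B"
proof (rule eq_matI)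
  fix r i assume "r < dim_row B" "i < dim_col B"
  then show "A $$ (r, i) = B $$ (r, i)"
    using assms mult_ucol_index[of A m n r i] mult_ucol_index[of B m n r i] by auto
qed (use assms in auto)

lemma kron_ucol:
  assumes "i < a" "j < b"
  shows "kron (ucol a i) (ucol b j) = ucol (a * b) (i * b + j)"
proof (rule eq_matI)
  fix r s assume "r < dim_row (ucol (a * b) (i * b + j))" "s < dim_col (ucol (a * b) (i * b + j))"
  then have r: "r < a * b" and [simp]: "s = 0" by simp_all
  have "(r div b = i \<and> r mod b = j) = (r = i * b + j)" using assms by auto
  then show "kron (ucol a i) (ucol b j) $$ (r, s) = ucol (a * b) (i * b + j) $$ (r, s)"
    using r div_mod_less[OF r] by (auto simp: kron_index)
qed simp_all

lemma mat_eq_kron_ucolI: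
  assumes "A \<in> carrier_mat m (a * b)" "B \<in> carrier_mat m (a * b)"
    and "\<And>i j. i < a \<Longrightarrow> j < b \<Longrightarrow> A * kron (ucol a i) (ucol b j) = B * kron (ucol a i) (ucol b j)"
  shows "A = B"
proof (rule mat_eq_ucolI[OF assms(1,2)])
  fix k assume k: "k < a * b"
  show "A * ucol (a * b) k = B * ucol (a * b) k"
    using assms(3)[OF div_mod_less[OF k]] kron_ucol[OF div_mod_less[OF k]] by simp
qed

section \<open>Matrix representations of monoid algebras\<close>

definition alg_rep :: "nat \<Rightarrow> (('m::monoid_add \<Rightarrow>\<^sub>0 complex) \<Rightarrow> complex mat) \<Rightarrow> bool" where
  "alg_rep d L \<longleftrightarrow> (\<forall>x. L x \<in> carrier_mat d d) \<and> (\<forall>x y. L (x + y) = L x + L y) \<and>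
     (\<forall>x y. L (x * y) = L x * L y) \<and> L 1 = 1\<^sub>m d \<and> (\<forall>c x. L (c \<cdot> x) = c \<cdot>\<^sub>m L x)"

lemma
  assumes "alg_rep d L"
  shows alg_rep_carrier: "L x \<in> carrier_mat d d"
    and alg_rep_add: "L (x + y) = L x + L y"
    and alg_rep_mult: "L (x * y) = L x * L y"
    and alg_rep_one: "L 1 = 1\<^sub>m d"
    and alg_rep_smul: "L (c \<cdot> x) = c \<cdot>\<^sub>m L x"
  using assms by (auto simp: alg_rep_def)

lemma alg_rep_zero:
  assumes L: "alg_rep d L" shows "L 0 = 0\<^sub>m d d"
proof -
  have "L 0 = 0 \<cdot>\<^sub>m L 0"
    using alg_rep_smul[OF L, of 0 0] unfolding smul_zero(1) .
  also have "\<dots> = 0\<^sub>m d d"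
    using alg_rep_carrier[OF L, of 0] by (intro eq_matI) auto
  finally show ?thesis .
qed

lemma alg_rep_minus: "alg_rep d L \<Longrightarrow> L (- x) = - L x"
  using alg_rep_smul[of d L "-1" x] alg_rep_carrier[of d L x]
  by (simp add: minus_smul, intro eq_matI) auto

lemma alg_rep_diff:
  assumes L: "alg_rep d L" shows "L (x - y) = L x - L y"
  using alg_rep_add[OF L, of x "- y"] alg_rep_minus[OF L, of y]
    alg_rep_carrier[OF L, of x] alg_rep_carrier[OF L, of y]
  by (simp, intro eq_matI) auto

lemma alg_rep_eq_iff:
  assumes L: "alg_rep d L" shows "L (x - y) = 0\<^sub>m d d \<longleftrightarrow> L x = L y"
proof
  assume a: "L (x - y) = 0\<^sub>m d d"
  have "L x = L (x - y) + L y" using alg_rep_add[OF L, of "x - y" y] by simp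
  then show "L x = L y" using a alg_rep_carrier[OF L, of y] by simp
next
  assume "L x = L y"
  then show "L (x - y) = 0\<^sub>m d d"
    using alg_rep_diff[OF L, of x y] alg_rep_carrier[OF L, of y] by simp
qed

lemma two_sided_kernel:
  assumes L: "alg_rep d L" shows "two_sided {x. L x = 0\<^sub>m d d}"
  unfolding two_sided_def
  using alg_rep_zero[OF L] alg_rep_add[OF L] alg_rep_mult[OF L] alg_rep_carrier[OF L]
  by (auto simp: left_mult_zero_mat[of _ d d d] right_mult_zero_mat[of _ d d d])

definition lin :: "nat \<Rightarrow> ('m::monoid_add \<Rightarrow> complex mat) \<Rightarrow> ('m \<Rightarrow>\<^sub>0 complex) \<Rightarrow> complex mat" where
  "lin d M x = msum d (\<lambda>u. Poly_Mapping.lookup x u \<cdot>\<^sub>m M u) (Poly_Mapping.keys x)"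

lemma msum_carrier [simp, intro]: "msum d f A \<in> carrier_mat d d"
  and dim_msum [simp]: "dim_row (msum d f A) = d" "dim_col (msum d f A) = d"
  by (simp_all add: msum_def)

lemma
  assumes M: "\<And>u. M u \<in> carrier_mat d d"
  shows lin_add: "lin d M (x + y) = lin d M x + lin d M y"
    and lin_single: "lin d M (Poly_Mapping.single u c) = c \<cdot>\<^sub>m M u"
proof -
  have idx: "lin d M x $$ (i, j) = (\<Sum>u\<in>Poly_Mapping.keys x. Poly_Mapping.lookup x u * M u $$ (i, j))"
    if "i < d" "j < d" for i j x
    using that carrier_matD[OF M] by (simp add: lin_def msum_def)
  show "lin d M (x + y) = lin d M x + lin d M y"
  proof (rule eq_matI)
    fix i j assume "i < dim_row (lin d M x + lin d M y)" "j < dim_col (lin d M x + lin d M y)"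
    then have ij: "i < d" "j < d" by (simp_all add: lin_def)
    have "lin d M (x + y) $$ (i, j) = lin d M x $$ (i, j) + lin d M y $$ (i, j)"
      unfolding idx[OF ij]
      using setsum_keys_plus_distrib[of "\<lambda>u c. c * M u $$ (i, j)" x y] by (simp add: distrib_right)
    then show "lin d M (x + y) $$ (i, j) = (lin d M x + lin d M y) $$ (i, j)"
      using ij by (simp add: lin_def)
  qed (simp_all add: lin_def)
  show "lin d M (Poly_Mapping.single u c) = c \<cdot>\<^sub>m M u"
  proof (rule eq_matI)
    fix i j assume "i < dim_row (c \<cdot>\<^sub>m M u)" "j < dim_col (c \<cdot>\<^sub>m M u)"
    then have ij: "i < d" "j < d" using carrier_matD[OF M] by simp_all
    then show "lin d M (Poly_Mapping.single u c) $$ (i, j) = (c \<cdot>\<^sub>m M u) $$ (i, j)"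
      using carrier_matD[OF M] by (simp add: idx)
  qed (use carrier_matD[OF M] in \<open>simp_all add: lin_def\<close>)
qed

lemma alg_rep_lin:
  assumes M: "\<And>u. M u \<in> carrier_mat d d" and mult: "\<And>u v. M (u + v) = M u * M v"
    and one: "M 0 = 1\<^sub>m d"
  shows "alg_rep d (lin d M)"
proof -
  note add = lin_add[of M d, OF M] and single = lin_single[of M d, OF M]
  have car: "lin d M x \<in> carrier_mat d d" for x by (simp add: lin_def)
  have m: "lin d M (x * y) = lin d M x * lin d M y" for x y
  proof (induction x rule: poly_mapping_additive_induct)
    case (2 x1 x2)
    then show ?case
      by (simp add: distrib_right add add_mult_distrib_mat[OF car car car])
  next
    case (1 u a)
    show ?case
    proof (induction y rule: poly_mapping_additive_induct)
      case (2 y1 y2)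
      then show ?case by (simp add: distrib_left add mult_add_distrib_mat[OF car car car])
    next
      case (1 v b)
      have "(a \<cdot>\<^sub>m M u) * (b \<cdot>\<^sub>m M v) = (a * b) \<cdot>\<^sub>m (M u * M v)"
        using M[of u] M[of v] by (intro eq_matI) auto
      then show ?case by (simp add: mult_single single mult)
    qed
  qed
  have s: "lin d M (c \<cdot> x) = c \<cdot>\<^sub>m lin d M x" for c x
  proof -
    have "lin d M (c \<cdot> x) = (c \<cdot>\<^sub>m 1\<^sub>m d) * lin d M x"
      by (simp add: smul_def m scal_def single one)
    then show ?thesis
      using car[of x] mult_smult_assoc_mat[OF one_carrier_mat car[of x], of c] by simp
  qed
  have "1 \<cdot>\<^sub>m 1\<^sub>m d = (1\<^sub>m d :: complex mat)" by (rule eq_matI) auto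
  then show ?thesis unfolding alg_rep_def
    using car m s add single[of 0 1] one by simp
qed


section \<open>The ideals of relations and the coproduct\<close>

lemma coset_eq_iff_cg: "two_sided J \<Longrightarrow> (J +>\<^bsub>monoid_alg\<^esub> x = J +>\<^bsub>monoid_alg\<^esub> y) \<longleftrightarrow> cg J x y"
  using ring.quotient_eq_iff_same_a_r_cos[OF ring_monoid_alg, of J x y]
  by (simp add: ideal_iff_two_sided cg_def)

lemma mem_coset_iff_cg: "y \<in> J +>\<^bsub>monoid_alg\<^esub> x \<longleftrightarrow> cg J y x"
proof -
  have "(\<exists>h\<in>J. y = h + x) \<longleftrightarrow> y - x \<in> J"
    by (auto intro: bexI[of _ "y - x"])
  then show ?thesis by (auto simp: a_r_coset_def' cg_def)
qed

lemma induced_coset: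
  assumes "two_sided J" "\<And>y. cg J y x \<Longrightarrow> f y = f x"
  shows "induced f (J +>\<^bsub>monoid_alg\<^esub> x) = f x"
proof -
  have "x \<in> J +>\<^bsub>monoid_alg\<^esub> x"
    by (simp add: mem_coset_iff_cg cg_refl[OF assms(1)])
  moreover have "f z = f x" if "z \<in> J +>\<^bsub>monoid_alg\<^esub> x" for z
    using that assms(2) by (simp add: mem_coset_iff_cg)
  ultimately have "f ` (J +>\<^bsub>monoid_alg\<^esub> x) = {f x}" by blast
  then show ?thesis by (simp add: induced_def)
qed

lemma word_prod_list: "Poly_Mapping.single w 1 = prod_list (map genr (letters w))"
proof -
  have "Poly_Mapping.single (Word gs) 1 = prod_list (map genr gs)" for gs
  proof (induction gs)
    case Nil
    then show ?case by (simp flip: zero_word_def)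
  next
    case (Cons g gs)
    have "Word (g # gs) = Word [g] + Word gs" by (simp add: plus_word_def)
    then have "Poly_Mapping.single (Word (g # gs)) 1 = genr g * Poly_Mapping.single (Word gs) 1"
      by (simp add: genr_def mult_single)
    then show ?case using Cons by simp
  qed
  from this[of "letters w"] show ?thesis by simp
qed

lemma free_alg_induct [case_names one gen add smul]:
  fixes x :: free_alg
  assumes one: "P 1" and gen: "\<And>g x. P x \<Longrightarrow> P (genr g * x)"
    and add: "\<And>x y. P x \<Longrightarrow> P y \<Longrightarrow> P (x + y)" and smul: "\<And>c x. P x \<Longrightarrow> P (c \<cdot> x)"
  shows "P x"
proof (induction x rule: poly_mapping_additive_induct)
  case (1 w a)
  have "P (prod_list (map genr gs))" for gs
    by (induction gs) (simp_all add: one gen)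
  then have "P (Poly_Mapping.single w 1)" by (simp add: word_prod_list)
  then show ?case by (subst single_conv_smul) (rule smul)
qed (rule add)

lemma tens_induct [case_names tens add]:
  fixes y :: "'m::monoid_add \<times> 'n::monoid_add \<Rightarrow>\<^sub>0 complex"
  assumes tens: "\<And>x x'. P (tens x x')" and add: "\<And>x y. P x \<Longrightarrow> P y \<Longrightarrow> P (x + y)"
  shows "P y"
proof (induction y rule: poly_mapping_additive_induct)
  case (1 w a)
  obtain u v where "w = (u, v)" by (cases w)
  then have "Poly_Mapping.single w a = tens (Poly_Mapping.single u a) (Poly_Mapping.single v 1)"
    by (simp add: tens_single)
  then show ?case using tens by simp
qed (rule add)

subsection \<open>Homomorphisms out of the free algebra\<close>

lemma letters_zero [simp]: "letters 0 = []"
  by (simp add: zero_word_def)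

lemma free_hom_single:
  "free_hom scal g (Poly_Mapping.single w c) = c \<cdot> prod_list (map g (letters w))"
  by (simp add: free_hom_def smul_def scal_0)

lemma free_hom_add: "free_hom scal g (x + y) = free_hom scal g x + free_hom scal g y"
  unfolding free_hom_def
  using setsum_keys_plus_distrib[of "\<lambda>w c. scal c * prod_list (map g (letters w))" x y]
  by (simp add: scal_0 scal_add distrib_right)

lemma free_hom_mult: "free_hom scal g (x * y) = free_hom scal g x * free_hom scal g y"
proof (induction x rule: poly_mapping_additive_induct)
  case (2 x1 x2) then show ?case by (simp add: distrib_right free_hom_add)
next
  case (1 u a)
  show ?case
  proof (induction y rule: poly_mapping_additive_induct)
    case (2 y1 y2) then show ?case by (simp add: distrib_left free_hom_add)
  next
    case (1 v b)
    show ?case by (simp add: mult_single free_hom_single plus_word_def mult.commute)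
  qed
qed

lemma free_hom_one: "free_hom scal g 1 = 1"
  using free_hom_single[of g 0 1] by simp

lemma free_hom_smul: "free_hom scal g (c \<cdot> x) = c \<cdot> free_hom scal g x"
proof -
  have "free_hom scal g (scal c) = scal c"
    using free_hom_single[of g 0 c] by (simp add: scal_def smul_def)
  then show ?thesis by (simp add: smul_def free_hom_mult)
qed

lemma free_hom_genr: "free_hom scal g (genr a) = g a"
  by (simp add: genr_def free_hom_single)

lemma free_hom_diff: "free_hom scal g (x - y) = free_hom scal g x - free_hom scal g y"
  by (metis add_diff_cancel_right' diff_add_cancel free_hom_add)

lemma free_hom_power: "free_hom scal g (x ^ n) = free_hom scal g x ^ n"
  by (induction n) (simp_all add: free_hom_one free_hom_mult)

lemma free_hom_zero: "free_hom scal g 0 = 0"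
  using free_hom_diff[of g 0 0] by simp

context small_q
begin

lemma two_sided_uq: "two_sided (uq_ideal p q)"
  unfolding uq_ideal_def ideal_iff_two_sided[symmetric]
  by (rule ring.genideal_ideal[OF ring_monoid_alg]) simp

lemma two_sided_uq2: "two_sided (uq2_ideal p q)"
  unfolding uq2_ideal_def ideal_iff_two_sided[symmetric]
  by (rule ring.genideal_ideal[OF ring_monoid_alg]) simp

lemma uq_relation: "x \<in> uq_relations p q \<Longrightarrow> x \<in> uq_ideal p q"
  unfolding uq_ideal_def
  using ring.genideal_self[OF ring_monoid_alg, of "uq_relations p q"] by auto

lemma uq_ideal_least: "two_sided J \<Longrightarrow> uq_relations p q \<subseteq> J \<Longrightarrow> uq_ideal p q \<subseteq> J"
  unfolding uq_ideal_def
  by (rule ring.genideal_minimal[OF ring_monoid_alg]) (simp_all add: ideal_iff_two_sided)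

lemma uq2_ideal_least:
  assumes "two_sided J" "\<And>x. x \<in> uq_ideal p q \<Longrightarrow> tens x 1 \<in> J \<and> tens 1 x \<in> J"
  shows "uq2_ideal p q \<subseteq> J"
  unfolding uq2_ideal_def
  by (rule ring.genideal_minimal[OF ring_monoid_alg]) (use assms in \<open>auto simp: ideal_iff_two_sided\<close>)

end

lemma (in small_q) qrel_ideal_of_relations:
  assumes J: "two_sided J"
    and "gK * gE - scal (q^2) * gE * gK \<in> J" "gK * gF - scal (inverse (q^2)) * gF * gK \<in> J"
      "gE * gF - gF * gE - scal (1 / (q - inverse q)) * (gK - Kinv p) \<in> J"
  shows "qrel_ideal p q J"
  by unfold_locales (use assms in \<open>simp_all add: cg_def smul_def mult.assoc diff_diff_eq\<close>)

sublocale small_q \<subseteq> I: qrel_ideal p q "uq_ideal p q"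
  by (rule qrel_ideal_of_relations[OF two_sided_uq]; rule uq_relation; simp add: uq_relations_def)

sublocale small_q \<subseteq> I2: cong_ideal "uq2_ideal p q"
  by unfold_locales (rule two_sided_uq2)

context small_q
begin

abbreviation cgI :: "free_alg \<Rightarrow> free_alg \<Rightarrow> bool" (infix \<open>\<approx>\<close> 50) where
  "x \<approx> y \<equiv> cg (uq_ideal p q) x y"
abbreviation cgI2 :: "free_alg2 \<Rightarrow> free_alg2 \<Rightarrow> bool" (infix \<open>\<approx>\<^sub>2\<close> 50) where
  "x \<approx>\<^sub>2 y \<equiv> cg (uq2_ideal p q) x y"

lemma E_p: "gE ^ p \<approx> 0" and F_p: "gF ^ p \<approx> 0" and K_p: "gK ^ p \<approx> 1"
  using uq_relation[of "gE ^ p"] uq_relation[of "gF ^ p"] uq_relation[of "gK ^ p - 1"]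
  by (simp_all add: cg_def uq_relations_def)

lemma tens_cong: "x \<approx> x' \<Longrightarrow> y \<approx> y' \<Longrightarrow> tens x y \<approx>\<^sub>2 tens x' y'"
proof -
  assume a: "x \<approx> x'" "y \<approx> y'"
  have gen: "tens z 1 \<in> uq2_ideal p q" "tens 1 z \<in> uq2_ideal p q" if "z \<in> uq_ideal p q" for z
    unfolding uq2_ideal_def
    by (rule subsetD[OF ring.genideal_self[OF ring_monoid_alg]]; use that in simp)+
  have "tens (x - x') 1 * tens 1 y \<in> uq2_ideal p q"
    using a(1) by (intro two_sided_rmult[OF two_sided_uq2] gen) (simp add: cg_def)
  moreover have "tens x' 1 * tens 1 (y - y') \<in> uq2_ideal p q"
    using a(2) by (intro two_sided_lmult[OF two_sided_uq2] gen) (simp add: cg_def)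
  ultimately have "tens (x - x') 1 * tens 1 y + tens x' 1 * tens 1 (y - y') \<in> uq2_ideal p q"
    by (rule two_sided_add[OF two_sided_uq2])
  then show "tens x y \<approx>\<^sub>2 tens x' y'"
    by (simp add: cg_def tens_mult tens_diff_left tens_diff_right left_diff_distrib right_diff_distrib)
qed

definition Delta :: "free_alg \<Rightarrow> free_alg2" where
  "Delta = free_hom scal (comult_gen p)"

lemma Delta_add: "Delta (x + y) = Delta x + Delta y"
  and Delta_diff: "Delta (x - y) = Delta x - Delta y"
  and Delta_mult: "Delta (x * y) = Delta x * Delta y"
  and Delta_smul: "Delta (c \<cdot> x) = c \<cdot> Delta x"
  and Delta_one: "Delta 1 = 1"
  and Delta_zero: "Delta 0 = 0"
  and Delta_power: "Delta (x ^ n) = Delta x ^ n"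
  by (simp_all add: Delta_def free_hom_add free_hom_diff free_hom_mult free_hom_smul free_hom_one
        free_hom_zero free_hom_power)

lemma Delta_E: "Delta gE = tens 1 gE + tens gE gK"
  and Delta_F: "Delta gF = tens gF 1 + tens Ki gF"
  and Delta_K: "Delta gK = tens gK gK"
  by (simp_all add: Delta_def free_hom_genr)

lemma Delta_Ki: "Delta Ki = tens Ki Ki"
  by (simp add: Kinv_def Delta_power Delta_K tens_power)

lemma Ki_F: "Ki * gF \<approx> Q \<cdot> (gF * Ki)"
  using I.KF_step[of "p - 1"] by (simp add: Kinv_def Qi_pred del: One_nat_def)

lemma E_Ki: "gE * Ki \<approx> Q \<cdot> (Ki * gE)"
  using I.EK_step[of "p - 1"] by (simp add: Kinv_def Qi_pred del: One_nat_def)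

lemma Delta_F_power:
  "Delta gF ^ n \<approx>\<^sub>2 (\<Sum>b\<le>n. gauss_binom Q n b \<cdot> tens (gF ^ (n - b) * Ki ^ b) (gF ^ b))"
proof -
  have "tens Ki gF * tens gF 1 = tens (Ki * gF) gF" by (simp add: tens_mult)
  also have "\<dots> \<approx>\<^sub>2 tens (Q \<cdot> (gF * Ki)) gF" by (intro tens_cong Ki_F) simp
  finally have "tens Ki gF * tens gF 1 \<approx>\<^sub>2 Q \<cdot> (tens gF 1 * tens Ki gF)" by (simp add: tens_mult)
  from I2.gauss_binomial[OF this, of n] show ?thesis
    by (simp add: Delta_F tens_power tens_mult)
qed

lemma Delta_E_power:
  "Delta gE ^ n \<approx>\<^sub>2 (\<Sum>c\<le>n. gauss_binom Q n c \<cdot> tens (gE ^ c) (gE ^ (n - c) * gK ^ c))"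
proof -
  have "tens gE gK * tens 1 gE = tens gE (gK * gE)" by (simp add: tens_mult)
  also have "\<dots> \<approx>\<^sub>2 tens gE (Q \<cdot> (gE * gK))" by (intro tens_cong I.KE) simp
  finally have "tens gE gK * tens 1 gE \<approx>\<^sub>2 Q \<cdot> (tens 1 gE * tens gE gK)" by (simp add: tens_mult)
  from I2.gauss_binomial[OF this, of n] show ?thesis
    by (simp add: Delta_E tens_power tens_mult)
qed

lemma gauss_binom_p: "0 < k \<Longrightarrow> k < p \<Longrightarrow> gauss_binom Q p k = 0"
  using Q_power_eq_1_iff by (intro gauss_binom_root_of_unity) (auto dest: nat_dvd_not_less)

text \<open>
  Only the two extreme terms of the binomial expansion at the exponent \<open>p\<close> survive, because the
  order of \<open>q\<^sup>2\<close> is \<open>p\<close>; this is why \<open>E ^ p = 0\<close> and \<open>F ^ p = 0\<close> are compatible with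
  the coproduct.
\<close>

lemma Delta_uq_ideal: "x \<in> uq_ideal p q \<Longrightarrow> Delta x \<in> uq2_ideal p q"
proof -
  let ?J = "{x. Delta x \<in> uq2_ideal p q}"
  have J: "two_sided ?J"
    using two_sided_uq2 by (auto simp: two_sided_def Delta_zero Delta_add Delta_mult)
  have ends: "(\<Sum>k\<le>p. gauss_binom Q p k \<cdot> f k) = f 0 + f p" for f :: "nat \<Rightarrow> free_alg2"
  proof -
    have "(\<Sum>k\<le>p. gauss_binom Q p k \<cdot> f k) = (\<Sum>k\<in>{0, p}. gauss_binom Q p k \<cdot> f k)"
      using gauss_binom_p by (intro sum.mono_neutral_right) auto
    then show ?thesis using p_ge by simp
  qed
  have r1: "Delta (gK * gE) \<approx>\<^sub>2 Delta (Q \<cdot> (gE * gK))"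
  proof -
    have "Delta (gK * gE) = tens gK (gK * gE) + tens (gK * gE) (gK * gK)"
      by (simp add: Delta_mult Delta_E Delta_K distrib_left tens_mult)
    also have "\<dots> \<approx>\<^sub>2 tens gK (Q \<cdot> (gE * gK)) + tens (Q \<cdot> (gE * gK)) (gK * gK)"
      by (intro I2.cadd tens_cong I.KE) simp_all
    also have "\<dots> = Delta (Q \<cdot> (gE * gK))"
      by (simp add: Delta_mult Delta_E Delta_K Delta_smul distrib_right tens_mult smul_add)
    finally show ?thesis .
  qed
  have r2: "Delta (gK * gF) \<approx>\<^sub>2 Delta (Qi \<cdot> (gF * gK))"
  proof -
    have KiK: "gK * Ki = Ki * gK" by (simp add: Kinv_def power_commutes)
    have "Delta (gK * gF) = tens (gK * gF) gK + tens (gK * Ki) (gK * gF)"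
      by (simp add: Delta_mult Delta_F Delta_K distrib_left tens_mult)
    also have "\<dots> \<approx>\<^sub>2 tens (Qi \<cdot> (gF * gK)) gK + tens (gK * Ki) (Qi \<cdot> (gF * gK))"
      by (intro I2.cadd tens_cong I.KF) simp_all
    also have "\<dots> = Delta (Qi \<cdot> (gF * gK))"
      by (simp add: Delta_mult Delta_F Delta_K Delta_smul distrib_right tens_mult smul_add KiK)
    finally show ?thesis .
  qed
  have r3: "Delta (gE * gF) \<approx>\<^sub>2 Delta (gF * gE + c0 \<cdot> (gK - Ki))"
  proof -
    have "tens (gE * Ki) (gK * gF) \<approx>\<^sub>2 tens (Q \<cdot> (Ki * gE)) (Qi \<cdot> (gF * gK))"
      by (intro tens_cong E_Ki I.KF)
    then have cross: "tens (gE * Ki) (gK * gF) \<approx>\<^sub>2 tens (Ki * gE) (gF * gK)"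
      using q_nz by simp
    have "Delta (gE * gF) = tens gF gE + tens Ki (gE * gF) + tens (gE * gF) gK + tens (gE * Ki) (gK * gF)"
      by (simp add: Delta_mult Delta_E Delta_F distrib_left distrib_right tens_mult)
    also have "\<dots> \<approx>\<^sub>2 tens gF gE + tens Ki (gF * gE + c0 \<cdot> (gK - Ki))
        + tens (gF * gE + c0 \<cdot> (gK - Ki)) gK + tens (Ki * gE) (gF * gK)"
      by (intro I2.cadd tens_cong I.EF cross) simp_all
    also have "\<dots> = Delta (gF * gE + c0 \<cdot> (gK - Ki))"
      by (simp add: Delta_mult Delta_E Delta_F Delta_K Delta_Ki Delta_smul Delta_add Delta_diff
           distrib_left distrib_right tens_mult tens_add_left tens_add_right smul_add smul_diff
           tens_diff_left tens_diff_right)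
    finally show ?thesis .
  qed
  have r4: "Delta (gE ^ p) \<approx>\<^sub>2 0"
  proof -
    have "Delta (gE ^ p) \<approx>\<^sub>2 (\<Sum>c\<le>p. gauss_binom Q p c \<cdot> tens (gE ^ c) (gE ^ (p - c) * gK ^ c))"
      using Delta_E_power by (simp add: Delta_power)
    also have "\<dots> = tens 1 (gE ^ p) + tens (gE ^ p) (gK ^ p)" by (subst ends) simp
    also have "\<dots> \<approx>\<^sub>2 tens 1 0 + tens 0 (gK ^ p)" by (intro I2.cadd tens_cong E_p) simp_all
    finally show ?thesis by simp
  qed
  have r5: "Delta (gF ^ p) \<approx>\<^sub>2 0"
  proof -
    have "Delta (gF ^ p) \<approx>\<^sub>2 (\<Sum>b\<le>p. gauss_binom Q p b \<cdot> tens (gF ^ (p - b) * Ki ^ b) (gF ^ b))"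
      using Delta_F_power by (simp add: Delta_power)
    also have "\<dots> = tens (gF ^ p) 1 + tens (Ki ^ p) (gF ^ p)" by (subst ends) simp
    also have "\<dots> \<approx>\<^sub>2 tens 0 1 + tens (Ki ^ p) 0" by (intro I2.cadd tens_cong F_p) simp_all
    finally show ?thesis by simp
  qed
  have r6: "Delta (gK ^ p) \<approx>\<^sub>2 Delta 1"
    using tens_cong[OF K_p K_p] by (simp add: Delta_power Delta_K tens_power Delta_one tens_one)
  have "gK * gE - scal Q * gE * gK \<in> ?J"
    using r1 by (simp add: cg_def Delta_diff[symmetric] smul_def mult.assoc)
  moreover have "gK * gF - scal Qi * gF * gK \<in> ?J"
    using r2 by (simp add: cg_def Delta_diff[symmetric] smul_def mult.assoc)
  moreover have "gE * gF - gF * gE - scal c0 * (gK - Ki) \<in> ?J"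
    using r3 by (simp add: cg_def Delta_diff[symmetric] smul_def diff_diff_eq)
  moreover have "gE ^ p \<in> ?J" "gF ^ p \<in> ?J"
    using r4 r5 by (simp_all add: cg_def)
  moreover have "gK ^ p - 1 \<in> ?J"
    using r6 by (simp add: cg_def Delta_diff)
  ultimately have "uq_relations p q \<subseteq> ?J"
    by (simp only: uq_relations_def insert_subset empty_subsetI)
  then show "x \<in> uq_ideal p q \<Longrightarrow> Delta x \<in> uq2_ideal p q"
    using uq_ideal_least[OF J] by auto
qed

lemma Delta_cong: "x \<approx> y \<Longrightarrow> Delta x \<approx>\<^sub>2 Delta y"
  using Delta_uq_ideal[of "x - y"] by (simp add: cg_def Delta_diff)

lemma Delta_pbw:
  "Delta (pbw (i, j, k)) \<approx>\<^sub>2 (\<Sum>b\<le>i. \<Sum>c\<le>k.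
     (gauss_binom Q i b * gauss_binom Q k c * Qi ^ (c * (k - c))) \<cdot>
       tens (pbw (i - b, (p - 1) * b + j, c)) (pbw (b, j + c, k - c)))"
proof -
  let ?f = "\<lambda>b. gauss_binom Q i b \<cdot> tens (gF ^ (i - b) * Ki ^ b) (gF ^ b)"
  let ?e = "\<lambda>c. gauss_binom Q k c \<cdot> tens (gE ^ c) (gE ^ (k - c) * gK ^ c)"
  let ?e' = "\<lambda>c. (gauss_binom Q k c * Qi ^ (c * (k - c))) \<cdot> tens (gE ^ c) (gK ^ c * gE ^ (k - c))"
  have Kb: "gK ^ ((p - 1) * b + j) = Ki ^ b * gK ^ j" and Kc: "gK ^ (j + c) = gK ^ j * gK ^ c" for b c
    by (simp_all add: power_add power_mult Kinv_def del: One_nat_def)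
  have e: "?e c \<approx>\<^sub>2 ?e' c" for c
  proof -
    have "?e c \<approx>\<^sub>2 gauss_binom Q k c \<cdot> tens (gE ^ c) (Qi ^ (c * (k - c)) \<cdot> (gK ^ c * gE ^ (k - c)))"
      by (intro I2.csmul tens_cong I.EK_power) simp
    then show ?thesis by simp
  qed
  have "Delta (pbw (i, j, k)) = Delta gF ^ i * tens (gK ^ j) (gK ^ j) * Delta gE ^ k"
    by (simp add: Delta_mult Delta_power Delta_K tens_power)
  also have "\<dots> \<approx>\<^sub>2 (\<Sum>b\<le>i. ?f b) * tens (gK ^ j) (gK ^ j) * (\<Sum>c\<le>k. ?e c)"
    by (intro I2.cmult Delta_F_power Delta_E_power) simp
  also have "\<dots> \<approx>\<^sub>2 (\<Sum>b\<le>i. ?f b) * tens (gK ^ j) (gK ^ j) * (\<Sum>c\<le>k. ?e' c)"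
    by (intro I2.cmult_l I2.csum e)
  also have "\<dots> = (\<Sum>b\<le>i. \<Sum>c\<le>k. ?f b * tens (gK ^ j) (gK ^ j) * ?e' c)"
    by (simp only: sum_distrib_right sum_distrib_left) (rule sum.swap)
  also have "\<dots> = (\<Sum>b\<le>i. \<Sum>c\<le>k.
     (gauss_binom Q i b * gauss_binom Q k c * Qi ^ (c * (k - c))) \<cdot>
       tens (pbw (i - b, (p - 1) * b + j, c)) (pbw (b, j + c, k - c)))"
    by (intro sum.cong refl)
       (simp add: tens_mult mult.assoc Kb Kc del: One_nat_def, simp add: mult.commute mult.left_commute)
  finally show ?thesis .
qed


section \<open>Modules, intertwiners and tensor products\<close>

definition rep :: "hmod \<Rightarrow> free_alg \<Rightarrow> complex mat" where
  "rep X x = snd X (uq_class p q x)"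

lemma uq_class_eq_iff: "uq_class p q x = uq_class p q y \<longleftrightarrow> x \<approx> y"
  unfolding uq_class_def by (rule coset_eq_iff_cg[OF two_sided_uq])

lemma uq_class_hom: "uq_class p q \<in> Ring.ring_hom monoid_alg (uq p q)"
proof -
  have "(+>\<^bsub>monoid_alg\<^esub>) (uq_ideal p q) \<in> Ring.ring_hom monoid_alg (uq p q)"
    unfolding uq_def
    by (rule ideal.rcos_ring_hom) (simp add: ideal_iff_two_sided two_sided_uq)
  then show ?thesis by (simp add: uq_class_def[abs_def])
qed

lemma carrier_uq: "carrier (uq p q) = range (uq_class p q)"
  by (auto simp: uq_def FactRing_def A_RCOSETS_def' uq_class_def)

lemma uq_class_carrier [simp]: "uq_class p q x \<in> carrier (uq p q)"
  by (simp add: carrier_uq)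

lemma uq_class_ops:
  "uq_class p q (x + y) = uq_class p q x \<oplus>\<^bsub>uq p q\<^esub> uq_class p q y"
  "uq_class p q (x * y) = uq_class p q x \<otimes>\<^bsub>uq p q\<^esub> uq_class p q y"
  "uq_class p q 1 = \<one>\<^bsub>uq p q\<^esub>"
  using Ring.ring_hom_add[OF uq_class_hom, of x y] Ring.ring_hom_mult[OF uq_class_hom, of x y]
    Ring.ring_hom_one[OF uq_class_hom] by simp_all

lemma alg_rep_rep:
  assumes X: "X \<in> modules p q" shows "alg_rep (fst X) (rep X)"
proof -
  obtain d \<rho> where [simp]: "X = (d, \<rho>)" by (cases X)
  have \<rho>: "\<rho> \<in> Ring.ring_hom (uq p q) (ring_mat TYPE(complex) d ())"
    and sc: "\<rho> (uq_class p q (scal c)) = c \<cdot>\<^sub>m 1\<^sub>m d" for c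
    using X by (auto simp: modules_def)
  have car: "\<rho> (uq_class p q x) \<in> carrier_mat d d" for x
    using Ring.ring_hom_closed[OF \<rho>, of "uq_class p q x"] by (simp add: ring_mat_simps)
  have mul: "rep X (x * y) = rep X x * rep X y" for x y
    using Ring.ring_hom_mult[OF \<rho>, of "uq_class p q x" "uq_class p q y"]
    by (simp add: rep_def uq_class_ops ring_mat_simps)
  have add: "rep X (x + y) = rep X x + rep X y" for x y
    using Ring.ring_hom_add[OF \<rho>, of "uq_class p q x" "uq_class p q y"]
    by (simp add: rep_def uq_class_ops ring_mat_simps)
  have one: "rep X 1 = 1\<^sub>m d"
    using Ring.ring_hom_one[OF \<rho>] by (simp add: rep_def uq_class_ops ring_mat_simps)
  have "rep X (c \<cdot> x) = c \<cdot>\<^sub>m rep X x" for c x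
  proof -
    have "rep X (c \<cdot> x) = (c \<cdot>\<^sub>m 1\<^sub>m d) * rep X x"
      unfolding smul_def mul by (simp add: rep_def sc)
    then show ?thesis
      using car[of x] mult_smult_assoc_mat[OF one_carrier_mat car[of x], of c] by (simp add: rep_def)
  qed
  then show ?thesis
    unfolding alg_rep_def using car mul add one by (simp add: rep_def)
qed

lemma rep_cong: "x \<approx> y \<Longrightarrow> rep X x = rep X y"
  by (simp add: rep_def uq_class_eq_iff[symmetric])

text \<open>
  The function \<open>f\<close> on cosets is left open because it is \<open>induced L\<close> for the regular module, but
  passes through the coproduct of the quotient for a tensor product.
\<close>

lemma module_of_alg_rep:
  assumes L: "alg_rep d L" and ker: "\<And>x. x \<in> uq_ideal p q \<Longrightarrow> L x = 0\<^sub>m d d"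
    and X: "X = (d, \<lambda>h\<in>carrier (uq p q). f h)" and f: "\<And>x. f (uq_class p q x) = L x"
  shows "X \<in> modules p q" "rep X x = L x"
proof -
  have r: "(\<lambda>h\<in>carrier (uq p q). f h) (uq_class p q x) = L x" for x
    by (simp add: f)
  then show "rep X x = L x" by (simp add: rep_def X)
  have "(\<lambda>h\<in>carrier (uq p q). f h) \<in> Ring.ring_hom (uq p q) (ring_mat TYPE(complex) d ())"
  proof (rule Ring.ring_hom_memI)
    fix h assume "h \<in> carrier (uq p q)"
    then obtain x where "h = uq_class p q x" by (auto simp: carrier_uq)
    then show "(\<lambda>h\<in>carrier (uq p q). f h) h \<in> carrier (ring_mat TYPE(complex) d ())"
      using r[of x] alg_rep_carrier[OF L] by (simp add: ring_mat_simps)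
  next
    fix h k assume "h \<in> carrier (uq p q)" "k \<in> carrier (uq p q)"
    then obtain x y where hk: "h = uq_class p q x" "k = uq_class p q y" by (auto simp: carrier_uq)
    show "(\<lambda>h\<in>carrier (uq p q). f h) (h \<otimes>\<^bsub>uq p q\<^esub> k)
      = (\<lambda>h\<in>carrier (uq p q). f h) h \<otimes>\<^bsub>ring_mat TYPE(complex) d ()\<^esub> (\<lambda>h\<in>carrier (uq p q). f h) k"
      unfolding hk uq_class_ops[symmetric] r by (simp add: ring_mat_simps alg_rep_mult[OF L])
    show "(\<lambda>h\<in>carrier (uq p q). f h) (h \<oplus>\<^bsub>uq p q\<^esub> k)
      = (\<lambda>h\<in>carrier (uq p q). f h) h \<oplus>\<^bsub>ring_mat TYPE(complex) d ()\<^esub> (\<lambda>h\<in>carrier (uq p q). f h) k"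
      unfolding hk uq_class_ops[symmetric] r by (simp add: ring_mat_simps alg_rep_add[OF L])
  next
    show "(\<lambda>h\<in>carrier (uq p q). f h) \<one>\<^bsub>uq p q\<^esub> = \<one>\<^bsub>ring_mat TYPE(complex) d ()\<^esub>"
      unfolding uq_class_ops[symmetric] r by (simp add: ring_mat_simps alg_rep_one[OF L])
  qed
  then show "X \<in> modules p q"
    by (auto simp: modules_def X f scal_conv_smul alg_rep_smul[OF L] alg_rep_one[OF L])
qed

lemma alg_rep_eqI:
  assumes "alg_rep d L" "alg_rep d L'" "\<And>g. L (genr g) = L' (genr g)"
  shows "L x = L' x"
  by (induction x rule: free_alg_induct)
     (simp_all add: assms alg_rep_one[OF assms(1)] alg_rep_one[OF assms(2)] alg_rep_mult[OF assms(1)]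
       alg_rep_mult[OF assms(2)] alg_rep_add[OF assms(1)] alg_rep_add[OF assms(2)]
       alg_rep_smul[OF assms(1)] alg_rep_smul[OF assms(2)])

lemma module_eqI:
  assumes X: "X \<in> modules p q" and Y: "Y \<in> modules p q" and d: "fst X = fst Y"
    and g: "\<And>g. rep X (genr g) = rep Y (genr g)"
  shows "X = Y"
proof -
  have "rep X x = rep Y x" for x
    using alg_rep_eqI[of "fst Y" "rep X" "rep Y"] alg_rep_rep[OF X] alg_rep_rep[OF Y] d g by simp
  then have "snd X h = snd Y h" if "h \<in> carrier (uq p q)" for h
    using that by (auto simp: carrier_uq rep_def)
  moreover have "snd X \<in> extensional (carrier (uq p q))" "snd Y \<in> extensional (carrier (uq p q))"
    using X Y by (auto simp: modules_def)
  ultimately have "snd X = snd Y" by (intro extensionalityI)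
  then show ?thesis using d by (simp add: prod_eq_iff)
qed

lemma mod_homD:
  assumes "\<phi> \<in> mod_hom p q X Y"
  shows "\<phi> \<in> carrier_mat (fst Y) (fst X)" "\<phi> * rep X x = rep Y x * \<phi>"
  using assms by (auto simp: mod_hom_def rep_def)

lemma mod_homI:
  assumes "\<phi> \<in> carrier_mat (fst Y) (fst X)" "\<And>x. \<phi> * rep X x = rep Y x * \<phi>"
  shows "\<phi> \<in> mod_hom p q X Y"
  using assms by (auto simp: mod_hom_def rep_def carrier_uq)

lemma mod_hom_genI:
  assumes X: "X \<in> modules p q" and Y: "Y \<in> modules p q"
    and \<phi>: "\<phi> \<in> carrier_mat (fst Y) (fst X)" and g: "\<And>g. \<phi> * rep X (genr g) = rep Y (genr g) * \<phi>"
  shows "\<phi> \<in> mod_hom p q X Y"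
proof (rule mod_homI[OF \<phi>])
  note LX = alg_rep_rep[OF X] and LY = alg_rep_rep[OF Y]
  note cX = alg_rep_carrier[OF LX] and cY = alg_rep_carrier[OF LY]
  fix x show "\<phi> * rep X x = rep Y x * \<phi>"
  proof (induction x rule: free_alg_induct)
    case one
    show ?case using \<phi> by (simp add: alg_rep_one[OF LX] alg_rep_one[OF LY])
  next
    case (gen a x)
    have "\<phi> * rep X (genr a * x) = (\<phi> * rep X (genr a)) * rep X x"
      by (simp add: alg_rep_mult[OF LX] assoc_mult_mat[OF \<phi> cX cX])
    also have "\<dots> = rep Y (genr a) * (\<phi> * rep X x)"
      unfolding g by (rule assoc_mult_mat[OF cY \<phi> cX])
    also have "\<dots> = rep Y (genr a * x) * \<phi>"
      unfolding gen by (simp add: alg_rep_mult[OF LY] assoc_mult_mat[OF cY cY \<phi>])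
    finally show ?case .
  next
    case (add x y)
    then show ?case
      by (simp add: alg_rep_add[OF LX] alg_rep_add[OF LY] mult_add_distrib_mat[OF \<phi> cX cX]
          add_mult_distrib_mat[OF cY cY \<phi>])
  next
    case (smul c x)
    then show ?case
      by (simp add: alg_rep_smul[OF LX] alg_rep_smul[OF LY] mult_smult_distrib[OF \<phi> cX]
          mult_smult_assoc_mat[OF cY \<phi>])
  qed
qed

abbreviation trep :: "hmod \<Rightarrow> hmod \<Rightarrow> free_alg2 \<Rightarrow> complex mat" where
  "trep \<equiv> tensor_rep p q"

lemma trep_lin:
  "trep X Y = lin (fst X * fst Y) (\<lambda>(u, v). kron (rep X (Poly_Mapping.single u 1)) (rep Y (Poly_Mapping.single v 1)))"
  by (auto simp: tensor_rep_def lin_def rep_def fun_eq_iff intro!: arg_cong2[of _ _ _ _ "msum _"])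

context
  fixes X Y :: hmod
  assumes X: "X \<in> modules p q" and Y: "Y \<in> modules p q"
begin

lemma alg_rep_trep: "alg_rep (fst X * fst Y) (trep X Y)"
  unfolding trep_lin
proof (rule alg_rep_lin)
  note LX = alg_rep_rep[OF X] and LY = alg_rep_rep[OF Y]
  note cX = alg_rep_carrier[OF LX] and cY = alg_rep_carrier[OF LY]
  let ?M = "\<lambda>(u, v). kron (rep X (Poly_Mapping.single u 1)) (rep Y (Poly_Mapping.single v 1))"
  show "?M u \<in> carrier_mat (fst X * fst Y) (fst X * fst Y)" for u
    using cX cY by (auto split: prod.split)
  show "?M (u + v) = ?M u * ?M v" for u v
  proof -
    obtain a b a' b' where uv: "u = (a, b)" "v = (a', b')" by (cases u, cases v)
    have m: "Poly_Mapping.single (w + w') 1 = Poly_Mapping.single w 1 * (Poly_Mapping.single w' 1 :: free_alg)"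
      for w w' by (simp add: mult_single)
    show ?thesis
      by (simp add: uv kron_mult[OF cX cY cX cY] m alg_rep_mult[OF LX] alg_rep_mult[OF LY])
  qed
  show "?M 0 = 1\<^sub>m (fst X * fst Y)"
    by (simp add: zero_prod_def alg_rep_one[OF LX] alg_rep_one[OF LY] kron_one)
qed

lemma trep_tens: "trep X Y (tens x y) = kron (rep X x) (rep Y y)"
proof -
  note LX = alg_rep_rep[OF X] and LY = alg_rep_rep[OF Y] and L = alg_rep_trep
  note cX = alg_rep_carrier[OF LX] and cY = alg_rep_carrier[OF LY]
  let ?M = "\<lambda>(u, v). kron (rep X (Poly_Mapping.single u 1)) (rep Y (Poly_Mapping.single v 1))"
  have M: "?M u \<in> carrier_mat (fst X * fst Y) (fst X * fst Y)" for u
    using cX cY by (auto split: prod.split)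
  show ?thesis
  proof (induction x rule: poly_mapping_additive_induct)
    case (2 x x')
    then show ?case
      by (simp add: tens_add_left alg_rep_add[OF L] alg_rep_add[OF LX] kron_add_left[OF cX cX])
  next
    case (1 u a)
    show ?case
    proof (induction y rule: poly_mapping_additive_induct)
      case (2 y y')
      then show ?case
        by (simp add: tens_add_right alg_rep_add[OF L] alg_rep_add[OF LY] kron_add_right[OF cY cY])
    next
      case (1 v b)
      have s: "rep X (Poly_Mapping.single u a) = a \<cdot>\<^sub>m rep X (Poly_Mapping.single u 1)"
        "rep Y (Poly_Mapping.single v b) = b \<cdot>\<^sub>m rep Y (Poly_Mapping.single v 1)"
        using alg_rep_smul[OF LX, of a "Poly_Mapping.single u 1"]
          alg_rep_smul[OF LY, of b "Poly_Mapping.single v 1"] by (simp_all flip: single_conv_smul)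
      have ss: "a \<cdot>\<^sub>m (b \<cdot>\<^sub>m A) = (a * b) \<cdot>\<^sub>m A" for a b and A :: "complex mat"
        by (rule eq_matI) auto
      have "trep X Y (tens (Poly_Mapping.single u a) (Poly_Mapping.single v b)) = (a * b) \<cdot>\<^sub>m ?M (u, v)"
        unfolding trep_lin tens_single by (rule lin_single[OF M])
      then show ?case
        by (simp add: s kron_smult_left kron_smult_right ss mult.commute)
    qed
  qed
qed

lemma trep_uq2_ideal: "y \<in> uq2_ideal p q \<Longrightarrow> trep X Y y = 0\<^sub>m (fst X * fst Y) (fst X * fst Y)"
proof -
  note LX = alg_rep_rep[OF X] and LY = alg_rep_rep[OF Y] and L = alg_rep_trep
  have "uq2_ideal p q \<subseteq> {y. trep X Y y = 0\<^sub>m (fst X * fst Y) (fst X * fst Y)}"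
  proof (rule uq2_ideal_least[OF two_sided_kernel[OF L]])
    fix x assume "x \<in> uq_ideal p q"
    then have x: "x \<approx> 0" by (simp add: cg_def)
    have "rep X x = 0\<^sub>m (fst X) (fst X)" "rep Y x = 0\<^sub>m (fst Y) (fst Y)"
      using rep_cong[OF x] alg_rep_zero[OF LX] alg_rep_zero[OF LY] by simp_all
    then show "tens x 1 \<in> {y. trep X Y y = 0\<^sub>m (fst X * fst Y) (fst X * fst Y)} \<and>
        tens 1 x \<in> {y. trep X Y y = 0\<^sub>m (fst X * fst Y) (fst X * fst Y)}"
      by (simp add: trep_tens alg_rep_one[OF LX] alg_rep_one[OF LY] kron_zero_left kron_zero_right)
  qed
  then show "y \<in> uq2_ideal p q \<Longrightarrow> trep X Y y = 0\<^sub>m (fst X * fst Y) (fst X * fst Y)" by auto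
qed

lemma trep_cong: "x \<approx>\<^sub>2 y \<Longrightarrow> trep X Y x = trep X Y y"
  using trep_uq2_ideal[of "x - y"] alg_rep_eq_iff[OF alg_rep_trep, of x y] by (simp add: cg_def)

lemma
  shows tensor_mod_modules: "tensor_mod p q X Y \<in> modules p q"
    and rep_tensor_mod: "rep (tensor_mod p q X Y) x = trep X Y (Delta x)"
proof -
  note L = alg_rep_trep
  have L': "alg_rep (fst X * fst Y) (\<lambda>x. trep X Y (Delta x))"
    unfolding alg_rep_def
    by (simp add: alg_rep_carrier[OF L] alg_rep_add[OF L] alg_rep_mult[OF L] alg_rep_one[OF L]
        alg_rep_smul[OF L] Delta_add Delta_mult Delta_one Delta_smul)
  have ker: "trep X Y (Delta x) = 0\<^sub>m (fst X * fst Y) (fst X * fst Y)" if "x \<in> uq_ideal p q" for x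
    using that by (intro trep_uq2_ideal Delta_uq_ideal)
  have c: "comult p q (uq_class p q x) = uq2_class p q (Delta x)" for x
    unfolding comult_def uq_class_def Delta_def[symmetric]
  proof (rule induced_coset[OF two_sided_uq])
    fix y assume "y \<approx> x"
    then show "uq2_class p q (Delta y) = uq2_class p q (Delta x)"
      unfolding uq2_class_def coset_eq_iff_cg[OF two_sided_uq2] by (rule Delta_cong)
  qed
  have i: "induced (trep X Y) (comult p q (uq_class p q x)) = trep X Y (Delta x)" for x
    unfolding c uq2_class_def
    by (rule induced_coset[OF two_sided_uq2]) (rule trep_cong)
  note m = module_of_alg_rep[OF L' ker tensor_mod_def[of p q X Y] i]
  show "tensor_mod p q X Y \<in> modules p q" "rep (tensor_mod p q X Y) x = trep X Y (Delta x)"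
    using m by blast+
qed

end

lemma fst_tensor_mod [simp]: "fst (tensor_mod p q X Y) = fst X * fst Y"
  by (simp add: tensor_mod_def)

lemma rep_tensor_mod_gen:
  assumes X: "X \<in> modules p q" and Y: "Y \<in> modules p q"
  shows "rep (tensor_mod p q X Y) gE = kron (1\<^sub>m (fst X)) (rep Y gE) + kron (rep X gE) (rep Y gK)"
    and "rep (tensor_mod p q X Y) gF = kron (rep X gF) (1\<^sub>m (fst Y)) + kron (rep X Ki) (rep Y gF)"
    and "rep (tensor_mod p q X Y) gK = kron (rep X gK) (rep Y gK)"
    and "rep (tensor_mod p q X Y) Ki = kron (rep X Ki) (rep Y Ki)"
  by (simp_all add: rep_tensor_mod[OF X Y] Delta_E Delta_F Delta_K Delta_Ki alg_rep_add[OF alg_rep_trep[OF X Y]]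
      trep_tens[OF X Y] alg_rep_one[OF alg_rep_rep[OF X]] alg_rep_one[OF alg_rep_rep[OF Y]])

text \<open>
  Coassociativity makes the two bracketings of a triple tensor product literally the same module;
  it is enough to compare the actions of the three generators.
\<close>

lemma tensor_mod_assoc:
  assumes X: "X \<in> modules p q" and Y: "Y \<in> modules p q" and Z: "Z \<in> modules p q"
  shows "tensor_mod p q (tensor_mod p q X Y) Z = tensor_mod p q X (tensor_mod p q Y Z)"
proof (rule module_eqI)
  note XY = tensor_mod_modules[OF X Y] and YZ = tensor_mod_modules[OF Y Z]
  note cX = alg_rep_carrier[OF alg_rep_rep[OF X]] and cY = alg_rep_carrier[OF alg_rep_rep[OF Y]]
    and cZ = alg_rep_carrier[OF alg_rep_rep[OF Z]]
  show "tensor_mod p q (tensor_mod p q X Y) Z \<in> modules p q"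
    "tensor_mod p q X (tensor_mod p q Y Z) \<in> modules p q"
    by (rule tensor_mod_modules[OF XY Z], rule tensor_mod_modules[OF X YZ])
  show "fst (tensor_mod p q (tensor_mod p q X Y) Z) = fst (tensor_mod p q X (tensor_mod p q Y Z))"
    by (simp add: mult.assoc)
  have add3: "A + (B + C) = A + B + (C :: complex mat)"
    if "A \<in> carrier_mat n m" "B \<in> carrier_mat n m" "C \<in> carrier_mat n m" for A B C n m
    using that by (simp add: assoc_add_mat[of A n m])
  fix g show "rep (tensor_mod p q (tensor_mod p q X Y) Z) (genr g)
      = rep (tensor_mod p q X (tensor_mod p q Y Z)) (genr g)"
  proof (cases g)
    case GE
    have "kron (kron (1\<^sub>m (fst X)) (rep Y gE) + kron (rep X gE) (rep Y gK)) (rep Z gK)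
      = kron (1\<^sub>m (fst X)) (kron (rep Y gE) (rep Z gK)) + kron (rep X gE) (kron (rep Y gK) (rep Z gK))"
      by (subst kron_add_left[of _ "fst X * fst Y" "fst X * fst Y"]) (use cX cY in \<open>auto simp: kron_assoc\<close>)
    moreover have "kron (1\<^sub>m (fst X)) (kron (1\<^sub>m (fst Y)) (rep Z gE) + kron (rep Y gE) (rep Z gK))
      = kron (1\<^sub>m (fst X)) (kron (1\<^sub>m (fst Y)) (rep Z gE)) + kron (1\<^sub>m (fst X)) (kron (rep Y gE) (rep Z gK))"
      by (subst kron_add_right[of _ "fst Y * fst Z" "fst Y * fst Z"]) (use cY cZ in auto)
    moreover have "kron (1\<^sub>m (fst X * fst Y)) (rep Z gE) = kron (1\<^sub>m (fst X)) (kron (1\<^sub>m (fst Y)) (rep Z gE))"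
      by (simp flip: kron_one kron_assoc)
    ultimately show ?thesis
      by (simp add: GE rep_tensor_mod_gen[OF XY Z] rep_tensor_mod_gen[OF X YZ]
          rep_tensor_mod_gen[OF X Y] rep_tensor_mod_gen[OF Y Z])
        (rule add3[of _ "fst X * (fst Y * fst Z)" "fst X * (fst Y * fst Z)"]; use cX cY cZ in simp)
  next
    case GF
    have "kron (kron (rep X gF) (1\<^sub>m (fst Y)) + kron (rep X Ki) (rep Y gF)) (1\<^sub>m (fst Z))
      = kron (rep X gF) (kron (1\<^sub>m (fst Y)) (1\<^sub>m (fst Z))) + kron (rep X Ki) (kron (rep Y gF) (1\<^sub>m (fst Z)))"
      by (subst kron_add_left[of _ "fst X * fst Y" "fst X * fst Y"]) (use cX cY in \<open>auto simp: kron_assoc\<close>)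
    moreover have "kron (rep X Ki) (kron (rep Y gF) (1\<^sub>m (fst Z)) + kron (rep Y Ki) (rep Z gF))
      = kron (rep X Ki) (kron (rep Y gF) (1\<^sub>m (fst Z))) + kron (rep X Ki) (kron (rep Y Ki) (rep Z gF))"
      by (subst kron_add_right[of _ "fst Y * fst Z" "fst Y * fst Z"]) (use cY cZ in auto)
    ultimately show ?thesis
      by (simp add: GF rep_tensor_mod_gen[OF XY Z] rep_tensor_mod_gen[OF X YZ]
          rep_tensor_mod_gen[OF X Y] rep_tensor_mod_gen[OF Y Z] kron_assoc kron_one)
        (rule add3[symmetric, of _ "fst X * (fst Y * fst Z)" "fst X * (fst Y * fst Z)"]; use cX cY cZ in simp)
  next
    case GK
    then show ?thesis
      by (simp add: rep_tensor_mod_gen[OF XY Z] rep_tensor_mod_gen[OF X YZ]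
          rep_tensor_mod_gen[OF X Y] rep_tensor_mod_gen[OF Y Z] kron_assoc)
  qed
qed


section \<open>The regular module and coordinates\<close>

definition B :: "(expo) set" where
  "B = {..<p} \<times> {..<p} \<times> {..<p}"

abbreviation dimR :: nat where "dimR \<equiv> p * p * p"

fun enc :: "expo \<Rightarrow> nat" where
  "enc (i, j, k) = (i * p + j) * p + k"

definition dec :: "nat \<Rightarrow> expo" where
  "dec r = (r div p div p, r div p mod p, r mod p)"

lemma finite_B [simp, intro]: "finite B"
  by (simp add: B_def)

lemma B_iff [simp]: "(i, j, k) \<in> B \<longleftrightarrow> i < p \<and> j < p \<and> k < p"
  by (simp add: B_def)

lemma p_pos [simp]: "0 < p"
  using p_ge by simp

lemma enc_less: "s \<in> B \<Longrightarrow> enc s < dimR"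
  by (cases s) (auto intro!: mult_add_less)

lemma dec_enc: "s \<in> B \<Longrightarrow> dec (enc s) = s"
  by (cases s) (simp add: dec_def)

lemma enc_dec: "enc (dec r) = r"
  by (simp add: dec_def)

lemma dec_B: "r < dimR \<Longrightarrow> dec r \<in> B"
  using div_mod_less[of r "p * p" p] div_mod_less[of "r div p" p p] by (simp add: dec_def)

lemma enc_eq_iff: "s \<in> B \<Longrightarrow> t \<in> B \<Longrightarrow> enc s = enc t \<longleftrightarrow> s = t"
  by (metis dec_enc)

text \<open>
  The vector of \<open>F ^ i * K ^ j * E ^ k\<close> in the regular module. Reading \<open>j\<close> modulo \<open>p\<close> and letting
  the vector vanish for \<open>i \<ge> p\<close> or \<open>k \<ge> p\<close> makes the formulas for the action valid without
  boundary cases.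
\<close>

fun bv :: "expo \<Rightarrow> complex mat" where
  "bv (i, j, k) = (if i < p \<and> k < p then ucol dimR (enc (i, j mod p, k)) else 0\<^sub>m dimR 1)"

declare bv.simps [simp del] enc.simps [simp del]

lemma bv_carrier [simp, intro]: "bv s \<in> carrier_mat dimR 1"
  by (cases s) (auto simp: bv.simps)

lemma dim_bv [simp]: "dim_row (bv s) = dimR" "dim_col (bv s) = 1"
  using bv_carrier[of s] by auto

lemma bv_in_B: "s \<in> B \<Longrightarrow> bv s = ucol dimR (enc s)"
  by (cases s) (simp add: bv.simps)

lemma bv_mod: "bv (i, j mod p, k) = bv (i, j, k)"
  by (simp add: bv.simps)

lemma bv_add_p: "bv (i, p + j, k) = bv (i, j, k)"
  by (metis bv_mod mod_add_self1)

lemma bv_zero: "p \<le> i \<or> p \<le> k \<Longrightarrow> bv (i, j, k) = 0\<^sub>m dimR 1"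
  by (auto simp: bv.simps)

definition colmat :: "(expo \<Rightarrow> complex mat) \<Rightarrow> complex mat" where
  "colmat g = mat dimR dimR (\<lambda>(r, s). g (dec s) $$ (r, 0))"

lemma colmat_carrier [simp, intro]: "colmat g \<in> carrier_mat dimR dimR"
  by (simp add: colmat_def)

lemma colmat_bv:
  assumes "s \<in> B" "g s \<in> carrier_mat dimR 1" shows "colmat g * bv s = g s"
proof (rule eq_matI)
  fix r c assume "r < dim_row (g s)" "c < dim_col (g s)"
  then have "r < dimR" "c = 0" using assms by auto
  then show "(colmat g * bv s) $$ (r, c) = g s $$ (r, c)"
    using assms mult_ucol_index[OF colmat_carrier, of r "enc s" g] enc_less[of s]
    by (simp add: bv_in_B colmat_def dec_enc)
qed (use assms(2) in \<open>auto simp: colmat_def\<close>)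

lemma colmat_bv_all:
  assumes "\<And>s. g s \<in> carrier_mat dimR 1" and "\<And>i j k. g (i, j mod p, k) = g (i, j, k)"
    and "\<And>i j k. p \<le> i \<or> p \<le> k \<Longrightarrow> g (i, j, k) = 0\<^sub>m dimR 1"
  shows "colmat g * bv (i, j, k) = g (i, j, k)"
proof (cases "i < p \<and> k < p")
  case True
  then have "colmat g * bv (i, j mod p, k) = g (i, j mod p, k)"
    using assms(1) by (intro colmat_bv) simp_all
  then show ?thesis using assms(2) by (simp add: bv_mod)
next
  case False
  then have "p \<le> i \<or> p \<le> k" by auto
  then show ?thesis
    using assms(3) bv_zero right_mult_zero_mat[OF colmat_carrier[of g]] by metis
qed

lemma mat_eq_bvI:
  assumes "A \<in> carrier_mat m dimR" "A' \<in> carrier_mat m dimR"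
    "\<And>i j k. (i, j, k) \<in> B \<Longrightarrow> A * bv (i, j, k) = A' * bv (i, j, k)"
  shows "A = A'"
proof (rule mat_eq_ucolI[OF assms(1,2)])
  fix r assume r: "r < dimR"
  obtain i j k where d: "dec r = (i, j, k)" by (cases "dec r")
  have "(i, j, k) \<in> B" "ucol dimR r = bv (i, j, k)"
    using dec_B[OF r] enc_dec[of r] bv_in_B[of "dec r"] unfolding d by auto
  then show "A * ucol dimR r = A' * ucol dimR r" using assms(3) by metis
qed

text \<open>The coefficients are those of \<open>g * F ^ i * K ^ j * E ^ k\<close> in the monomials, for a generator \<open>g\<close>.\<close>

fun Ract :: "gen \<Rightarrow> expo \<Rightarrow> complex mat" where
  "Ract GF (i, j, k) = bv (Suc i, j, k)"
| "Ract GK (i, j, k) = Qi ^ i \<cdot>\<^sub>m bv (i, Suc j, k)"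
| "Ract GE (i, j, k) = Qi ^ j \<cdot>\<^sub>m bv (i, j, Suc k) +
     ((c0 * Sm i) \<cdot>\<^sub>m bv (i - 1, Suc j, k) + (- (c0 * Sp i)) \<cdot>\<^sub>m bv (i - 1, j + (p - 1), k))"

definition LR :: "free_alg \<Rightarrow> complex mat" where
  "LR = lin dimR (\<lambda>w. foldr (\<lambda>g A. colmat (Ract g) * A) (letters w) (1\<^sub>m dimR))"

lemma foldr_colmat_carrier:
  "foldr (\<lambda>g A. colmat (Ract g) * A) gs (1\<^sub>m dimR) \<in> carrier_mat dimR dimR"
  by (induction gs) (auto intro!: mult_carrier_mat[of _ dimR dimR])

lemma foldr_colmat_append:
  "foldr (\<lambda>g A. colmat (Ract g) * A) (gs @ hs) (1\<^sub>m dimR)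
    = foldr (\<lambda>g A. colmat (Ract g) * A) gs (1\<^sub>m dimR) * foldr (\<lambda>g A. colmat (Ract g) * A) hs (1\<^sub>m dimR)"
proof (induction gs)
  case Nil
  show ?case using foldr_colmat_carrier[of hs] by simp
next
  case (Cons g gs)
  show ?case
    using assoc_mult_mat[OF colmat_carrier[of "Ract g"] foldr_colmat_carrier[of gs] foldr_colmat_carrier[of hs]]
    by (simp add: Cons del: foldr_append)
qed

lemma alg_rep_LR: "alg_rep dimR LR"
  unfolding LR_def
  by (rule alg_rep_lin) (simp_all add: foldr_colmat_carrier foldr_colmat_append plus_word_def
      del: foldr_append)

lemma LR_carrier [simp, intro]: "LR x \<in> carrier_mat dimR dimR"
  by (rule alg_rep_carrier[OF alg_rep_LR])

lemma LR_genr: "LR (genr g) = colmat (Ract g)"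
proof -
  have "LR (genr g) = 1 \<cdot>\<^sub>m (colmat (Ract g) * 1\<^sub>m dimR)"
    unfolding LR_def genr_def by (subst lin_single) (simp_all add: foldr_colmat_carrier)
  then show ?thesis using colmat_carrier[of "Ract g"] by (simp, intro eq_matI) auto
qed

lemma LR_F: "LR gF * bv (i, j, k) = bv (Suc i, j, k)"
  unfolding LR_genr
  by (subst colmat_bv_all) (auto simp: bv_zero bv.simps)

lemma LR_K: "LR gK * bv (i, j, k) = Qi ^ i \<cdot>\<^sub>m bv (i, Suc j, k)"
  unfolding LR_genr
  by (subst colmat_bv_all) (auto simp: bv_zero bv.simps mod_Suc_eq)

lemma LR_E: "LR gE * bv (i, j, k) = Qi ^ j \<cdot>\<^sub>m bv (i, j, Suc k) +
     ((c0 * Sm i) \<cdot>\<^sub>m bv (i - 1, Suc j, k) + (- (c0 * Sp i)) \<cdot>\<^sub>m bv (i - 1, j + (p - 1), k))"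
  unfolding LR_genr
proof (subst colmat_bv_all)
  fix i j k
  have "bv (i, j mod p + (p - 1), k) = bv (i, j + (p - 1), k)" for i
    by (metis bv_mod mod_add_left_eq)
  moreover have "bv (i, Suc (j mod p), k) = bv (i, Suc j, k)" for i
    by (metis bv_mod mod_Suc_eq)
  moreover have "Qi ^ (j mod p) = Qi ^ j" by (simp add: Qi_power_eq_iff)
  ultimately show "Ract GE (i, j mod p, k) = Ract GE (i, j, k)"
    by (simp add: bv_mod del: One_nat_def)
  assume ik: "p \<le> i \<or> p \<le> k"
  then have z: "bv (i, j, Suc k) = 0\<^sub>m dimR 1" by (auto simp only: le_SucI intro!: bv_zero)
  have "Sm i = 0 \<and> Sp i = 0
      \<or> bv (i - 1, Suc j, k) = 0\<^sub>m dimR 1 \<and> bv (i - 1, j + (p - 1), k) = 0\<^sub>m dimR 1"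
  proof (cases "i = p")
    case False
    then have "p \<le> i - 1 \<or> p \<le> k" using ik by auto
    then show ?thesis using bv_zero by blast
  qed simp
  with z show "Ract GE (i, j, k) = 0\<^sub>m dimR 1"
    by (auto intro!: eq_matI simp del: One_nat_def)
qed auto

lemma LR_mult_bv: "LR (x * y) * bv s = LR x * (LR y * bv s)"
  by (simp add: alg_rep_mult[OF alg_rep_LR] assoc_mult_mat[OF LR_carrier LR_carrier bv_carrier])

lemma LR_comb: "LR x * (a \<cdot>\<^sub>m bv s + (b \<cdot>\<^sub>m bv t + c \<cdot>\<^sub>m bv u))
    = a \<cdot>\<^sub>m (LR x * bv s) + (b \<cdot>\<^sub>m (LR x * bv t) + c \<cdot>\<^sub>m (LR x * bv u))"
  unfolding mult_add_distrib_mat[OF LR_carrier smult_carrier_mat[OF bv_carrier]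
      add_carrier_mat[OF smult_carrier_mat[OF bv_carrier]]]
    mult_add_distrib_mat[OF LR_carrier smult_carrier_mat[OF bv_carrier] smult_carrier_mat[OF bv_carrier]]
    mult_smult_distrib[OF LR_carrier bv_carrier] ..

lemma LR_smult: "LR x * (a \<cdot>\<^sub>m bv s) = a \<cdot>\<^sub>m (LR x * bv s)"
  by (rule mult_smult_distrib[OF LR_carrier bv_carrier])

lemma LR_F_power: "LR (gF ^ m) * bv (i, j, k) = bv (m + i, j, k)"
  by (induction m) (simp_all add: LR_mult_bv LR_F alg_rep_one[OF alg_rep_LR])

lemma LR_K_power: "LR (gK ^ m) * bv (i, j, k) = Qi ^ (m * i) \<cdot>\<^sub>m bv (i, m + j, k)"
proof (induction m)
  case 0
  show ?case by (simp add: alg_rep_one[OF alg_rep_LR], intro eq_matI) auto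
next
  case (Suc m)
  then show ?case
    by (simp add: LR_mult_bv LR_smult LR_K power_add, intro eq_matI) auto
qed

lemma LR_E_power: "LR (gE ^ m) * bv (0, 0, k) = bv (0, 0, m + k)"
proof (induction m)
  case 0
  show ?case by (simp add: alg_rep_one[OF alg_rep_LR])
next
  case (Suc m)
  then show ?case
    by (simp add: LR_mult_bv LR_E, intro eq_matI) auto
qed

lemma LR_pbw: "LR (pbw (i, j, k)) * bv (0, 0, 0) = bv (i, j, k)"
proof -
  have "LR (pbw (i, j, k)) * bv (0, 0, 0) = 1 \<cdot>\<^sub>m bv (i, j, k)"
    by (simp add: LR_mult_bv LR_E_power LR_K_power LR_smult LR_F_power)
  then show ?thesis by (simp, intro eq_matI) auto
qed

lemma LR_Ki: "LR Ki * bv (i, j, k) = Q ^ i \<cdot>\<^sub>m bv (i, j + (p - 1), k)"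
  unfolding Kinv_def LR_K_power
  by (simp only: power_mult Qi_pred add.commute)

lemma LR_KE: "LR (gK * gE) = LR (Q \<cdot> (gE * gK))"
proof (rule mat_eq_bvI)
  fix i j k
  have a: "LR (gK * gE) * bv (i, j, k) = Qi ^ j \<cdot>\<^sub>m (Qi ^ i \<cdot>\<^sub>m bv (i, Suc j, Suc k)) +
     ((c0 * Sm i) \<cdot>\<^sub>m (Qi ^ (i - 1) \<cdot>\<^sub>m bv (i - 1, Suc (Suc j), k))
      + (- (c0 * Sp i)) \<cdot>\<^sub>m (Qi ^ (i - 1) \<cdot>\<^sub>m bv (i - 1, Suc (j + (p - 1)), k)))"
    unfolding LR_mult_bv LR_E LR_comb LR_K ..
  have "LR (Q \<cdot> (gE * gK)) * bv (i, j, k) = Q \<cdot>\<^sub>m (LR gE * (LR gK * bv (i, j, k)))"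
    using mult_smult_assoc_mat[OF LR_carrier bv_carrier, of Q "gE * gK" "(i, j, k)"]
    by (simp add: alg_rep_smul[OF alg_rep_LR] LR_mult_bv)
  also have "\<dots> = Q \<cdot>\<^sub>m (Qi ^ i \<cdot>\<^sub>m (Qi ^ Suc j \<cdot>\<^sub>m bv (i, Suc j, Suc k) +
     ((c0 * Sm i) \<cdot>\<^sub>m bv (i - 1, Suc (Suc j), k) + (- (c0 * Sp i)) \<cdot>\<^sub>m bv (i - 1, Suc j + (p - 1), k))))"
    unfolding LR_K LR_smult LR_E ..
  finally have b: "LR (Q \<cdot> (gE * gK)) * bv (i, j, k) = \<dots>" .
  have Qi: "i > 0 \<Longrightarrow> Qi ^ i = Qi * Qi ^ (i - 1)" by (simp flip: power_Suc)
  have Q1: "Q * (Qi * x) = x" for x by (simp only: mult.assoc[symmetric] Q_Qi) simp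
  show "LR (gK * gE) * bv (i, j, k) = LR (Q \<cdot> (gE * gK)) * bv (i, j, k)"
    unfolding a b
  proof (rule eq_matI, goal_cases)
    case (1 r c)
    then show ?case
      using Qi
      by (cases "i = 0") (simp_all add: Q1 distrib_left right_diff_distrib ac_simps del: One_nat_def)
  qed auto
qed auto

lemma LR_KF: "LR (gK * gF) = LR (Qi \<cdot> (gF * gK))"
proof (rule mat_eq_bvI)
  fix i j k
  have "LR (Qi \<cdot> (gF * gK)) * bv (i, j, k) = Qi \<cdot>\<^sub>m (LR gF * (LR gK * bv (i, j, k)))"
    using mult_smult_assoc_mat[OF LR_carrier bv_carrier, of Qi "gF * gK" "(i, j, k)"]
    by (simp add: alg_rep_smul[OF alg_rep_LR] LR_mult_bv)
  then show "LR (gK * gF) * bv (i, j, k) = LR (Qi \<cdot> (gF * gK)) * bv (i, j, k)"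
    by (simp add: LR_mult_bv LR_F LR_K LR_smult, intro eq_matI) auto
qed auto

lemma LR_EF: "LR (gE * gF) = LR (gF * gE + c0 \<cdot> (gK - Ki))"
proof (rule mat_eq_bvI)
  fix i j k
  have a: "LR (gE * gF) * bv (i, j, k) = Qi ^ j \<cdot>\<^sub>m bv (Suc i, j, Suc k) +
     ((c0 * Sm (Suc i)) \<cdot>\<^sub>m bv (i, Suc j, k) + (- (c0 * Sp (Suc i))) \<cdot>\<^sub>m bv (i, j + (p - 1), k))"
    by (simp add: LR_mult_bv LR_F LR_E)
  have "LR (gF * gE + c0 \<cdot> (gK - Ki)) * bv (i, j, k)
    = LR (gF * gE) * bv (i, j, k) + c0 \<cdot>\<^sub>m (LR gK * bv (i, j, k) - LR Ki * bv (i, j, k))"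
    unfolding alg_rep_add[OF alg_rep_LR] alg_rep_smul[OF alg_rep_LR] alg_rep_diff[OF alg_rep_LR]
      add_mult_distrib_mat[OF LR_carrier smult_carrier_mat[OF minus_carrier_mat[OF LR_carrier]] bv_carrier]
      mult_smult_assoc_mat[OF minus_carrier_mat[OF LR_carrier] bv_carrier]
      minus_mult_distrib_mat[OF LR_carrier LR_carrier bv_carrier] ..
  also have "LR (gF * gE) * bv (i, j, k) = Qi ^ j \<cdot>\<^sub>m bv (Suc i, j, Suc k) +
     ((c0 * Sm i) \<cdot>\<^sub>m bv (Suc (i - 1), Suc j, k) + (- (c0 * Sp i)) \<cdot>\<^sub>m bv (Suc (i - 1), j + (p - 1), k))"
    unfolding LR_mult_bv LR_E LR_comb LR_F ..
  finally have b: "LR (gF * gE + c0 \<cdot> (gK - Ki)) * bv (i, j, k) = Qi ^ j \<cdot>\<^sub>m bv (Suc i, j, Suc k) +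
     ((c0 * Sm i) \<cdot>\<^sub>m bv (Suc (i - 1), Suc j, k) + (- (c0 * Sp i)) \<cdot>\<^sub>m bv (Suc (i - 1), j + (p - 1), k))
     + c0 \<cdot>\<^sub>m (Qi ^ i \<cdot>\<^sub>m bv (i, Suc j, k) - Q ^ i \<cdot>\<^sub>m bv (i, j + (p - 1), k))"
    by (simp only: LR_K LR_Ki)
  have S: "Sm (Suc i) = Sm i + Qi ^ i" "Sp (Suc i) = Sp i + Q ^ i"
    by (simp_all add: Sm_def Sp_def)
  show "LR (gE * gF) * bv (i, j, k) = LR (gF * gE + c0 \<cdot> (gK - Ki)) * bv (i, j, k)"
    unfolding a b S
    by (rule eq_matI; cases "i = 0"; simp add: algebra_simps del: One_nat_def)
qed auto

lemma LR_kernel_qrel: "qrel_ideal p q {x. LR x = 0\<^sub>m dimR dimR}"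
  by unfold_locales
     (simp_all only: cg_def mem_Collect_eq two_sided_kernel[OF alg_rep_LR] alg_rep_eq_iff[OF alg_rep_LR]
       LR_KE LR_KF LR_EF)

text \<open>
  The three commutation relations suffice to move \<open>E ^ p\<close> past \<open>F ^ i * K ^ j\<close>, because \<open>Sp p\<close>
  and \<open>Sm p\<close> vanish. It then meets \<open>E ^ k\<close> next to the cyclic vector.
\<close>

lemma LR_E_p: "LR (gE ^ p) = 0\<^sub>m dimR dimR"
proof (rule mat_eq_bvI)
  let ?J = "{x. LR x = 0\<^sub>m dimR dimR}"
  interpret J: qrel_ideal p q ?J by (rule LR_kernel_qrel)
  fix i j k
  have "cg ?J (gE ^ p * gF) (1 \<cdot> (gF * gE ^ p))"
    using J.E_power_F[of p] by simp
  from J.qcomm_power[OF this, of 1 i] have F: "cg ?J (gE ^ p * gF ^ i) (gF ^ i * gE ^ p)" by simp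
  have K: "cg ?J (gE ^ p * gK ^ j) (gK ^ j * gE ^ p)"
    using J.EK_power[of p j] by (simp add: mult.commute[of j p] power_mult)
  have "gE ^ p * pbw (i, j, k) = (gE ^ p * gF ^ i) * (gK ^ j * gE ^ k)" by (simp add: mult.assoc)
  also have "cg ?J \<dots> ((gF ^ i * gE ^ p) * (gK ^ j * gE ^ k))" by (rule J.cmult_r[OF F])
  also have "\<dots> = gF ^ i * ((gE ^ p * gK ^ j) * gE ^ k)" by (simp add: mult.assoc)
  also have "cg ?J \<dots> (gF ^ i * ((gK ^ j * gE ^ p) * gE ^ k))" by (intro J.cmult_l J.cmult_r K)
  also have "\<dots> = pbw (i, j, p + k)" by (simp add: mult.assoc power_add)
  finally have "LR (gE ^ p * pbw (i, j, k)) = LR (pbw (i, j, p + k))"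
    by (simp only: cg_def mem_Collect_eq alg_rep_eq_iff[OF alg_rep_LR])
  then have "LR (gE ^ p) * bv (i, j, k) = bv (i, j, p + k)"
    by (simp only: LR_pbw[of i j k, symmetric] LR_mult_bv[symmetric]) (simp only: LR_pbw)
  also have "\<dots> = 0\<^sub>m dimR dimR * bv (i, j, k)"
    by (simp add: bv_zero left_mult_zero_mat[OF bv_carrier])
  finally show "LR (gE ^ p) * bv (i, j, k) = 0\<^sub>m dimR dimR * bv (i, j, k)" .
qed auto

lemma LR_F_p: "LR (gF ^ p) = 0\<^sub>m dimR dimR"
  by (rule mat_eq_bvI) (auto simp: LR_F_power bv_zero left_mult_zero_mat[OF bv_carrier])

lemma LR_K_p: "LR (gK ^ p) = LR 1"
proof (rule mat_eq_bvI)
  fix i j k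
  have "Qi ^ (p * i) = 1" by (simp add: power_mult)
  then show "LR (gK ^ p) * bv (i, j, k) = LR 1 * bv (i, j, k)"
    by (simp add: LR_K_power bv_add_p alg_rep_one[OF alg_rep_LR], intro eq_matI) auto
qed auto

lemma uq_relations_alt:
  "uq_relations p q = {gK * gE - Q \<cdot> (gE * gK), gK * gF - Qi \<cdot> (gF * gK),
     gE * gF - (gF * gE + c0 \<cdot> (gK - Ki)), gE ^ p, gF ^ p, gK ^ p - 1}"
  by (simp add: uq_relations_def smul_def mult.assoc diff_diff_eq)

lemma LR_uq_ideal: "x \<in> uq_ideal p q \<Longrightarrow> LR x = 0\<^sub>m dimR dimR"
proof -
  have "uq_relations p q \<subseteq> {x. LR x = 0\<^sub>m dimR dimR}"
    by (simp only: uq_relations_alt insert_subset empty_subsetI mem_Collect_eq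
        alg_rep_eq_iff[OF alg_rep_LR] LR_KE LR_KF LR_EF LR_E_p LR_F_p LR_K_p simp_thms)
  then show "x \<in> uq_ideal p q \<Longrightarrow> LR x = 0\<^sub>m dimR dimR"
    using uq_ideal_least[OF two_sided_kernel[OF alg_rep_LR]] by blast
qed

definition R :: hmod where
  "R = (dimR, \<lambda>h\<in>carrier (uq p q). induced LR h)"

lemma R_module: "R \<in> modules p q" and rep_R: "rep R x = LR x"
proof -
  have c: "LR y = LR x" if "y \<approx> x" for x y
    using that LR_uq_ideal[of "y - x"] alg_rep_eq_iff[OF alg_rep_LR] by (simp add: cg_def)
  have i: "induced LR (uq_class p q x) = LR x" for x
    unfolding uq_class_def by (rule induced_coset[OF two_sided_uq]) (rule c)
  show "R \<in> modules p q" "rep R x = LR x"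
    using module_of_alg_rep[OF alg_rep_LR LR_uq_ideal R_def i] by blast+
qed

lemma fst_R [simp]: "fst R = dimR"
  by (simp add: R_def)


subsection \<open>The monomial basis\<close>

definition pbw_sum :: "(expo \<Rightarrow> complex) \<Rightarrow> free_alg" where
  "pbw_sum a = (\<Sum>s\<in>B. a s \<cdot> pbw s)"

definition pbw_sum2 :: "(expo \<Rightarrow> expo \<Rightarrow> complex) \<Rightarrow> free_alg2" where
  "pbw_sum2 c = (\<Sum>s\<in>B. \<Sum>t\<in>B. c s t \<cdot> tens (pbw s) (pbw t))"

abbreviation o0 :: "expo" where "o0 \<equiv> (0, 0, 0)"

definition coord :: "free_alg \<Rightarrow> expo \<Rightarrow> complex" where
  "coord x s = (LR x * bv o0) $$ (enc s, 0)"

definition coord2 :: "free_alg2 \<Rightarrow> expo \<Rightarrow> expo \<Rightarrow> complex" where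
  "coord2 y s t = (trep R R y * kron (bv o0) (bv o0)) $$ (enc s * dimR + enc t, 0)"

lemma pbw_sum_add: "pbw_sum (\<lambda>s. a s + b s) = pbw_sum a + pbw_sum b"
  by (simp add: pbw_sum_def add_smul sum.distrib)

lemma pbw_sum_smul: "pbw_sum (\<lambda>s. c * a s) = c \<cdot> pbw_sum a"
  by (simp add: pbw_sum_def smul_sum)

lemma pbw_sum2_add: "pbw_sum2 (\<lambda>s t. a s t + b s t) = pbw_sum2 a + pbw_sum2 b"
  by (simp add: pbw_sum2_def add_smul sum.distrib)

lemma pbw_sum2_tens: "tens (pbw_sum a) (pbw_sum b) = pbw_sum2 (\<lambda>s t. a s * b t)"
  unfolding pbw_sum_def pbw_sum2_def tens_sum_left tens_sum_right
  by simp (subst sum.swap, simp add: mult.commute)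

lemma additive_pbw_sum:
  assumes "\<And>x y. f (x + y) = f x + f y" "\<And>c x. f (c \<cdot> x) = c * (f x :: complex)"
  shows "f (pbw_sum a) = (\<Sum>s\<in>B. a s * f (pbw s))"
proof -
  have z: "f 0 = 0" using assms(2)[of 0 0] by simp
  have "f (\<Sum>s\<in>S. a s \<cdot> pbw s) = (\<Sum>s\<in>S. a s * f (pbw s))" for S
    by (induction S rule: infinite_finite_induct) (simp_all add: z assms)
  then show ?thesis by (simp add: pbw_sum_def)
qed

lemma additive_pbw_sum2:
  assumes add: "\<And>x y. f (x + y) = f x + f y" and sc: "\<And>c x. f (c \<cdot> x) = c * (f x :: complex)"
  shows "f (pbw_sum2 c) = (\<Sum>s\<in>B. \<Sum>t\<in>B. c s t * f (tens (pbw s) (pbw t)))"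
proof -
  have z: "f 0 = 0" using sc[of 0 0] by simp
  have s: "f (\<Sum>i\<in>S. g i) = (\<Sum>i\<in>S. f (g i))" for S and g :: "expo \<Rightarrow> _"
    by (induction S rule: infinite_finite_induct) (simp_all add: z add)
  show ?thesis by (simp add: pbw_sum2_def s sc)
qed

lemma spanning: "\<exists>a. x \<approx> pbw_sum a"
proof -
  define S where "S = {x. \<exists>a. x \<approx> pbw_sum a}"
  have add: "x + y \<in> S" if "x \<in> S" "y \<in> S" for x y
    using that I.cadd unfolding S_def by (fastforce simp: pbw_sum_add[symmetric])
  have smul: "c \<cdot> x \<in> S" if "x \<in> S" for c x
    using that I.csmul unfolding S_def by (fastforce simp: pbw_sum_smul[symmetric])
  have cong: "x \<in> S" if "x \<approx> y" "y \<in> S" for x y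
    using that I.ctrans unfolding S_def by blast
  have zero: "0 \<in> S"
    unfolding S_def using I.crefl[of 0] by (auto intro!: exI[of _ "\<lambda>_. 0"] simp: pbw_sum_def)
  have bsS: "pbw (i, j, k) \<in> S" for i j k
  proof -
    consider "i \<ge> p" | "k \<ge> p" | "i < p" "k < p" by linarith
    then show ?thesis
    proof cases
      case 1
      have "gF ^ i = gF ^ p * gF ^ (i - p)" using 1 by (simp flip: power_add)
      also have "\<dots> \<approx> 0 * gF ^ (i - p)" by (intro I.cmult_r F_p)
      finally have "gF ^ i * (gK ^ j * gE ^ k) \<approx> 0 * (gK ^ j * gE ^ k)"
        by (intro I.cmult_r) simp
      then show ?thesis by (intro cong[OF _ zero]) (simp add: mult.assoc)
    next
      case 2
      have "gE ^ k = gE ^ (k - p) * gE ^ p" using 2 by (simp flip: power_add)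
      also have "\<dots> \<approx> gE ^ (k - p) * 0" by (intro I.cmult_l E_p)
      finally have "(gF ^ i * gK ^ j) * gE ^ k \<approx> (gF ^ i * gK ^ j) * 0"
        by (intro I.cmult_l) simp
      then show ?thesis by (intro cong[OF _ zero]) (simp add: mult.assoc)
    next
      case 3
      have "gK ^ j = (gK ^ p) ^ (j div p) * gK ^ (j mod p)"
        by (simp flip: power_mult power_add)
      also have "\<dots> \<approx> 1 ^ (j div p) * gK ^ (j mod p)" by (intro I.cmult_r I.cpower K_p)
      finally have "gF ^ i * gK ^ j * gE ^ k \<approx> gF ^ i * gK ^ (j mod p) * gE ^ k"
        by (intro I.cmult_r I.cmult_l) simp
      then have a: "pbw (i, j, k) \<approx> pbw (i, j mod p, k)" by simp
      have "pbw_sum (\<lambda>s. if s = (i, j mod p, k) then 1 else 0)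
        = (\<Sum>s\<in>B. if s = (i, j mod p, k) then pbw s else 0)"
        unfolding pbw_sum_def by (intro sum.cong) auto
      also have "\<dots> = pbw (i, j mod p, k)" using 3 by (simp add: sum.delta del: pbw.simps)
      finally have "pbw (i, j mod p, k) \<in> S"
        unfolding S_def using I.crefl by (metis (mono_tags, lifting) mem_Collect_eq)
      then show ?thesis by (rule cong[OF a])
    qed
  qed
  have sum: "(\<Sum>s\<in>T. f s) \<in> S" if "\<And>s. s \<in> T \<Longrightarrow> f s \<in> S" for T and f :: "expo \<Rightarrow> free_alg"
    using that by (induction T rule: infinite_finite_induct) (auto simp: zero add)
  have gen_pbw: "genr g * pbw s \<in> S" for g s
  proof -
    obtain i j k where s: "s = (i, j, k)" by (cases s)
    show ?thesis
    proof (cases g)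
      case GE
      have "- x \<in> S" if "x \<in> S" for x using smul[OF that, of "-1"] by (simp add: minus_smul)
      then have diff: "x - y \<in> S" if "x \<in> S" "y \<in> S" for x y using add[of x "- y"] that by simp
      show ?thesis unfolding GE s by (rule cong[OF I.E_pbw]) (intro add smul diff bsS)
    next
      case GF
      show ?thesis unfolding GF s I.F_pbw by (rule bsS)
    next
      case GK
      show ?thesis unfolding GK s using cong[OF I.K_pbw[of 1 i j k]] smul bsS by (metis power_one_right)
    qed
  qed
  have "x \<in> S"
  proof (induction x rule: free_alg_induct)
    case one
    show ?case using bsS[of 0 0 0] by simp
  next
    case (gen g x)
    then obtain a where "x \<approx> pbw_sum a" by (auto simp: S_def)
    then have "genr g * x \<approx> genr g * pbw_sum a" by (rule I.cmult_l)
    moreover have "genr g * pbw_sum a = (\<Sum>s\<in>B. a s \<cdot> (genr g * pbw s))"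
      by (simp add: pbw_sum_def sum_distrib_left)
    ultimately show ?case
      using sum[of B "\<lambda>s. a s \<cdot> (genr g * pbw s)"] smul gen_pbw cong by simp
  qed (auto intro: add smul)
  then show ?thesis by (simp add: S_def)
qed

lemma coord_add: "coord (x + y) s = coord x s + coord y s" if "s \<in> B"
  using enc_less[OF that]
  by (simp add: coord_def alg_rep_add[OF alg_rep_LR] add_mult_distrib_mat[OF LR_carrier LR_carrier bv_carrier]
      carrier_matD[OF LR_carrier] del: index_mult_mat(1))

lemma coord_smul: "coord (c \<cdot> x) s = c * coord x s" if "s \<in> B"
  using enc_less[OF that]
  by (simp add: coord_def alg_rep_smul[OF alg_rep_LR] mult_smult_assoc_mat[OF LR_carrier bv_carrier]
      carrier_matD[OF LR_carrier] del: index_mult_mat(1))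

lemma coord_diff: "coord (x - y) s = coord x s - coord y s" if "s \<in> B"
  using coord_add[OF that, of "x - y" y] by simp

lemma coord_zero: "coord 0 s = 0" if "s \<in> B"
  using coord_diff[OF that, of 0 0] by simp

lemma coord_cong: "x \<approx> y \<Longrightarrow> coord x s = coord y s"
  using rep_cong[of x y R] by (simp add: coord_def rep_R)

lemma coord_pbw: "s \<in> B \<Longrightarrow>
  coord (pbw (i, j, k)) s = (if i < p \<and> k < p \<and> s = (i, j mod p, k) then 1 else 0)"
  unfolding coord_def LR_pbw
  using enc_less[of s] enc_less[of "(i, j mod p, k)"] enc_eq_iff[of s "(i, j mod p, k)"]
  by (simp add: bv.simps)

lemma coord_pbw_sum: "s \<in> B \<Longrightarrow> coord (pbw_sum a) s = a s"
proof -
  assume s: "s \<in> B"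
  have "coord (pbw_sum a) s = (\<Sum>t\<in>B. a t * coord (pbw t) s)"
    by (rule additive_pbw_sum[of "\<lambda>x. coord x s"]) (simp_all add: coord_add coord_smul s)
  also have "\<dots> = (\<Sum>t\<in>B. if t = s then a s else 0)"
  proof (rule sum.cong[OF refl])
    fix t assume t: "t \<in> B"
    obtain i j k where [simp]: "t = (i, j, k)" by (cases t)
    show "a t * coord (pbw t) s = (if t = s then a s else 0)"
      using t s by (auto simp: coord_pbw simp del: pbw.simps)
  qed
  finally show ?thesis using s by simp
qed

lemma expand: "x \<approx> pbw_sum (coord x)"
proof -
  obtain a where a: "x \<approx> pbw_sum a" using spanning by blast
  have "pbw_sum a = pbw_sum (coord x)"
    unfolding pbw_sum_def using coord_cong[OF a] by (intro sum.cong) (simp_all add: coord_pbw_sum)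
  then show ?thesis using a by simp
qed

lemma coord_eqI: "(\<And>s. s \<in> B \<Longrightarrow> coord x s = coord y s) \<Longrightarrow> x \<approx> y"
proof -
  assume "\<And>s. s \<in> B \<Longrightarrow> coord x s = coord y s"
  then have "pbw_sum (coord x) = pbw_sum (coord y)" unfolding pbw_sum_def by (intro sum.cong) simp_all
  then show ?thesis using expand[of x] I.csym[OF expand[of y]] I.ctrans by metis
qed

abbreviation e00 :: "complex mat" where "e00 \<equiv> kron (bv o0) (bv o0)"

lemma e00_carrier: "e00 \<in> carrier_mat (dimR * dimR) 1"
  using kron_carrier[OF bv_carrier bv_carrier, of o0 o0] by simp

lemma trep_RR_carrier: "trep R R y \<in> carrier_mat (dimR * dimR) (dimR * dimR)"
  using alg_rep_carrier[OF alg_rep_trep[OF R_module R_module]] by simp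

lemma enc2_less: "s \<in> B \<Longrightarrow> t \<in> B \<Longrightarrow> enc s * dimR + enc t < dimR * dimR"
  by (intro mult_add_less enc_less)

context
  fixes s t assumes st: "s \<in> B" "t \<in> B"
begin

lemma coord2_add: "coord2 (x + y) s t = coord2 x s t + coord2 y s t"
  using enc2_less[OF st] alg_rep_add[OF alg_rep_trep[OF R_module R_module]]
  by (simp add: coord2_def add_mult_distrib_mat[OF trep_RR_carrier trep_RR_carrier e00_carrier]
      carrier_matD[OF trep_RR_carrier] del: index_mult_mat(1))

lemma coord2_smul: "coord2 (c \<cdot> x) s t = c * coord2 x s t"
  using enc2_less[OF st] alg_rep_smul[OF alg_rep_trep[OF R_module R_module]]
  by (simp add: coord2_def mult_smult_assoc_mat[OF trep_RR_carrier e00_carrier]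
      carrier_matD[OF trep_RR_carrier] del: index_mult_mat(1))

lemma coord2_diff: "coord2 (x - y) s t = coord2 x s t - coord2 y s t"
  using coord2_add[of "x - y" y] by simp

lemma coord2_zero: "coord2 0 s t = 0"
  using coord2_diff[of 0 0] by simp

lemma coord2_sum: "coord2 (\<Sum>i\<in>S. f i) s t = (\<Sum>i\<in>S. coord2 (f i) s t)"
  by (induction S rule: infinite_finite_induct) (simp_all add: coord2_zero coord2_add)

lemma coord2_tens: "coord2 (tens x y) s t = coord x s * coord y t"
proof -
  have "trep R R (tens x y) * e00 = kron (LR x * bv o0) (LR y * bv o0)"
    by (simp add: trep_tens[OF R_module R_module] rep_R kron_mult[OF LR_carrier LR_carrier bv_carrier bv_carrier])
  moreover have "(enc s * dimR + enc t) div dimR = enc s" "(enc s * dimR + enc t) mod dimR = enc t"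
    using enc_less[OF st(2)] by (simp_all add: div_mult_self3[of dimR "enc t" "enc s"])
  ultimately show ?thesis
    using enc2_less[OF st]
    by (simp add: coord2_def coord_def kron_index carrier_matD[OF LR_carrier] del: index_mult_mat(1))
qed

end

lemma coord2_cong: "x \<approx>\<^sub>2 y \<Longrightarrow> coord2 x s t = coord2 y s t"
  using trep_cong[OF R_module R_module, of x y] by (simp add: coord2_def)

lemma coord2_pbw_sum2:
  assumes "s \<in> B" "t \<in> B" shows "coord2 (pbw_sum2 c) s t = c s t"
proof -
  have pbw: "coord (pbw u) s = (if u = s then 1 else 0)" if "u \<in> B" "s \<in> B" for u s
    using that by (cases u) (auto simp: coord_pbw simp del: pbw.simps)
  have "coord2 (pbw_sum2 c) s t = (\<Sum>u\<in>B. \<Sum>v\<in>B. c u v * coord2 (tens (pbw u) (pbw v)) s t)"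
    by (rule additive_pbw_sum2[of "\<lambda>x. coord2 x s t"]) (simp_all add: coord2_add coord2_smul assms)
  also have "\<dots> = (\<Sum>u\<in>B. \<Sum>v\<in>B. if v = t then if u = s then c s t else 0 else 0)"
    by (intro sum.cong refl) (simp add: coord2_tens assms pbw)
  finally show ?thesis using assms by simp
qed

lemma expand2: "y \<approx>\<^sub>2 pbw_sum2 (coord2 y)"
proof -
  have "\<exists>c. y \<approx>\<^sub>2 pbw_sum2 c"
  proof (induction y rule: tens_induct)
    case (tens x x')
    have "tens x x' \<approx>\<^sub>2 tens (pbw_sum (coord x)) (pbw_sum (coord x'))" by (intro tens_cong expand)
    then show ?case by (auto simp: pbw_sum2_tens)
  next
    case (add x y)
    then obtain a b where "x \<approx>\<^sub>2 pbw_sum2 a" "y \<approx>\<^sub>2 pbw_sum2 b" by blast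
    then have "x + y \<approx>\<^sub>2 pbw_sum2 (\<lambda>s t. a s t + b s t)" unfolding pbw_sum2_add by (rule I2.cadd)
    then show ?case by blast
  qed
  then obtain c where c: "y \<approx>\<^sub>2 pbw_sum2 c" by blast
  have "pbw_sum2 c = pbw_sum2 (coord2 y)"
    unfolding pbw_sum2_def using coord2_cong[OF c] by (intro sum.cong) (simp_all add: coord2_pbw_sum2)
  then show ?thesis using c by simp
qed

lemma coord2_eqI: "(\<And>s t. s \<in> B \<Longrightarrow> t \<in> B \<Longrightarrow> coord2 x s t = coord2 y s t) \<Longrightarrow> x \<approx>\<^sub>2 y"
proof -
  assume "\<And>s t. s \<in> B \<Longrightarrow> t \<in> B \<Longrightarrow> coord2 x s t = coord2 y s t"
  then have "pbw_sum2 (coord2 x) = pbw_sum2 (coord2 y)" unfolding pbw_sum2_def by (intro sum.cong) simp_all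
  then show ?thesis using expand2[of x] I2.csym[OF expand2[of y]] I2.ctrans by metis
qed

subsection \<open>Multiplication and comultiplication in coordinates\<close>

lemma coord_E_pbw:
  assumes "s \<in> B"
  shows "coord (gE * pbw (i, j, k)) s = Qi ^ j * coord (pbw (i, j, Suc k)) s
    + c0 * (Sm i * coord (pbw (i - 1, Suc j, k)) s - Sp i * coord (pbw (i - 1, j + (p - 1), k)) s)"
  unfolding coord_cong[OF I.E_pbw] using assms
  by (simp add: coord_add coord_diff coord_smul del: pbw.simps One_nat_def)

lemma coord_pbw_F:
  assumes "s \<in> B"
  shows "coord (pbw (i, j, k) * gF) s = Qi ^ j * coord (pbw (Suc i, j, k)) s
    + c0 * (Sm k * coord (pbw (i, Suc j, k - 1)) s - Sp k * coord (pbw (i, j + (p - 1), k - 1)) s)"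
  unfolding coord_cong[OF I.pbw_F] using assms
  by (simp add: coord_add coord_diff coord_smul del: pbw.simps One_nat_def)

lemma coord_K_pbw:
  assumes "s \<in> B"
  shows "coord (gK ^ m * pbw (i, j, k)) s = Qi ^ (m * i) * coord (pbw (i, m + j, k)) s"
    and "coord (pbw (i, j, k) * gK ^ m) s = Qi ^ (m * k) * coord (pbw (i, j + m, k)) s"
  unfolding coord_cong[OF I.K_pbw] coord_cong[OF I.pbw_K] using assms
  by (simp_all add: coord_smul del: pbw.simps)

text \<open>
  The multiplication of the dual algebra, seen by the functionals on it: \<open>g\<close> gives the values on
  the dual basis, and is evaluated at the product of the basis vectors \<open>s\<close> and \<open>t\<close>. Invariant
  cochains form a subcomplex of the Hochschild complex of the dual algebra with trivial coefficients.
\<close>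

definition dualmult :: "(expo \<Rightarrow> complex) \<Rightarrow> expo \<Rightarrow> expo \<Rightarrow> complex" where
  "dualmult g s t = (\<Sum>r\<in>B. g r * coord2 (Delta (pbw r)) s t)"

lemma coord2_Delta: "s \<in> B \<Longrightarrow> t \<in> B \<Longrightarrow> coord2 (Delta x) s t = dualmult (coord x) s t"
proof -
  assume st: "s \<in> B" "t \<in> B"
  have "coord2 (Delta x) s t = coord2 (Delta (pbw_sum (coord x))) s t"
    by (intro coord2_cong Delta_cong expand)
  also have "\<dots> = dualmult (coord x) s t"
    unfolding dualmult_def
    by (rule additive_pbw_sum[of "\<lambda>x. coord2 (Delta x) s t"])
       (simp_all add: Delta_add Delta_smul coord2_add coord2_smul st)
  finally show ?thesis .
qed

definition dualcoeff :: "nat \<Rightarrow> nat \<Rightarrow> nat \<Rightarrow> nat \<Rightarrow> complex" where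
  "dualcoeff a c b d = gauss_binom Q (a + b) b * gauss_binom Q (c + d) c * Qi ^ (c * d)"

lemma dualmult_formula:
  assumes st: "(a, j1, c) \<in> B" "(b, j2, d) \<in> B"
  shows "dualmult g (a, j1, c) (b, j2, d) =
    (if a + b < p \<and> c + d < p \<and> (j1 + b + c) mod p = j2
     then dualcoeff a c b d * g (a + b, (j1 + b) mod p, c + d) else 0)"
proof -
  have modj: "((p - 1) * b + j) mod p = j1 \<longleftrightarrow> j = (j1 + b) mod p" if "j < p" "j1 < p" for j b j1
  proof -
    have e: "(p - 1) * b + b = p * b"
      using p_ge by (metis Suc_diff_1 add.commute mult_Suc p_pos)
    show ?thesis
    proof
      assume "((p - 1) * b + j) mod p = j1"
      then have "(j1 + b) mod p = (((p - 1) * b + j) + b) mod p" by (metis mod_add_left_eq)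
      also have "((p - 1) * b + j) + b = j + p * b" using e by simp
      also have "(j + p * b) mod p = j" using that by simp
      finally show "j = (j1 + b) mod p" ..
    next
      assume "j = (j1 + b) mod p"
      then have "((p - 1) * b + j) mod p = ((p - 1) * b + (j1 + b)) mod p" by (metis mod_add_right_eq)
      also have "(p - 1) * b + (j1 + b) = j1 + p * b" using e by simp
      finally show "((p - 1) * b + j) mod p = j1" using that by simp
    qed
  qed
  have mult_ind: "(if A then 1 else 0) * (if A' then 1 else 0) = (if A \<and> A' then 1 else (0::complex))"
    for A A' by simp
  have pair_eqs: "(i' < p \<and> c' < p \<and> (a, j1, c) = (i', x1, c')) \<and> (b' < p \<and> k' < p \<and> (b, j2, d) = (b', x2, k'))
     \<longleftrightarrow> i' = a \<and> x1 = j1 \<and> c' = c \<and> b' = b \<and> x2 = j2 \<and> k' = d" for i' c' b' k' x1 x2 :: nat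
    using st by auto
  have D: "coord2 (Delta (pbw (i, j, k))) (a, j1, c) (b, j2, d) =
    (if i = a + b \<and> k = c + d \<and> j = (j1 + b) mod p \<and> (j + c) mod p = j2 then dualcoeff a c b d else 0)"
    if r: "(i, j, k) \<in> B" for i j k
  proof -
    let ?G = "\<lambda>b' c'. gauss_binom Q i b' * gauss_binom Q k c' * Qi ^ (c' * (k - c'))"
    have "coord2 (Delta (pbw (i, j, k))) (a, j1, c) (b, j2, d) =
      (\<Sum>b'\<le>i. \<Sum>c'\<le>k. ?G b' c' * (coord (pbw (i - b', (p - 1) * b' + j, c')) (a, j1, c)
          * coord (pbw (b', j + c', k - c')) (b, j2, d)))"
      unfolding coord2_cong[OF Delta_pbw] coord2_sum[OF st] coord2_smul[OF st] coord2_tens[OF st] ..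
    also have "\<dots> = (\<Sum>b'\<le>i. \<Sum>c'\<le>k. if c' = c then if b' = b then
        (if i = a + b \<and> k = c + d \<and> j = (j1 + b) mod p \<and> (j + c) mod p = j2 then dualcoeff a c b d else 0)
        else 0 else 0)"
    proof (intro sum.cong refl)
      fix b' c' assume "b' \<in> {..i}" "c' \<in> {..k}"
      then have le: "b' \<le> i" "c' \<le> k" by auto
      have "coord (pbw (i - b', (p - 1) * b' + j, c')) (a, j1, c) * coord (pbw (b', j + c', k - c')) (b, j2, d)
        = (if (i - b' < p \<and> c' < p \<and> (a, j1, c) = (i - b', ((p - 1) * b' + j) mod p, c')) \<and>
            (b' < p \<and> k - c' < p \<and> (b, j2, d) = (b', (j + c') mod p, k - c')) then 1 else 0)"
        unfolding coord_pbw[OF st(1)] coord_pbw[OF st(2)] by (simp only: mult_ind)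
      also have "\<dots> = (if c' = c \<and> b' = b \<and> i = a + b \<and> k = c + d \<and> j = (j1 + b) mod p \<and> (j + c) mod p = j2
           then 1 else 0)"
      proof (cases "b' = b \<and> c' = c")
        case True
        have m: "((p - 1) * b + j) mod p = j1 \<longleftrightarrow> j = (j1 + b) mod p"
          by (rule modj) (use st r in auto)
        have ik: "i - b = a \<longleftrightarrow> i = a + b" "k - c = d \<longleftrightarrow> k = c + d" using True le by auto
        show ?thesis unfolding pair_eqs using True by (simp only: m ik simp_thms conj_ac)
      next
        case False
        then have "(b' = b \<and> c' = c) = False" by simp
        then show ?thesis unfolding pair_eqs by auto
      qed
      finally have pq: "coord (pbw (i - b', (p - 1) * b' + j, c')) (a, j1, c)
          * coord (pbw (b', j + c', k - c')) (b, j2, d)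
        = (if c' = c \<and> b' = b \<and> i = a + b \<and> k = c + d \<and> j = (j1 + b) mod p \<and> (j + c) mod p = j2
           then 1 else 0)" .
      show "?G b' c' * (coord (pbw (i - b', (p - 1) * b' + j, c')) (a, j1, c)
          * coord (pbw (b', j + c', k - c')) (b, j2, d)) = (if c' = c then if b' = b then
        (if i = a + b \<and> k = c + d \<and> j = (j1 + b) mod p \<and> (j + c) mod p = j2 then dualcoeff a c b d else 0)
        else 0 else 0)"
        unfolding pq by (auto simp: dualcoeff_def)
    qed
    also have "\<dots> = (if i = a + b \<and> k = c + d \<and> j = (j1 + b) mod p \<and> (j + c) mod p = j2 then dualcoeff a c b d else 0)"
      by (auto intro!: sum.neutral)
    finally show ?thesis .
  qed
  let ?r = "(a + b, (j1 + b) mod p, c + d)"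
  have "dualmult g (a, j1, c) (b, j2, d)
    = (\<Sum>r\<in>B. if r = ?r then (if (j1 + b + c) mod p = j2 then dualcoeff a c b d * g ?r else 0) else 0)"
    unfolding dualmult_def
  proof (rule sum.cong[OF refl])
    fix r assume r: "r \<in> B"
    obtain i j k where [simp]: "r = (i, j, k)" by (cases r)
    have "((j1 + b) mod p + c) mod p = (j1 + b + c) mod p" by (rule mod_add_left_eq)
    then show "g r * coord2 (Delta (pbw r)) (a, j1, c) (b, j2, d)
      = (if r = ?r then (if (j1 + b + c) mod p = j2 then dualcoeff a c b d * g ?r else 0) else 0)"
      using D[of i j k] r by auto
  qed
  then show ?thesis by (simp add: sum.delta)
qed


section \<open>The complex in coordinates\<close>

lemma alg_rep_entry:
  assumes L: "alg_rep d L" and w: "w \<in> carrier_mat d 1" and r: "r < d"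
  shows "(L (x + y) * w) $$ (r, 0) = (L x * w) $$ (r, 0) + (L y * w) $$ (r, 0)"
    and "(L (c \<cdot> x) * w) $$ (r, 0) = c * (L x * w) $$ (r, 0)"
  using r w carrier_matD[OF alg_rep_carrier[OF L]]
  by (simp_all add: alg_rep_add[OF L] alg_rep_smul[OF L] del: index_mult_mat(1)
      add: add_mult_distrib_mat[OF alg_rep_carrier[OF L] alg_rep_carrier[OF L] w]
        mult_smult_assoc_mat[OF alg_rep_carrier[OF L] w])

abbreviation RR :: hmod where "RR \<equiv> tensor_mod p q R R"

lemma RR_module: "RR \<in> modules p q"
  by (rule tensor_mod_modules[OF R_module R_module])

lemma coord_pbw_B: "u \<in> B \<Longrightarrow> s \<in> B \<Longrightarrow> coord (pbw u) s = (if u = s then 1 else 0)"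
  by (cases u) (auto simp: coord_pbw simp del: pbw.simps)

lemma kron_index_pair:
  assumes "M \<in> carrier_mat a 1" "N \<in> carrier_mat b 1" "i < a" "j < b"
  shows "kron M N $$ (i * b + j, 0) = M $$ (i, 0) * N $$ (j, 0)"
  using assms mult_add_less[of i a j b] carrier_matD[OF assms(1)] carrier_matD[OF assms(2)]
  by (simp add: kron_index)

text \<open>
  This lemma and the next one translate the two terms of the differential of a 2-cochain in which
  modules are merged, and the coassociativity of the coproduct, into statements about \<open>dualmult\<close>.
\<close>

lemma trep_RR_R_coord:
  assumes s: "s \<in> B" and t: "t \<in> B" and u: "u \<in> B"
  shows "(trep RR R y * kron e00 (bv o0)) $$ ((enc s * dimR + enc t) * dimR + enc u, 0)
    = dualmult (\<lambda>r. coord2 y r u) s t"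
proof -
  let ?row = "(enc s * dimR + enc t) * dimR + enc u"
  let ?f = "\<lambda>y. (trep RR R y * kron e00 (bv o0)) $$ (?row, 0)"
  have L: "alg_rep (dimR * dimR * dimR) (trep RR R)"
    using alg_rep_trep[OF RR_module R_module] by simp
  have w: "kron e00 (bv o0) \<in> carrier_mat (dimR * dimR * dimR) 1"
    using kron_carrier[OF e00_carrier bv_carrier, of o0] by simp
  have row: "?row < dimR * dimR * dimR"
    by (intro mult_add_less enc2_less enc_less s t u)
  have f: "?f (tens x x') = dualmult (coord x) s t * coord x' u" for x x'
  proof -
    have "trep RR R (tens x x') * kron e00 (bv o0) = kron (trep R R (Delta x) * e00) (LR x' * bv o0)"
      by (simp add: trep_tens[OF RR_module R_module] rep_tensor_mod[OF R_module R_module] rep_R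
          kron_mult[OF trep_RR_carrier LR_carrier e00_carrier bv_carrier])
    then show ?thesis
      using kron_index_pair[of "trep R R (Delta x) * e00" "dimR * dimR" "LR x' * bv o0" dimR
          "enc s * dimR + enc t" "enc u"]
        mult_carrier_mat[OF trep_RR_carrier e00_carrier] mult_carrier_mat[OF LR_carrier bv_carrier]
        enc2_less[OF s t] enc_less[OF u] coord2_Delta[OF s t]
      by (simp only: coord2_def[symmetric] coord_def[symmetric])
  qed
  have "?f y = ?f (pbw_sum2 (coord2 y))"
    using trep_cong[OF RR_module R_module expand2[of y]] by simp
  also have "\<dots> = (\<Sum>r\<in>B. \<Sum>v\<in>B. coord2 y r v * ?f (tens (pbw r) (pbw v)))"
    by (rule additive_pbw_sum2) (rule alg_rep_entry[OF L w row])+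
  also have "\<dots> = (\<Sum>r\<in>B. \<Sum>v\<in>B. if v = u then coord2 y r u * coord2 (Delta (pbw r)) s t else 0)"
    unfolding f using u by (intro sum.cong refl) (simp add: coord_pbw_B coord2_Delta[OF s t])
  also have "\<dots> = dualmult (\<lambda>r. coord2 y r u) s t"
    using u by (simp add: dualmult_def)
  finally show ?thesis .
qed

lemma trep_R_RR_coord:
  assumes s: "s \<in> B" and t: "t \<in> B" and u: "u \<in> B"
  shows "(trep R RR y * kron (bv o0) e00) $$ (enc s * (dimR * dimR) + (enc t * dimR + enc u), 0)
    = dualmult (\<lambda>r. coord2 y s r) t u"
proof -
  let ?row = "enc s * (dimR * dimR) + (enc t * dimR + enc u)"
  let ?f = "\<lambda>y. (trep R RR y * kron (bv o0) e00) $$ (?row, 0)"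
  have L: "alg_rep (dimR * (dimR * dimR)) (trep R RR)"
    using alg_rep_trep[OF R_module RR_module] by simp
  have w: "kron (bv o0) e00 \<in> carrier_mat (dimR * (dimR * dimR)) 1"
    using kron_carrier[OF bv_carrier e00_carrier, of o0] by simp
  have row: "?row < dimR * (dimR * dimR)"
    by (intro mult_add_less[of _ dimR _ "dimR * dimR"] enc2_less enc_less s t u)
  have f: "?f (tens x x') = coord x s * dualmult (coord x') t u" for x x'
  proof -
    have "trep R RR (tens x x') * kron (bv o0) e00 = kron (LR x * bv o0) (trep R R (Delta x') * e00)"
      by (simp add: trep_tens[OF R_module RR_module] rep_tensor_mod[OF R_module R_module] rep_R
          kron_mult[OF LR_carrier trep_RR_carrier bv_carrier e00_carrier])
    then show ?thesis
      using kron_index_pair[of "LR x * bv o0" dimR "trep R R (Delta x') * e00" "dimR * dimR"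
          "enc s" "enc t * dimR + enc u"]
        mult_carrier_mat[OF trep_RR_carrier e00_carrier] mult_carrier_mat[OF LR_carrier bv_carrier]
        enc2_less[OF t u] enc_less[OF s] coord2_Delta[OF t u]
      by (simp only: coord2_def[symmetric] coord_def[symmetric])
  qed
  have "?f y = ?f (pbw_sum2 (coord2 y))"
    using trep_cong[OF R_module RR_module expand2[of y]] by simp
  also have "\<dots> = (\<Sum>v\<in>B. \<Sum>r\<in>B. coord2 y v r * ?f (tens (pbw v) (pbw r)))"
    by (rule additive_pbw_sum2) (rule alg_rep_entry[OF L w row])+
  also have "\<dots> = (\<Sum>v\<in>B. if v = s then (\<Sum>r\<in>B. coord2 y s r * coord2 (Delta (pbw r)) t u) else 0)"
    unfolding f using s by (intro sum.cong refl) (auto simp: coord_pbw_B coord2_Delta[OF t u] intro!: sum.cong sum.neutral)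
  also have "\<dots> = dualmult (\<lambda>r. coord2 y s r) t u"
    using s by (simp add: dualmult_def)
  finally show ?thesis .
qed

lemma dualmult_cong: "(\<And>r. r \<in> B \<Longrightarrow> g r = h r) \<Longrightarrow> dualmult g s t = dualmult h s t"
  unfolding dualmult_def by (intro sum.cong) simp_all

lemma dualmult_add: "dualmult (\<lambda>r. g r + h r) s t = dualmult g s t + dualmult h s t"
  and dualmult_diff: "dualmult (\<lambda>r. g r - h r) s t = dualmult g s t - dualmult h s t"
  by (simp_all add: dualmult_def algebra_simps sum.distrib sum_subtractf)

lemma dualmult_zero: "(\<And>r. r \<in> B \<Longrightarrow> g r = 0) \<Longrightarrow> dualmult g s t = 0"
  unfolding dualmult_def by (intro sum.neutral) simp

lemma dualmult_if: "dualmult (\<lambda>r. if P then g r else 0) s t = (if P then dualmult g s t else 0)"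
  by (simp add: dualmult_def)

text \<open>
  The dual algebra is associative since the two bracketings of \<open>R \<otimes> R \<otimes> R\<close> are the same
  module; in terms of \<open>dualcoeff\<close> this is an identity between products of Gaussian binomials.
\<close>

lemma dualmult_assoc:
  assumes s: "s \<in> B" and t: "t \<in> B" and u: "u \<in> B"
  shows "dualmult (\<lambda>r. dualmult h r u) s t = dualmult (\<lambda>r. dualmult h s r) t u"
proof -
  have "dualmult (\<lambda>r. dualmult h r u) s t = dualmult (\<lambda>r. coord2 (Delta (pbw_sum h)) r u) s t"
    using u by (intro dualmult_cong) (simp add: coord2_Delta dualmult_def coord_pbw_sum)
  also have "\<dots> = (trep RR R (Delta (pbw_sum h)) * kron e00 (bv o0)) $$ ((enc s * dimR + enc t) * dimR + enc u, 0)"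
    by (rule trep_RR_R_coord[OF s t u, symmetric])
  also have "trep RR R (Delta (pbw_sum h)) = trep R RR (Delta (pbw_sum h))"
    using tensor_mod_assoc[OF R_module R_module R_module]
    by (simp add: rep_tensor_mod[OF RR_module R_module, symmetric]
        rep_tensor_mod[OF R_module RR_module, symmetric])
  also have "kron e00 (bv o0) = kron (bv o0) e00" by (rule kron_assoc)
  also have "(enc s * dimR + enc t) * dimR + enc u = enc s * (dimR * dimR) + (enc t * dimR + enc u)"
    by (simp add: algebra_simps)
  also have "(trep R RR (Delta (pbw_sum h)) * kron (bv o0) e00) $$ (\<dots>, 0)
      = dualmult (\<lambda>r. coord2 (Delta (pbw_sum h)) s r) t u"
    by (rule trep_R_RR_coord[OF s t u])
  also have "\<dots> = dualmult (\<lambda>r. dualmult h s r) t u"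
    using s by (intro dualmult_cong) (simp add: coord2_Delta dualmult_def coord_pbw_sum)
  finally show ?thesis .
qed

text \<open>
  The differentials of the Hochschild complex of the dual algebra with coefficients in the trivial
  bimodule, given by the counit, which is evaluation at \<open>o0\<close>.
\<close>

definition d1 :: "(expo \<Rightarrow> complex) \<Rightarrow> expo \<Rightarrow> expo \<Rightarrow> complex" where
  "d1 h s t = (if s = o0 then h t else 0) - dualmult h s t + (if t = o0 then h s else 0)"

definition d2 :: "(expo \<Rightarrow> expo \<Rightarrow> complex) \<Rightarrow>
    expo \<Rightarrow> expo \<Rightarrow> expo \<Rightarrow> complex" where
  "d2 c s t u = (if s = o0 then c t u else 0) - dualmult (\<lambda>r. c r u) s t
     + dualmult (\<lambda>r. c s r) t u - (if u = o0 then c s t else 0)"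

lemma dualcoeff_units [simp]:
  "dualcoeff 0 0 b d = 1" "dualcoeff a c 0 0 = 1" "dualcoeff a 0 0 d = 1"
  by (simp_all add: dualcoeff_def)

lemma dualmult_counit:
  assumes "s \<in> B" "t \<in> B"
  shows "dualmult (\<lambda>r. if r = o0 then x else 0) s t = (if s = o0 then if t = o0 then x else 0 else 0)"
proof -
  obtain a j1 c b j2 d where [simp]: "s = (a, j1, c)" "t = (b, j2, d)" by (cases s, cases t)
  show ?thesis
    using assms by (auto simp: dualmult_formula)
qed

lemma d2_d1: "s \<in> B \<Longrightarrow> t \<in> B \<Longrightarrow> u \<in> B \<Longrightarrow> d2 (d1 h) s t u = 0"
  unfolding d2_def d1_def dualmult_add dualmult_diff dualmult_if
  by (simp add: dualmult_counit dualmult_assoc)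

lemma d2_diff: "d2 (\<lambda>s t. c s t - c' s t) s t u = d2 c s t u - d2 c' s t u"
  by (simp add: d2_def dualmult_diff)

lemma dualmult_idem_left:
  assumes "j < p" "(b, j2, d) \<in> B"
  shows "dualmult g (0, j, 0) (b, j2, d) = (if (j + b) mod p = j2 then g (b, j2, d) else 0)"
  using assms by (auto simp: dualmult_formula)

lemma dualmult_idem_right:
  assumes "j < p" "(a, j1, c) \<in> B"
  shows "dualmult g (a, j1, c) (0, j, 0) = (if (j1 + c) mod p = j then g (a, j1, c) else 0)"
  using assms by (auto simp: dualmult_formula)

text \<open>
  The dual basis vectors with index \<open>(0, j, 0)\<close> are orthogonal idempotents with sum \<open>1\<close>. Any
  cocycle can be normalised to vanish on them: first in the left argument, by subtracting the
  coboundary of \<open>c o0\<close>, and then in the right argument.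
\<close>

lemma normalise_cocycle:
  assumes coc: "\<And>s t u. s \<in> B \<Longrightarrow> t \<in> B \<Longrightarrow> u \<in> B \<Longrightarrow> d2 c s t u = 0"
  defines "c1 \<equiv> \<lambda>s t. c s t - d1 (c o0) s t"
  defines "h2 \<equiv> \<lambda>s. c1 s o0"
  defines "c2 \<equiv> \<lambda>s t. c1 s t - d1 h2 s t"
  shows "\<And>s t u. s \<in> B \<Longrightarrow> t \<in> B \<Longrightarrow> u \<in> B \<Longrightarrow> d2 c2 s t u = 0"
    and "\<And>j t. j < p \<Longrightarrow> t \<in> B \<Longrightarrow> c2 (0, j, 0) t = 0"
    and "\<And>j t. j < p \<Longrightarrow> t \<in> B \<Longrightarrow> c2 t (0, j, 0) = 0"
proof -
  have oB: "o0 \<in> B" by simp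
  have coc1: "d2 c1 s t u = 0" if "s \<in> B" "t \<in> B" "u \<in> B" for s t u
    using coc[OF that] d2_d1[OF that] unfolding c1_def d2_diff by simp
  show coc2: "d2 c2 s t u = 0" if "s \<in> B" "t \<in> B" "u \<in> B" for s t u
    using coc1[OF that] d2_d1[OF that] unfolding c2_def d2_diff by simp
  have c1l: "c1 (0, j, 0) t = 0" if j: "j < p" and t: "t \<in> B" for j t
  proof -
    obtain b j2 d where t': "t = (b, j2, d)" by (cases t)
    have jB: "(0, j, 0) \<in> B" using j by simp
    show ?thesis
      using coc[OF oB jB t] j t
      unfolding c1_def d1_def d2_def t'
      by (auto simp: dualmult_idem_left eq_neg_iff_add_eq_0 split: if_splits)
  qed
  show c2l: "c2 (0, j, 0) t = 0" if j: "j < p" and t: "t \<in> B" for j t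
  proof -
    have jB: "(0, j, 0) \<in> B" using j by simp
    have "dualmult (\<lambda>r. c1 (0, j, 0) r) t o0 = 0" by (rule dualmult_zero) (rule c1l[OF j])
    then have "(if (0, j, 0) = o0 then c1 t o0 else 0) = dualmult h2 (0, j, 0) t"
      using coc1[OF jB t oB] c1l[OF j t] unfolding d2_def h2_def by simp
    then show ?thesis
      using c1l[OF j t] c1l[OF j oB] unfolding c2_def d1_def h2_def by simp
  qed
  show "c2 t (0, j, 0) = 0" if j: "j < p" and t: "t \<in> B" for j t
  proof -
    have jB: "(0, j, 0) \<in> B" using j by simp
    have "dualmult (\<lambda>r. c1 t r) (0, j, 0) o0 = (if j = 0 then c1 t o0 else 0)"
      using j by (auto simp: dualmult_idem_left)
    then have "c1 t (0, j, 0) = (if j = 0 then c1 t o0 else 0) - dualmult h2 t (0, j, 0)"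
      using coc1[OF t jB oB] c1l[OF j oB] unfolding d2_def h2_def by (auto split: if_splits)
    then show ?thesis
      using c1l[OF j oB] unfolding c2_def d1_def h2_def by auto
  qed
qed

text \<open>
  Conjugation by \<open>K\<close> only sees degrees modulo \<open>p\<close>. For a single monomial this amounts to degree
  zero, as both exponents are below \<open>p\<close>; for a pair of monomials the sums can differ by \<open>p\<close>.
\<close>

fun balanced2 :: "expo \<Rightarrow> expo \<Rightarrow> bool" where
  "balanced2 (a, j1, c) (b, j2, d) \<longleftrightarrow> (a + b) mod p = (c + d) mod p"

fun balanced :: "expo \<Rightarrow> bool" where
  "balanced (i, j, k) \<longleftrightarrow> i = k"

lemma d1_balanced:
  assumes h: "\<And>s. s \<in> B \<Longrightarrow> h s \<noteq> 0 \<Longrightarrow> balanced s"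
    and st: "s \<in> B" "t \<in> B" and nz: "d1 h s t \<noteq> 0"
  shows "balanced2 s t"
proof -
  have "s = o0 \<and> h t \<noteq> 0 \<or> t = o0 \<and> h s \<noteq> 0 \<or> dualmult h s t \<noteq> 0"
    by (rule ccontr) (use nz in \<open>auto simp: d1_def split: if_splits\<close>)
  then consider "s = o0" "h t \<noteq> 0" | "t = o0" "h s \<noteq> 0" | "dualmult h s t \<noteq> 0" by blast
  moreover obtain a j1 c b j2 d where [simp]: "s = (a, j1, c)" "t = (b, j2, d)" by (cases s, cases t)
  ultimately show ?thesis
  proof cases
    case 3
    then have "a + b < p" "c + d < p" "h (a + b, (j1 + b) mod p, c + d) \<noteq> 0"
      using st by (auto simp: dualmult_formula split: if_splits)
    then show ?thesis using h[of "(a + b, (j1 + b) mod p, c + d)"] by simp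
  qed (use h[of s] h[of t] st in auto)
qed

text \<open>
  The assumption \<open>wt\<close> expresses commutation with the coproduct of \<open>K\<close>. The idempotents force the
  ends of the two arguments to match and the total degree in \<open>E\<close> and \<open>F\<close> to be divisible by
  \<open>p\<close>; the weight condition then makes both partial degrees
  divisible by \<open>p\<close>, as \<open>p\<close> is odd. In bidegree \<open>(p, p)\<close> the cocycle identity moves the powers of
  \<open>E\<close> together, where their product vanishes.
\<close>

lemma reduced_support:
  assumes coc: "\<And>s t u. s \<in> B \<Longrightarrow> t \<in> B \<Longrightarrow> u \<in> B \<Longrightarrow> d2 c s t u = 0"
    and nl: "\<And>j t. j < p \<Longrightarrow> t \<in> B \<Longrightarrow> c (0, j, 0) t = 0"
    and nr: "\<And>j t. j < p \<Longrightarrow> t \<in> B \<Longrightarrow> c t (0, j, 0) = 0"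
    and wt: "\<And>s t. s \<in> B \<Longrightarrow> t \<in> B \<Longrightarrow> c s t \<noteq> 0 \<Longrightarrow> balanced2 s t"
    and s: "s \<in> B" and t: "t \<in> B" and nz: "c s t \<noteq> 0"
  shows "(\<exists>a b. 0 < a \<and> 0 < b \<and> a + b = p \<and> s = (a, a, 0) \<and> t = (b, 0, 0)) \<or>
    (\<exists>e d. 0 < e \<and> 0 < d \<and> e + d = p \<and> s = (0, 0, e) \<and> t = (0, e, d))"
proof -
  obtain a j1 e b j2 d where st: "s = (a, j1, e)" "t = (b, j2, d)" by (cases s, cases t)
  have B: "a < p" "j1 < p" "e < p" "b < p" "j2 < p" "d < p" using s t st by auto
  have oB: "o0 \<in> B" by simp
  \<comment> \<open>Comparing with the idempotent \<open>o0\<close>, on which the counit is \<open>1\<close>, put in front of \<open>s\<close>.\<close>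
  have left: "j1 = a"
  proof -
    have "dualmult (\<lambda>r. c o0 r) s t = 0" by (rule dualmult_zero) (rule nl, simp)
    then have "c s t = dualmult (\<lambda>r. c r t) o0 s"
      using coc[OF oB s t] nl[of 0 s] s unfolding d2_def by (simp split: if_splits)
    also have "\<dots> = (if a mod p = j1 then c s t else 0)"
      using s unfolding st by (simp add: dualmult_idem_left)
    finally show ?thesis using nz B by (auto split: if_splits)
  qed
  \<comment> \<open>The same idempotent put behind \<open>t\<close>.\<close>
  have right: "(j2 + d) mod p = 0"
  proof -
    have "dualmult (\<lambda>r. c r o0) s t = 0" by (rule dualmult_zero) (rule nr, simp)
    then have "c s t = dualmult (\<lambda>r. c s r) t o0"
      using coc[OF s t oB] nr[of 0 t] t unfolding d2_def by (simp split: if_splits)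
    also have "\<dots> = (if (j2 + d) mod p = 0 then c s t else 0)"
      using t unfolding st by (simp add: dualmult_idem_right)
    finally show ?thesis using nz by (auto split: if_splits)
  qed
  \<comment> \<open>The idempotent fixing \<open>s\<close> from the right, put between \<open>s\<close> and \<open>t\<close>.\<close>
  have mid: "j2 = (a + e + b) mod p"
  proof -
    let ?j = "(j1 + e) mod p"
    have j: "?j < p" and jB: "(0, ?j, 0) \<in> B" by simp_all
    have "dualmult (\<lambda>r. c r t) s (0, ?j, 0) = dualmult (\<lambda>r. c s r) (0, ?j, 0) t"
      using coc[OF s jB t] nl[OF j t] nr[OF j s] unfolding d2_def by (simp split: if_splits)
    moreover have "dualmult (\<lambda>r. c r t) s (0, ?j, 0) = c s t"
      using s unfolding st by (simp add: dualmult_idem_right)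
    moreover have "dualmult (\<lambda>r. c s r) (0, ?j, 0) t = (if (?j + b) mod p = j2 then c s t else 0)"
      using t unfolding st by (simp add: dualmult_idem_left)
    ultimately have "(?j + b) mod p = j2" using nz by (auto split: if_splits)
    then show ?thesis by (simp add: left mod_add_left_eq)
  qed
  have s0: "a > 0 \<or> e > 0" using nl[of j1 t] nz t B unfolding st by (cases "a = 0"; cases "e = 0") auto
  have t0: "b > 0 \<or> d > 0" using nr[of j2 s] nz s B unfolding st by (cases "b = 0"; cases "d = 0") auto
  have "(a + e + b + d) mod p = 0"
    using right unfolding mid by (simp add: mod_add_left_eq)
  moreover have "(a + b) mod p = (e + d) mod p" using wt[OF s t nz] unfolding st by simp
  ultimately have "p dvd 2 * (a + b)"
    by (metis (no_types, lifting) add.assoc add.commute dvd_eq_mod_eq_0 mod_add_right_eq mult_2)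
  then have dvd1: "p dvd a + b" by (simp only: p_dvd_double)
  then have dvd2: "p dvd e + d"
    using \<open>(a + b) mod p = (e + d) mod p\<close> by (simp add: dvd_eq_mod_eq_0)
  have cases: "x = 0 \<or> x = p" if "p dvd x" "x < 2 * p" for x
    using that by (auto elim!: dvdE simp: less_2_cases_iff)
  have ab: "a + b = 0 \<or> a + b = p" by (rule cases[OF dvd1]) (use B in simp)
  have ed: "e + d = 0 \<or> e + d = p" by (rule cases[OF dvd2]) (use B in simp)
  have "\<not> (a + b = p \<and> e + d = p)"
  proof
    assume pp: "a + b = p \<and> e + d = p"
    have x: "(a, j1, 0) \<in> B" "(0, j1, e) \<in> B" using B by auto
    have a0: "a > 0" "d > 0" using pp B by auto
    have "dualmult (\<lambda>r. c r t) (a, j1, 0) (0, j1, e) = c s t"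
      using x B unfolding st by (simp add: dualmult_formula)
    moreover have "dualmult (\<lambda>r. c (a, j1, 0) r) (0, j1, e) t = 0"
      using x t pp unfolding st by (simp add: dualmult_formula)
    ultimately have "c s t = 0"
      using coc[OF x t] a0 unfolding d2_def st by simp
    then show False using nz by simp
  qed
  with ab ed s0 t0 consider "a + b = p" "e = 0" "d = 0" | "a = 0" "b = 0" "e + d = p" by auto
  then show ?thesis
  proof cases
    case 1
    then show ?thesis using B left mid unfolding st by auto
  next
    case 2
    then show ?thesis using B left mid unfolding st by auto
  qed
qed


section \<open>Commutation with the coproduct\<close>

definition cobd :: "free_alg \<Rightarrow> free_alg2" where
  "cobd x = tens 1 x - Delta x + tens x 1"

lemma coord_one: "s \<in> B \<Longrightarrow> coord 1 s = (if s = o0 then 1 else 0)"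
  using coord_pbw[of s 0 0 0] by simp

lemma coord2_cobd: "s \<in> B \<Longrightarrow> t \<in> B \<Longrightarrow> coord2 (cobd x) s t = d1 (coord x) s t"
  by (simp add: cobd_def d1_def coord2_add coord2_diff coord2_tens coord2_Delta coord_one)

lemma cobd_commutator_E:
  assumes K: "x * gK \<approx> gK * x"
  shows "cobd x * Delta gE - Delta gE * cobd x \<approx>\<^sub>2
    tens 1 (x * gE - gE * x) + tens (x * gE - gE * x) gK - Delta (x * gE - gE * x)"
proof -
  have "cobd x * Delta gE - Delta gE * cobd x = tens 1 (x * gE - gE * x) + tens gE (x * gK - gK * x)
      + tens (x * gE - gE * x) gK - Delta (x * gE - gE * x)"
    by (simp add: cobd_def Delta_E Delta_mult Delta_diff distrib_left distrib_right left_diff_distrib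
        right_diff_distrib tens_mult tens_diff_left tens_diff_right)
  also have "\<dots> \<approx>\<^sub>2 tens 1 (x * gE - gE * x) + tens gE (x * gK - x * gK)
      + tens (x * gE - gE * x) gK - Delta (x * gE - gE * x)"
    by (intro I2.cadd I2.cdiff tens_cong I.cdiff I.csym[OF K]) simp_all
  finally show ?thesis by simp
qed

lemma cobd_commutator_F:
  assumes K: "x * Ki \<approx> Ki * x"
  shows "cobd x * Delta gF - Delta gF * cobd x \<approx>\<^sub>2
    tens (x * gF - gF * x) 1 + tens Ki (x * gF - gF * x) - Delta (x * gF - gF * x)"
proof -
  have "cobd x * Delta gF - Delta gF * cobd x = tens (x * gF - gF * x) 1 + tens (x * Ki - Ki * x) gF
      + tens Ki (x * gF - gF * x) - Delta (x * gF - gF * x)"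
    by (simp add: cobd_def Delta_F Delta_mult Delta_diff distrib_left distrib_right left_diff_distrib
        right_diff_distrib tens_mult tens_diff_left tens_diff_right)
  also have "\<dots> \<approx>\<^sub>2 tens (x * gF - gF * x) 1 + tens (x * Ki - x * Ki) gF
      + tens Ki (x * gF - gF * x) - Delta (x * gF - gF * x)"
    by (intro I2.cadd I2.cdiff tens_cong I.cdiff I.csym[OF K]) simp_all
  finally show ?thesis by simp
qed

text \<open>
  The contribution of the coefficient at \<open>s'\<close>, \<open>t'\<close> of a cochain to the coordinate at \<open>s\<close>, \<open>t\<close> of
  its commutator with the coproduct of \<open>E\<close>, respectively of \<open>F\<close>.
\<close>

definition commE :: "expo \<Rightarrow> expo \<Rightarrow> expo \<Rightarrow> expo \<Rightarrow> complex" where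
  "commE s' t' s t = coord (pbw s') s * coord (pbw t' * gE) t + coord (pbw s' * gE) s * coord (pbw t' * gK) t
     - coord (pbw s') s * coord (gE * pbw t') t - coord (gE * pbw s') s * coord (gK * pbw t') t"

definition commF :: "expo \<Rightarrow> expo \<Rightarrow> expo \<Rightarrow> expo \<Rightarrow> complex" where
  "commF s' t' s t = coord (pbw s' * gF) s * coord (pbw t') t + coord (pbw s' * Ki) s * coord (pbw t' * gF) t
     - coord (gF * pbw s') s * coord (pbw t') t - coord (Ki * pbw s') s * coord (gF * pbw t') t"

lemma coord2_pbw_sum2_comm:
  assumes st: "s \<in> B" "t \<in> B"
  shows "coord2 (pbw_sum2 c * z - z * pbw_sum2 c) s t
    = (\<Sum>s'\<in>B. \<Sum>t'\<in>B. c s' t' * coord2 (tens (pbw s') (pbw t') * z - z * tens (pbw s') (pbw t')) s t)"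
  by (rule additive_pbw_sum2)
     (simp_all add: coord2_add[OF st] coord2_diff[OF st] coord2_smul[OF st] algebra_simps)

lemma coord2_comm_E:
  assumes st: "s \<in> B" "t \<in> B"
  shows "coord2 (pbw_sum2 c * Delta gE - Delta gE * pbw_sum2 c) s t = (\<Sum>s'\<in>B. \<Sum>t'\<in>B. c s' t' * commE s' t' s t)"
  unfolding coord2_pbw_sum2_comm[OF st]
  by (intro sum.cong refl)
     (simp add: Delta_E distrib_left distrib_right tens_mult coord2_add[OF st] coord2_diff[OF st]
       coord2_tens[OF st] commE_def)

lemma coord2_comm_F:
  assumes st: "s \<in> B" "t \<in> B"
  shows "coord2 (pbw_sum2 c * Delta gF - Delta gF * pbw_sum2 c) s t = (\<Sum>s'\<in>B. \<Sum>t'\<in>B. c s' t' * commF s' t' s t)"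
  unfolding coord2_pbw_sum2_comm[OF st]
  by (intro sum.cong refl)
     (simp add: Delta_F distrib_left distrib_right tens_mult coord2_add[OF st] coord2_diff[OF st]
       coord2_tens[OF st] commF_def)

lemma Suc_mod_inj: "Suc j mod p = Suc j' mod p \<Longrightarrow> j < p \<Longrightarrow> j' < p \<Longrightarrow> j = j'"
  by (metis mod_Suc mod_less nat.inject nat.simps(3))

lemma coord_K_shift:
  assumes B: "(i, j, k) \<in> B" "(a, j', e) \<in> B"
  shows "coord (gK * pbw (i, j, k)) (a, Suc j' mod p, e) = (if (i, j, k) = (a, j', e) then Qi ^ a else 0)"
    and "coord (pbw (i, j, k) * gK) (a, Suc j' mod p, e) = (if (i, j, k) = (a, j', e) then Qi ^ e else 0)"
proof -
  have s: "(a, Suc j' mod p, e) \<in> B" using B by simp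
  have m: "Suc j' mod p = Suc j mod p \<longleftrightarrow> j' = j" using Suc_mod_inj[of j' j] B by auto
  have c: "coord (pbw (i, Suc j, k)) (a, Suc j' mod p, e) = (if i = a \<and> j = j' \<and> k = e then 1 else 0)"
    unfolding coord_pbw[OF s] prod.inject m using B by auto
  show "coord (gK * pbw (i, j, k)) (a, Suc j' mod p, e) = (if (i, j, k) = (a, j', e) then Qi ^ a else 0)"
    using coord_K_pbw(1)[OF s, of 1 i j k] c by (simp del: pbw.simps)
  show "coord (pbw (i, j, k) * gK) (a, Suc j' mod p, e) = (if (i, j, k) = (a, j', e) then Qi ^ e else 0)"
    using coord_K_pbw(2)[OF s, of i j k 1] c by (simp del: pbw.simps)
qed

text \<open>
  Left and right multiplication by \<open>K \<otimes> K\<close> shift the exponents of \<open>K\<close> in the same way; they only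
  differ by powers of \<open>q\<^sup>-\<^sup>2\<close>, whose exponents are the degrees in \<open>F\<close> and in \<open>E\<close>.
\<close>

lemma balanced2_of_commute_K:
  assumes K: "pbw_sum2 c * Delta gK \<approx>\<^sub>2 Delta gK * pbw_sum2 c"
    and s: "s \<in> B" and t: "t \<in> B" and nz: "c s t \<noteq> 0"
  shows "balanced2 s t"
proof -
  obtain a j1 e b j2 d where st: "s = (a, j1, e)" "t = (b, j2, d)" by (cases s, cases t)
  define s1 where "s1 = (a, Suc j1 mod p, e)"
  define t1 where "t1 = (b, Suc j2 mod p, d)"
  have st1: "s1 \<in> B" "t1 \<in> B" using s t by (auto simp: s1_def t1_def st)
  have Kb: "coord (gK * pbw u) s1 = (if u = s then Qi ^ a else 0)"
    "coord (gK * pbw u) t1 = (if u = t then Qi ^ b else 0)"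
    "coord (pbw u * gK) s1 = (if u = s then Qi ^ e else 0)"
    "coord (pbw u * gK) t1 = (if u = t then Qi ^ d else 0)" if "u \<in> B" for u
    using that s t coord_K_shift[of _ _ _ a j1 e] coord_K_shift[of _ _ _ b j2 d]
    unfolding s1_def t1_def st by (cases u; simp only:)+
  have "0 = coord2 (pbw_sum2 c * Delta gK - Delta gK * pbw_sum2 c) s1 t1"
    using coord2_cong[OF K] by (simp add: coord2_diff st1)
  also have "\<dots> = (\<Sum>s'\<in>B. \<Sum>t'\<in>B. if t' = t then if s' = s then c s t * (Qi ^ (e + d) - Qi ^ (a + b)) else 0 else 0)"
    unfolding coord2_pbw_sum2_comm[OF st1]
  proof (intro sum.cong refl)
    fix s' t' assume "s' \<in> B" "t' \<in> B"
    then show "c s' t' * coord2 (tens (pbw s') (pbw t') * Delta gK - Delta gK * tens (pbw s') (pbw t')) s1 t1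
      = (if t' = t then if s' = s then c s t * (Qi ^ (e + d) - Qi ^ (a + b)) else 0 else 0)"
      by (simp add: Delta_K tens_mult coord2_diff[OF st1] coord2_tens[OF st1] Kb power_add)
  qed
  also have "\<dots> = c s t * (Qi ^ (e + d) - Qi ^ (a + b))" using s t by simp
  finally have "Qi ^ (a + b) = Qi ^ (e + d)" using nz by simp
  then show ?thesis by (simp add: st Qi_power_eq_iff)
qed

lemma commute_pbw_sum:
  assumes bal: "\<And>s. s \<in> B \<Longrightarrow> a s \<noteq> 0 \<Longrightarrow> balanced s"
  shows "pbw_sum a * gK ^ m \<approx> gK ^ m * pbw_sum a"
proof -
  have "a s \<cdot> (pbw s * gK ^ m) \<approx> a s \<cdot> (gK ^ m * pbw s)" if sB: "s \<in> B" for s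
  proof (cases "a s = 0")
    case False
    then obtain i j where s: "s = (i, j, i)" using bal[OF sB False] by (cases s) auto
    have "pbw s * gK ^ m \<approx> Qi ^ (m * i) \<cdot> pbw (i, j + m, i)" unfolding s by (rule I.pbw_K)
    also have "\<dots> = Qi ^ (m * i) \<cdot> pbw (i, m + j, i)" by (simp add: add.commute)
    also have "\<dots> \<approx> gK ^ m * pbw s" unfolding s by (rule I.csym[OF I.K_pbw])
    finally show ?thesis by (rule I.csmul)
  qed simp
  then show ?thesis unfolding pbw_sum_def sum_distrib_left sum_distrib_right smul_mult_left smul_mult_right
    by (intro I.csum)
qed

lemma coord_pbw_sum_comm:
  assumes "s \<in> B"
  shows "coord (pbw_sum a * z - z * pbw_sum a) s = (\<Sum>r\<in>B. a r * (coord (pbw r * z) s - coord (z * pbw r) s))"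
proof -
  have "coord (pbw_sum a * z - z * pbw_sum a) s = (\<Sum>r\<in>B. a r * coord (pbw r * z - z * pbw r) s)"
    by (rule additive_pbw_sum[of "\<lambda>x. coord (x * z - z * x) s"])
       (simp_all add: coord_add[OF assms] coord_diff[OF assms] coord_smul[OF assms] algebra_simps)
  then show ?thesis by (simp add: coord_diff[OF assms])
qed

lemma coord_pbw_E: "s \<in> B \<Longrightarrow> coord (pbw (i, j, k) * gE) s = coord (pbw (i, j, Suc k)) s"
  by (simp only: I.pbw_E)

lemma coord_F_pbw: "s \<in> B \<Longrightarrow> coord (gF * pbw (i, j, k)) s = coord (pbw (Suc i, j, k)) s"
  by (simp only: I.F_pbw)

lemma comm_E_support:
  assumes bal: "\<And>s. s \<in> B \<Longrightarrow> a s \<noteq> 0 \<Longrightarrow> balanced s"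
    and s: "(i, j, k) \<in> B" and k: "k \<noteq> Suc i"
  shows "coord (pbw_sum a * gE - gE * pbw_sum a) (i, j, k) = 0"
  unfolding coord_pbw_sum_comm[OF s]
proof (rule sum.neutral, rule ballI)
  fix r assume r: "r \<in> B"
  show "a r * (coord (pbw r * gE) (i, j, k) - coord (gE * pbw r) (i, j, k)) = 0"
  proof (cases "a r = 0")
    case False
    then obtain i' j' where [simp]: "r = (i', j', i')" using bal[OF r False] by (cases r) auto
    show ?thesis
      using s k
      by (cases i') (auto simp: coord_pbw_E coord_E_pbw coord_pbw simp del: pbw.simps)
  qed simp
qed

lemma comm_F_support:
  assumes bal: "\<And>s. s \<in> B \<Longrightarrow> a s \<noteq> 0 \<Longrightarrow> balanced s"
    and s: "(i, j, k) \<in> B" and k: "i \<noteq> Suc k"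
  shows "coord (pbw_sum a * gF - gF * pbw_sum a) (i, j, k) = 0"
  unfolding coord_pbw_sum_comm[OF s]
proof (rule sum.neutral, rule ballI)
  fix r assume r: "r \<in> B"
  show "a r * (coord (pbw r * gF) (i, j, k) - coord (gF * pbw r) (i, j, k)) = 0"
  proof (cases "a r = 0")
    case False
    then obtain i' j' where [simp]: "r = (i', j', i')" using bal[OF r False] by (cases r) auto
    show ?thesis
      using s k
      by (cases i') (auto simp: coord_F_pbw coord_pbw_F coord_pbw simp del: pbw.simps)
  qed simp
qed


section \<open>Every invariant cocycle is the coboundary of a central element\<close>

lemma coord_pbw_K: "s \<in> B \<Longrightarrow> coord (pbw (i, j, k) * gK) s = Qi ^ k * coord (pbw (i, Suc j, k)) s"
  and coord_K_pbw1: "s \<in> B \<Longrightarrow> coord (gK * pbw (i, j, k)) s = Qi ^ i * coord (pbw (i, Suc j, k)) s"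
  using coord_K_pbw(2)[of s i j k 1] coord_K_pbw(1)[of s 1 i j k] by (simp_all del: pbw.simps)

lemma coord_pbw_Ki:
  "s \<in> B \<Longrightarrow> coord (pbw (i, j, k) * Ki) s = Qi ^ ((p - 1) * k) * coord (pbw (i, j + (p - 1), k)) s"
  unfolding Kinv_def by (rule coord_K_pbw)

lemma succ_ne_pred_mod: "(Suc 0) mod p \<noteq> (p - 1) mod p" "(j + (p - 1)) mod p \<noteq> Suc j mod p"
proof -
  show "(Suc 0) mod p \<noteq> (p - 1) mod p" using p_ge by simp
  show "(j + (p - 1)) mod p \<noteq> Suc j mod p"
  proof
    assume "(j + (p - 1)) mod p = Suc j mod p"
    moreover have "j + (p - 1) = Suc j + (p - 2)" using p_ge by simp
    ultimately have "p dvd p - 2"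
      by (metis diff_add_inverse le_add1 mod_eq_dvd_iff_nat)
    then show False using p_ge by (auto dest: dvd_imp_le)
  qed
qed

text \<open>
  The pairs of monomials of the form \<open>F ^ a * K ^ a \<otimes> F ^ (p - a)\<close> and
  \<open>E ^ e \<otimes> K ^ e * E ^ (p - e)\<close>. Combinations of them represent the classes of bidegree
  \<open>(p, 0)\<close> and \<open>(0, p)\<close>; formally these are the coboundaries of \<open>F ^ p / [p]!\<close> and
  \<open>E ^ p / [p]!\<close>.
\<close>

definition typeF :: "expo \<Rightarrow> expo \<Rightarrow> bool" where
  "typeF s t \<longleftrightarrow> (\<exists>a b. 0 < a \<and> 0 < b \<and> a + b = p \<and> s = (a, a, 0) \<and> t = (b, 0, 0))"

definition typeE :: "expo \<Rightarrow> expo \<Rightarrow> bool" where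
  "typeE s t \<longleftrightarrow> (\<exists>e d. 0 < e \<and> 0 < d \<and> e + d = p \<and> s = (0, 0, e) \<and> t = (0, e, d))"

context
  fixes a c2
  assumes bal: "\<And>s. s \<in> B \<Longrightarrow> a s \<noteq> 0 \<Longrightarrow> balanced s"
    and supp: "\<And>s t. s \<in> B \<Longrightarrow> t \<in> B \<Longrightarrow> c2 s t \<noteq> 0 \<Longrightarrow> typeF s t \<or> typeE s t"
    and commE0: "(cobd (pbw_sum a) + pbw_sum2 c2) * Delta gE \<approx>\<^sub>2 Delta gE * (cobd (pbw_sum a) + pbw_sum2 c2)"
    and commF0: "(cobd (pbw_sum a) + pbw_sum2 c2) * Delta gF \<approx>\<^sub>2 Delta gF * (cobd (pbw_sum a) + pbw_sum2 c2)"
begin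

definition xE :: free_alg where "xE = pbw_sum a * gE - gE * pbw_sum a"
definition yF :: free_alg where "yF = pbw_sum a * gF - gF * pbw_sum a"

lemma commute_K: "pbw_sum a * gK \<approx> gK * pbw_sum a"
  using commute_pbw_sum[OF bal, where m = 1] by simp

lemma commute_Ki: "pbw_sum a * Ki \<approx> Ki * pbw_sum a"
  unfolding Kinv_def by (rule commute_pbw_sum[OF bal])

lemma comm_sum_E:
  assumes st: "s \<in> B" "t \<in> B"
  shows "(\<Sum>s'\<in>B. \<Sum>t'\<in>B. c2 s' t' * commE s' t' s t) + ((if s = o0 then coord xE t else 0)
    + (if t = (0, 1, 0) then coord xE s else 0) - dualmult (coord xE) s t) = 0"
proof -
  have K: "coord gK t = (if t = (0, 1, 0) then 1 else 0)"
    using coord_pbw[OF st(2), of 0 1 0] p_ge by simp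
  have "(cobd (pbw_sum a) + pbw_sum2 c2) * Delta gE - Delta gE * (cobd (pbw_sum a) + pbw_sum2 c2)
    = (pbw_sum2 c2 * Delta gE - Delta gE * pbw_sum2 c2) + (cobd (pbw_sum a) * Delta gE - Delta gE * cobd (pbw_sum a))"
    by (simp add: algebra_simps)
  also have "\<dots> \<approx>\<^sub>2 (pbw_sum2 c2 * Delta gE - Delta gE * pbw_sum2 c2) + (tens 1 xE + tens xE gK - Delta xE)"
    unfolding xE_def by (intro I2.cadd cobd_commutator_E commute_K) simp
  finally have "coord2 ((cobd (pbw_sum a) + pbw_sum2 c2) * Delta gE - Delta gE * (cobd (pbw_sum a) + pbw_sum2 c2)) s t
    = coord2 ((pbw_sum2 c2 * Delta gE - Delta gE * pbw_sum2 c2) + (tens 1 xE + tens xE gK - Delta xE)) s t"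
    by (rule coord2_cong)
  moreover have "coord2 ((cobd (pbw_sum a) + pbw_sum2 c2) * Delta gE - Delta gE * (cobd (pbw_sum a) + pbw_sum2 c2)) s t = 0"
    using coord2_cong[OF commE0] by (simp add: coord2_diff[OF st])
  ultimately have "coord2 (pbw_sum2 c2 * Delta gE - Delta gE * pbw_sum2 c2) s t
      + coord2 (tens 1 xE + tens xE gK - Delta xE) s t = 0"
    using coord2_add[OF st] by metis
  moreover have "coord2 (tens 1 xE + tens xE gK - Delta xE) s t = (if s = o0 then coord xE t else 0)
      + (if t = (0, 1, 0) then coord xE s else 0) - dualmult (coord xE) s t"
    unfolding coord2_add[OF st] coord2_diff[OF st] coord2_tens[OF st] coord2_Delta[OF st]
      coord_one[OF st(1)] K
    by (cases "s = o0"; cases "t = (0, 1, 0)"; simp)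
  ultimately show ?thesis
    unfolding coord2_comm_E[OF st] by (simp only:)
qed

lemma comm_sum_F:
  assumes st: "s \<in> B" "t \<in> B"
  shows "(\<Sum>s'\<in>B. \<Sum>t'\<in>B. c2 s' t' * commF s' t' s t) + ((if t = o0 then coord yF s else 0)
    + (if s = (0, p - 1, 0) then coord yF t else 0) - dualmult (coord yF) s t) = 0"
proof -
  have K: "coord Ki s = (if s = (0, p - 1, 0) then 1 else 0)"
    using coord_pbw[OF st(1), of 0 "p - 1" 0] p_ge by (simp add: Kinv_def)
  have "(cobd (pbw_sum a) + pbw_sum2 c2) * Delta gF - Delta gF * (cobd (pbw_sum a) + pbw_sum2 c2)
    = (pbw_sum2 c2 * Delta gF - Delta gF * pbw_sum2 c2) + (cobd (pbw_sum a) * Delta gF - Delta gF * cobd (pbw_sum a))"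
    by (simp add: algebra_simps)
  also have "\<dots> \<approx>\<^sub>2 (pbw_sum2 c2 * Delta gF - Delta gF * pbw_sum2 c2) + (tens yF 1 + tens Ki yF - Delta yF)"
    unfolding yF_def by (intro I2.cadd cobd_commutator_F commute_Ki) simp
  finally have "coord2 ((cobd (pbw_sum a) + pbw_sum2 c2) * Delta gF - Delta gF * (cobd (pbw_sum a) + pbw_sum2 c2)) s t
    = coord2 ((pbw_sum2 c2 * Delta gF - Delta gF * pbw_sum2 c2) + (tens yF 1 + tens Ki yF - Delta yF)) s t"
    by (rule coord2_cong)
  moreover have "coord2 ((cobd (pbw_sum a) + pbw_sum2 c2) * Delta gF - Delta gF * (cobd (pbw_sum a) + pbw_sum2 c2)) s t = 0"
    using coord2_cong[OF commF0] by (simp add: coord2_diff[OF st])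
  ultimately have "coord2 (pbw_sum2 c2 * Delta gF - Delta gF * pbw_sum2 c2) s t
      + coord2 (tens yF 1 + tens Ki yF - Delta yF) s t = 0"
    using coord2_add[OF st] by metis
  moreover have "coord2 (tens yF 1 + tens Ki yF - Delta yF) s t = (if t = o0 then coord yF s else 0)
      + (if s = (0, p - 1, 0) then coord yF t else 0) - dualmult (coord yF) s t"
    unfolding coord2_add[OF st] coord2_diff[OF st] coord2_tens[OF st] coord2_Delta[OF st]
      coord_one[OF st(2)] K
    by (cases "t = o0"; cases "s = (0, p - 1, 0)"; simp)
  ultimately show ?thesis
    unfolding coord2_comm_F[OF st] by (simp only:)
qed

lemma xE_support: "(i, j, k) \<in> B \<Longrightarrow> k \<noteq> Suc i \<Longrightarrow> coord xE (i, j, k) = 0"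
  unfolding xE_def by (rule comm_E_support[OF bal])

lemma yF_support: "(i, j, k) \<in> B \<Longrightarrow> i \<noteq> Suc k \<Longrightarrow> coord yF (i, j, k) = 0"
  unfolding yF_def by (rule comm_F_support[OF bal])

lemma sum_single_pair:
  assumes "s0 \<in> B" "t0 \<in> B"
    and "\<And>s' t'. s' \<in> B \<Longrightarrow> t' \<in> B \<Longrightarrow> (s', t') \<noteq> (s0, t0) \<Longrightarrow> f s' t' = (0::complex)"
  shows "(\<Sum>s'\<in>B. \<Sum>t'\<in>B. f s' t') = f s0 t0"
proof -
  have "(\<Sum>s'\<in>B. \<Sum>t'\<in>B. f s' t') = (\<Sum>s'\<in>B. \<Sum>t'\<in>B. if t' = t0 then if s' = s0 then f s0 t0 else 0 else 0)"
    using assms(3) by (intro sum.cong refl) auto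
  also have "\<dots> = f s0 t0" using assms(1,2) by simp
  finally show ?thesis .
qed

text \<open>
  In the commutator with the coproduct of \<open>E\<close>, the coefficient at
  \<open>F ^ e * K ^ e \<otimes> F ^ (b - 1) * K\<close> involves only the coefficients of \<open>c2\<close> at the two
  neighbouring places \<open>b\<close> and \<open>b - 1\<close>, and the one at \<open>b\<close> with the non-zero factor
  \<open>Sm b\<close>.
\<close>

lemma typeF_vanishes:
  assumes "0 < b" "e + b = p" "0 < e"
  shows "c2 (e, e, 0) (b, 0, 0) = 0"
  using assms
proof (induction b arbitrary: e)
  case (Suc b)
  define s where "s = (e, e, 0::nat)"
  define t where "t = (b, Suc 0, 0::nat)"
  define t0 where "t0 = (Suc b, 0::nat, 0::nat)"
  have B: "s \<in> B" "t \<in> B" "t0 \<in> B" using Suc.prems p_ge by (auto simp: s_def t_def t0_def)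
  have eb: "e < p" "Suc b < p" "0 < e" using Suc.prems by auto
  have other: "c2 s' t' * commE s' t' s t = 0" if st': "s' \<in> B" "t' \<in> B" "(s', t') \<noteq> (s, t0)" for s' t'
  proof (cases "c2 s' t' = 0")
    case False
    from supp[OF st'(1,2) False] show ?thesis
    proof
      assume "typeF s' t'"
      then obtain e' b' where ty: "0 < e'" "0 < b'" "e' + b' = p" "s' = (e', e', 0)" "t' = (b', 0, 0)"
        by (auto simp: typeF_def)
      have ne: "e' \<noteq> e" using st'(3) ty Suc.prems by (auto simp: s_def t0_def)
      have ne': "e' \<noteq> Suc e"
      proof
        assume e': "e' = Suc e"
        then have b': "b' = b" using ty Suc.prems by simp
        then have "c2 s' t' = 0" using Suc.IH[of e'] ty by simp
        then show False using False by simp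
      qed
      have "e' - 1 \<noteq> e" using ne' ty(1) by simp
      then have "commE s' t' s t = 0"
        using B ne ne' ty(1,2) eb unfolding commE_def ty(4,5)
        by (simp add: coord_pbw_E coord_E_pbw coord_pbw_K coord_K_pbw1 coord_pbw s_def t_def
            del: pbw.simps One_nat_def)
      then show ?thesis by simp
    next
      assume "typeE s' t'"
      then obtain e' d' where ty: "0 < e'" "0 < d'" "e' + d' = p" "s' = (0, 0, e')" "t' = (0, e', d')"
        by (auto simp: typeE_def)
      have "commE s' t' s t = 0"
        using B ty(1,2) eb unfolding commE_def ty(4,5)
        by (simp add: coord_pbw_E coord_E_pbw coord_pbw_K coord_K_pbw1 coord_pbw s_def t_def
            del: pbw.simps One_nat_def)
      then show ?thesis by simp
    qed
  qed simp
  have p1: "(p - 1) mod p \<noteq> Suc 0" using succ_ne_pred_mod(1) p_ge by simp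
  have "commE s t0 s t = - (c0 * Sm (Suc b))"
    using B eb p1 unfolding commE_def s_def t0_def t_def
    by (simp add: coord_pbw_E coord_E_pbw coord_pbw_K coord_K_pbw1 coord_pbw
        del: pbw.simps)
  moreover have "(\<Sum>s'\<in>B. \<Sum>t'\<in>B. c2 s' t' * commE s' t' s t) = c2 s t0 * commE s t0 s t"
    by (rule sum_single_pair[OF B(1,3) other])
  moreover have "(if s = o0 then coord xE t else 0) + (if t = (0, 1, 0) then coord xE s else 0)
      - dualmult (coord xE) s t = 0"
  proof -
    have "coord xE s = 0" unfolding s_def by (rule xE_support) (use eb in auto)
    moreover have "dualmult (coord xE) s t = 0"
      using B unfolding s_def t_def by (auto simp: dualmult_formula intro!: xE_support)
    ultimately show ?thesis using eb by (simp add: s_def)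
  qed
  ultimately have "c2 s t0 * (c0 * Sm (Suc b)) = 0"
    using comm_sum_E[OF B(1,2)] by simp
  then show ?case using Sm_nz[of "Suc b"] c0_nz eb by (simp add: s_def t0_def)
qed simp

lemma supp_E: "s \<in> B \<Longrightarrow> t \<in> B \<Longrightarrow> c2 s t \<noteq> 0 \<Longrightarrow> typeE s t"
  using supp typeF_vanishes unfolding typeF_def by blast

text \<open>
  In the commutator with the coproduct of \<open>F\<close>, the coefficient at
  \<open>K\<^sup>-\<^sup>1 * E ^ e \<otimes> K ^ (e + 1) * E ^ (d - 1)\<close> again involves only the coefficients of \<open>c2\<close> at
  \<open>d\<close> and \<open>d - 1\<close>, and the one at \<open>d\<close> with a non-zero factor.
\<close>

lemma typeE_vanishes:
  assumes "0 < d" "e + d = p" "0 < e"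
  shows "c2 (0, 0, e) (0, e, d) = 0"
  using assms
proof (induction d arbitrary: e)
  case (Suc d)
  define s where "s = (0::nat, p - 1, e)"
  define t where "t = (0::nat, Suc e mod p, d)"
  define s0 where "s0 = (0::nat, 0::nat, e)"
  define t0 where "t0 = (0::nat, e, Suc d)"
  have B: "s \<in> B" "t \<in> B" "s0 \<in> B" "t0 \<in> B"
    using Suc.prems p_ge by (auto simp: s_def t_def s0_def t0_def)
  have ed: "e < p" "Suc d < p" "0 < e" using Suc.prems by auto
  have p1: "Suc 0 mod p \<noteq> p - 1" "(p - 1) mod p = p - 1" using p_ge by auto
  have p2: "(j + (p - 1)) mod p \<noteq> Suc j mod p" "Suc j mod p \<noteq> (j + (p - 1)) mod p" for j
    using succ_ne_pred_mod(2)[of j] by auto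
  have other: "c2 s' t' * commF s' t' s t = 0" if st': "s' \<in> B" "t' \<in> B" "(s', t') \<noteq> (s0, t0)" for s' t'
  proof (cases "c2 s' t' = 0")
    case False
    then obtain e' d' where ty: "0 < e'" "0 < d'" "e' + d' = p" "s' = (0, 0, e')" "t' = (0, e', d')"
      using supp_E[OF st'(1,2)] by (auto simp: typeE_def)
    have ne: "e' \<noteq> e" using st'(3) ty Suc.prems by (auto simp: s0_def t0_def)
    have ne': "e' \<noteq> Suc e"
    proof
      assume e': "e' = Suc e"
      then have d': "d' = d" using ty Suc.prems by simp
      then have "c2 s' t' = 0" using Suc.IH[of e'] ty by simp
      then show False using False by simp
    qed
    have "e' - 1 \<noteq> e" using ne' ty(1) by simp
    then have "coord (pbw s' * gF) s = 0" "coord (pbw s' * Ki) s = 0" "coord (gF * pbw s') s = 0" "coord (gF * pbw t') t = 0"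
      using B ne ne' ty(1,2) ed p1 unfolding ty(4,5)
      by (simp_all add: coord_pbw_F coord_F_pbw coord_pbw_Ki coord_pbw s_def t_def del: pbw.simps One_nat_def)
    then show ?thesis by (simp add: commF_def)
  qed simp
  have "e - 1 \<noteq> e" using ed by simp
  then have "coord (pbw s0 * gF) s = 0" "coord (gF * pbw s0) s = 0" "coord (gF * pbw t0) t = 0"
    "coord (pbw s0 * Ki) s = Qi ^ ((p - 1) * e)" "coord (pbw t0 * gF) t = c0 * Sm (Suc d)"
    using B ed p1 p2 unfolding s0_def t0_def
    by (simp_all add: coord_pbw_F coord_F_pbw coord_pbw_Ki coord_pbw s_def t_def del: pbw.simps One_nat_def)
  then have "commF s0 t0 s t = Qi ^ ((p - 1) * e) * (c0 * Sm (Suc d))"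
    by (simp add: commF_def)
  moreover have "(\<Sum>s'\<in>B. \<Sum>t'\<in>B. c2 s' t' * commF s' t' s t) = c2 s0 t0 * commF s0 t0 s t"
    by (rule sum_single_pair[OF B(3,4) other])
  moreover have "(if t = o0 then coord yF s else 0) + (if s = (0, p - 1, 0) then coord yF t else 0)
      - dualmult (coord yF) s t = 0"
  proof -
    have "coord yF s = 0" unfolding s_def by (rule yF_support) (use ed in auto)
    moreover have "dualmult (coord yF) s t = 0"
      using B unfolding s_def t_def by (auto simp: dualmult_formula intro!: yF_support)
    ultimately show ?thesis using ed by (simp add: s_def)
  qed
  ultimately have "c2 s0 t0 * (Qi ^ ((p - 1) * e) * (c0 * Sm (Suc d))) = 0"
    using comm_sum_F[OF B(1,2)] by simp
  then show ?case using Sm_nz[of "Suc d"] c0_nz ed q_nz by (simp add: s0_def t0_def)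
qed simp

lemma c2_zero: "s \<in> B \<Longrightarrow> t \<in> B \<Longrightarrow> c2 s t = 0"
  using supp_E typeE_vanishes unfolding typeE_def by blast

text \<open>
  The element \<open>xE\<close> is skew-primitive of degree one. If \<open>i > 0\<close> then its coordinate at \<open>(i, j, i + 1)\<close>
  is its value at the product of the dual vectors of \<open>F ^ i * K ^ j\<close> and \<open>K ^ j * E ^ (i + 1)\<close>, and
  vanishes. The product of an idempotent \<open>j \<noteq> 0\<close> and the dual vector of \<open>K ^ j * E\<close> excludes the
  remaining coordinates other than that of \<open>E\<close>.
\<close>

lemma xE_eq: "\<exists>l. xE \<approx> l \<cdot> gE"
proof -
  have eq: "(if s = o0 then coord xE t else 0) + (if t = (0, 1, 0) then coord xE s else 0)
      = dualmult (coord xE) s t" if "s \<in> B" "t \<in> B" for s t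
    using comm_sum_E[OF that] by (simp add: c2_zero)
  have "coord xE s = coord (coord xE (0, 0, 1) \<cdot> gE) s" if s: "s \<in> B" for s
  proof -
    obtain i j k where st: "s = (i, j, k)" by (cases s)
    have gE: "coord gE s = (if s = (0, 0, 1) then 1 else 0)"
      using coord_pbw[OF s, of 0 0 1] p_ge by simp
    have "coord xE s = 0" if ne: "s \<noteq> (0, 0, 1)"
    proof (cases "k = Suc i")
      case True
      then show ?thesis
        using eq[of "(i, j, 0)" "(0, j, k)"] s ne by (auto simp: st dualmult_formula)
    next
      case False
      then show ?thesis using xE_support[of i j k] s by (simp add: st)
    qed
    then show ?thesis unfolding coord_smul[OF s] gE by auto
  qed
  then have "xE \<approx> coord xE (0, 0, 1) \<cdot> gE" by (rule coord_eqI)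
  then show ?thesis ..
qed

lemma yF_eq: "\<exists>m. yF \<approx> m \<cdot> gF"
proof -
  have eq: "(if t = o0 then coord yF s else 0) + (if s = (0, p - 1, 0) then coord yF t else 0)
      = dualmult (coord yF) s t" if "s \<in> B" "t \<in> B" for s t
    using comm_sum_F[OF that] by (simp add: c2_zero)
  have "coord yF s = coord (coord yF (1, 0, 0) \<cdot> gF) s" if s: "s \<in> B" for s
  proof -
    obtain i j k where st: "s = (i, j, k)" by (cases s)
    have gF: "coord gF s = (if s = (1, 0, 0) then 1 else 0)"
      using coord_pbw[OF s, of 1 0 0] p_ge by simp
    have "coord yF s = 0" if ne: "s \<noteq> (1, 0, 0)"
    proof (cases "i = Suc k")
      case True
      then show ?thesis
        using eq[of "(i, j, 0)" "(0, j, k)"] s ne by (auto simp: st dualmult_formula split: if_splits)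
    next
      case False
      then show ?thesis using yF_support[of i j k] s by (simp add: st)
    qed
    then show ?thesis unfolding coord_smul[OF s] gF by auto
  qed
  then have "yF \<approx> coord yF (1, 0, 0) \<cdot> gF" by (rule coord_eqI)
  then show ?thesis ..
qed

end


text \<open>The Harish-Chandra projection of \<open>pbw_sum a\<close>, evaluated at \<open>K = z\<close>.\<close>

definition hwfun :: "(expo \<Rightarrow> complex) \<Rightarrow> complex \<Rightarrow> complex" where
  "hwfun a z = (\<Sum>(i, j, k)\<in>B. if i = 0 \<and> k = 0 then a (i, j, k) * z ^ j else 0)"

lemma K_power_eigen:
  assumes "gK * v \<approx> z \<cdot> v" shows "gK ^ j * v \<approx> z ^ j \<cdot> v"
proof (induction j)
  case (Suc j)
  have "gK ^ Suc j * v = gK * (gK ^ j * v)" by (simp add: mult.assoc)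
  also have "\<dots> \<approx> gK * (z ^ j \<cdot> v)" by (rule I.cmult_l[OF Suc])
  also have "\<dots> = z ^ j \<cdot> (gK * v)" by simp
  also have "\<dots> \<approx> z ^ j \<cdot> (z \<cdot> v)" by (rule I.csmul[OF assms])
  finally show ?case by (simp add: mult.commute)
qed simp

text \<open>Every monomial of degree zero other than a power of \<open>K\<close> ends in a power of \<open>E\<close>, which kills \<open>v\<close>.\<close>

lemma act_on_highest_weight:
  assumes bal: "\<And>s. s \<in> B \<Longrightarrow> a s \<noteq> 0 \<Longrightarrow> balanced s"
    and K: "gK * v \<approx> z \<cdot> v" and E: "gE * v \<approx> 0"
  shows "pbw_sum a * v \<approx> hwfun a z \<cdot> v"
proof -
  note Kj = K_power_eigen[OF K]
  have Ek: "gE ^ Suc k * v \<approx> 0" for k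
  proof -
    have "gE ^ Suc k * v = gE ^ k * (gE * v)" by (simp only: power_Suc2 mult.assoc)
    also have "\<dots> \<approx> gE ^ k * 0" by (rule I.cmult_l[OF E])
    finally show ?thesis by simp
  qed
  have "a s \<cdot> (pbw s * v) \<approx> (case s of (i, j, k) \<Rightarrow> if i = 0 \<and> k = 0 then a (i, j, k) * z ^ j else 0) \<cdot> v"
    if s: "s \<in> B" for s
  proof (cases "a s = 0")
    case False
    then obtain i j where st: "s = (i, j, i)" using bal[OF s False] by (cases s) auto
    show ?thesis
    proof (cases i)
      case 0
      then show ?thesis using I.csmul[OF Kj[of j], of "a s"] by (simp add: st)
    next
      case (Suc k)
      have "pbw s * v = gF ^ i * gK ^ j * (gE ^ Suc k * v)" by (simp add: st Suc mult.assoc)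
      also have "\<dots> \<approx> gF ^ i * gK ^ j * 0" by (rule I.cmult_l[OF Ek])
      finally have "a s \<cdot> (pbw s * v) \<approx> a s \<cdot> 0" by (intro I.csmul) simp
      then show ?thesis by (simp add: st Suc del: pbw.simps)
    qed
  qed (auto split: prod.split)
  then have "(\<Sum>s\<in>B. a s \<cdot> (pbw s * v))
      \<approx> (\<Sum>s\<in>B. (case s of (i, j, k) \<Rightarrow> if i = 0 \<and> k = 0 then a (i, j, k) * z ^ j else 0) \<cdot> v)"
    by (intro I.csum)
  then show ?thesis
    by (simp add: pbw_sum_def hwfun_def sum_distrib_right sum_smul[symmetric])
qed

text \<open>
  The image in the algebra of a highest weight vector of weight \<open>z\<close>: the sum over \<open>j\<close> projects to
  the eigenvalue \<open>z\<close> of \<open>K\<close>, and \<open>E ^ (p - 1)\<close> is killed by \<open>E\<close>.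
\<close>

definition hw :: "complex \<Rightarrow> free_alg" where
  "hw z = (\<Sum>j<p. inverse z ^ j \<cdot> pbw (0, j, p - 1))"

lemma hw_K:
  assumes z: "z ^ p = 1" shows "gK * hw z \<approx> z \<cdot> hw z"
proof -
  let ?f = "\<lambda>j. inverse z ^ j \<cdot> pbw (0, j, p - 1)"
  have z0: "z \<noteq> 0" using z p_ge by (cases "z = 0") (auto simp: power_0_left split: if_splits)
  have "gK * hw z = (\<Sum>j<p. z \<cdot> ?f (Suc j))"
    using z0 unfolding hw_def sum_distrib_left
    by (intro sum.cong refl) (simp add: mult.assoc mult.assoc[symmetric, of z])
  also have "\<dots> = z \<cdot> ((\<Sum>j<Suc p. ?f j) - ?f 0)"
    by (simp only: sum.lessThan_Suc_shift smul_sum) (simp add: smul_sum)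
  also have "\<dots> = z \<cdot> (hw z + (?f p - ?f 0))"
    by (simp add: hw_def add_diff_eq)
  also have "\<dots> \<approx> z \<cdot> (hw z + (?f 0 - ?f 0))"
  proof -
    have "?f p \<approx> 1 \<cdot> pbw (0, 0, p - 1)"
      using z I.cmult_r[OF K_p, of "gE ^ (p - 1)"] by (simp add: power_inverse)
    then show ?thesis by (intro I.csmul I.cadd I.cdiff) simp_all
  qed
  finally show ?thesis by simp
qed

lemma hw_E: "gE * hw z \<approx> 0"
proof -
  have "gE * pbw (0, j, p - 1) \<approx> 0" for j
  proof -
    have "gE * pbw (0, j, p - 1) \<approx> Qi ^ j \<cdot> (gK ^ j * gE ^ p)"
      using I.E_pbw[of 0 j "p - 1"] p_ge by simp
    also have "\<dots> \<approx> Qi ^ j \<cdot> (gK ^ j * 0)" by (intro I.csmul I.cmult_l E_p)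
    finally show ?thesis by simp
  qed
  then have "(\<Sum>j<p. inverse z ^ j \<cdot> (gE * pbw (0, j, p - 1))) \<approx> (\<Sum>j<p. inverse z ^ j \<cdot> 0)"
    by (intro I.csum I.csmul)
  then show ?thesis by (simp add: hw_def sum_distrib_left del: pbw.simps)
qed

lemma coord_F_hw:
  assumes n: "n < p" shows "coord (gF ^ n * hw z) (n, 0, p - 1) = 1"
proof -
  have B: "(n, 0, p - 1) \<in> B" using n p_ge by simp
  have Fb: "gF ^ n * pbw (0, j, k) = pbw (n, j, k)" for j k by (simp add: mult.assoc)
  have "gF ^ n * hw z = (\<Sum>j<p. inverse z ^ j \<cdot> pbw (n, j, p - 1))"
    by (simp only: hw_def sum_distrib_left smul_mult_right Fb)
  then have "coord (gF ^ n * hw z) (n, 0, p - 1)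
    = (\<Sum>j<p. coord (inverse z ^ j \<cdot> pbw (n, j, p - 1)) (n, 0, p - 1))"
  proof -
    have "coord (\<Sum>j\<in>S. f j) (n, 0, p - 1) = (\<Sum>j\<in>S. coord (f j) (n, 0, p - 1))"
      for S :: "nat set" and f
      by (induction S rule: infinite_finite_induct) (simp_all add: coord_zero[OF B] coord_add[OF B] del: One_nat_def)
    then show ?thesis using \<open>gF ^ n * hw z = _\<close> by simp
  qed
  also have "\<dots> = (\<Sum>j<p. if j = 0 then 1 else 0)"
    using B by (intro sum.cong refl) (auto simp: coord_smul coord_pbw simp del: pbw.simps)
  finally show ?thesis by simp
qed

text \<open>
  If \<open>v\<close> is a highest weight vector, \<open>pbw_sum a\<close> acts on \<open>F ^ n * v\<close> by its scalar on \<open>v\<close> plus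
  \<open>n * m\<close>. Whenever \<open>F ^ n * v\<close> is again killed by \<open>E\<close>, that scalar depends only on the weight
  of \<open>F ^ n * v\<close>. This happens for \<open>n = 1\<close>, which takes weight \<open>1\<close> to weight \<open>q\<^sup>-\<^sup>2\<close>, and for
  \<open>n = p - 1\<close>, which takes weight \<open>q\<^sup>-\<^sup>2\<close> back to weight \<open>1\<close>. Together the two steps give \<open>p * m = 0\<close>.
\<close>

lemma F_eigenvalue_zero:
  assumes bal: "\<And>s. s \<in> B \<Longrightarrow> a s \<noteq> 0 \<Longrightarrow> balanced s"
    and m: "pbw_sum a * gF - gF * pbw_sum a \<approx> m \<cdot> gF"
  shows "m = 0"
proof -
  have aF: "pbw_sum a * gF \<approx> gF * pbw_sum a + m \<cdot> gF"
    using I.cadd[OF m I.crefl[of "gF * pbw_sum a"]] by (simp add: add.commute)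
  have aFn: "pbw_sum a * gF ^ n \<approx> gF ^ n * pbw_sum a + (of_nat n * m) \<cdot> gF ^ n" for n
  proof (induction n)
    case (Suc n)
    have "pbw_sum a * gF ^ Suc n = (pbw_sum a * gF ^ n) * gF" by (simp only: power_Suc2 mult.assoc)
    also have "\<dots> \<approx> (gF ^ n * pbw_sum a + (of_nat n * m) \<cdot> gF ^ n) * gF" by (rule I.cmult_r[OF Suc])
    also have "\<dots> = gF ^ n * (pbw_sum a * gF) + (of_nat n * m) \<cdot> gF ^ Suc n"
      by (simp only: distrib_right smul_mult_left power_Suc2 mult.assoc)
    also have "\<dots> \<approx> gF ^ n * (gF * pbw_sum a + m \<cdot> gF) + (of_nat n * m) \<cdot> gF ^ Suc n"
      by (intro I.cadd I.cmult_l aF) simp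
    also have "\<dots> = gF ^ Suc n * pbw_sum a + (of_nat (Suc n) * m) \<cdot> gF ^ Suc n"
      by (simp only: distrib_left smul_mult_right power_Suc2 mult.assoc)
         (simp add: add_smul distrib_right add.assoc)
    finally show ?case .
  qed simp
  have shift: "hwfun a (Qi ^ n * z) = hwfun a z + of_nat n * m"
    if n: "n < p" and z: "z ^ p = 1" and S: "Sm n * z = Sp n * inverse z" for n z
  proof -
    let ?v = "gF ^ n * hw z"
    have z0: "z \<noteq> 0" using z p_ge by (cases "z = 0") (auto simp: power_0_left split: if_splits)
    have Kv: "gK * ?v \<approx> (Qi ^ n * z) \<cdot> ?v"
    proof -
      have "gK * ?v = (gK ^ 1 * gF ^ n) * hw z" by (simp add: mult.assoc)
      also have "\<dots> \<approx> (Qi ^ (1 * n) \<cdot> (gF ^ n * gK ^ 1)) * hw z" by (intro I.cmult_r I.KF_power)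
      also have "\<dots> = Qi ^ n \<cdot> (gF ^ n * (gK * hw z))" by (simp add: mult.assoc)
      also have "\<dots> \<approx> Qi ^ n \<cdot> (gF ^ n * (z \<cdot> hw z))" by (intro I.csmul I.cmult_l hw_K z)
      finally show ?thesis by simp
    qed
    have Kiv: "Ki * hw z \<approx> inverse z \<cdot> hw z"
    proof -
      have "z ^ (p - 1) * z = 1" using z p_ge by (metis Suc_diff_1 p_pos power_Suc2)
      then have "z ^ (p - 1) = inverse z" using z0 by (simp add: field_simps)
      then show ?thesis using K_power_eigen[OF hw_K[OF z], of "p - 1"] by (simp add: Kinv_def)
    qed
    have Ev: "gE * ?v \<approx> 0"
    proof -
      have "gE * ?v = (gE * gF ^ n) * hw z" by (simp add: mult.assoc)
      also have "\<dots> \<approx> (gF ^ n * gE + c0 \<cdot> (Sm n \<cdot> (gF ^ (n - 1) * gK) - Sp n \<cdot> (gF ^ (n - 1) * Ki))) * hw z"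
        by (intro I.cmult_r I.E_F_power)
      also have "\<dots> = gF ^ n * (gE * hw z)
          + c0 \<cdot> (Sm n \<cdot> (gF ^ (n - 1) * (gK * hw z)) - Sp n \<cdot> (gF ^ (n - 1) * (Ki * hw z)))"
        by (simp only: distrib_right left_diff_distrib smul_mult_left mult.assoc)
      also have "\<dots> \<approx> gF ^ n * 0
          + c0 \<cdot> (Sm n \<cdot> (gF ^ (n - 1) * (z \<cdot> hw z)) - Sp n \<cdot> (gF ^ (n - 1) * (inverse z \<cdot> hw z)))"
        by (intro I.cadd I.csmul I.cdiff I.cmult_l hw_E hw_K z Kiv)
      also have "\<dots> = 0" using S by (simp flip: diff_smul)
      finally show ?thesis .
    qed
    have "(hwfun a z + of_nat n * m) \<cdot> ?v = gF ^ n * (hwfun a z \<cdot> hw z) + (of_nat n * m) \<cdot> ?v"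
      by (simp add: add_smul)
    also have "\<dots> \<approx> gF ^ n * (pbw_sum a * hw z) + (of_nat n * m) \<cdot> ?v"
      by (intro I.cadd I.cmult_l I.csym[OF act_on_highest_weight[OF bal hw_K[OF z] hw_E]]) simp_all
    also have "\<dots> = (gF ^ n * pbw_sum a + (of_nat n * m) \<cdot> gF ^ n) * hw z"
      by (simp add: distrib_right mult.assoc)
    also have "\<dots> \<approx> (pbw_sum a * gF ^ n) * hw z" by (intro I.cmult_r I.csym[OF aFn])
    also have "\<dots> = pbw_sum a * ?v" by (rule mult.assoc)
    also have "\<dots> \<approx> hwfun a (Qi ^ n * z) \<cdot> ?v" by (rule act_on_highest_weight[OF bal Kv Ev])
    finally have "coord ((hwfun a z + of_nat n * m) \<cdot> ?v) (n, 0, p - 1)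
        = coord (hwfun a (Qi ^ n * z) \<cdot> ?v) (n, 0, p - 1)" by (rule coord_cong)
    moreover have "(n, 0, p - 1) \<in> B" using n p_ge by simp
    ultimately show ?thesis using coord_F_hw[OF n] by (simp add: coord_smul)
  qed
  have "hwfun a (Qi ^ 1 * 1) = hwfun a 1 + of_nat 1 * m"
    by (rule shift) (use p_ge in \<open>simp_all add: Sm_1 Sp_1\<close>)
  moreover have "hwfun a (Qi ^ (p - 1) * Qi) = hwfun a Qi + of_nat (p - 1) * m"
  proof (rule shift)
    have "inverse Qi = Q" by simp
    then show "Sm (p - 1) * Qi = Sp (p - 1) * inverse Qi"
      unfolding Sm_pred Sp_pred by (simp only: mult_minus_left Q_Qi)
  qed (use p_ge in simp_all)
  moreover have "Qi ^ (p - 1) * Qi = 1" unfolding Qi_pred by (rule Q_Qi)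
  ultimately have "m + of_nat (p - 1) * m = 0" by simp
  then have "(1 + of_nat (p - 1)) * m = 0" by (simp only: distrib_right mult_1_left)
  moreover have "1 + of_nat (p - 1) = (of_nat p :: complex)" using p_ge by (simp add: of_nat_diff)
  ultimately show "m = 0" using p_ge by simp
qed

text \<open>
  The commutator with \<open>x\<close> multiplies \<open>E * F - F * E\<close> by \<open>l\<close>. It also vanishes there, because
  \<open>E * F - F * E\<close> is a multiple of \<open>K\<close> minus its inverse and \<open>x\<close> commutes with \<open>K\<close>.
\<close>

lemma E_eigenvalue_zero:
  assumes x: "x * gK \<approx> gK * x" "x * Ki \<approx> Ki * x" "x * gF \<approx> gF * x"
    and l: "x * gE - gE * x \<approx> l \<cdot> gE"
  shows "l = 0"
proof -
  have xE: "x * gE \<approx> gE * x + l \<cdot> gE"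
    using I.cadd[OF l I.crefl[of "gE * x"]] by (simp add: add.commute)
  have "x * (gE * gF) = (x * gE) * gF" by (simp add: mult.assoc)
  also have "\<dots> \<approx> (gE * x + l \<cdot> gE) * gF" by (rule I.cmult_r[OF xE])
  also have "\<dots> = gE * (x * gF) + l \<cdot> (gE * gF)" by (simp add: distrib_right mult.assoc)
  also have "\<dots> \<approx> gE * (gF * x) + l \<cdot> (gE * gF)" by (intro I.cadd I.cmult_l x) simp
  finally have 1: "x * (gE * gF) \<approx> gE * gF * x + l \<cdot> (gE * gF)" by (simp add: mult.assoc)
  have "x * (gF * gE) = (x * gF) * gE" by (simp add: mult.assoc)
  also have "\<dots> \<approx> (gF * x) * gE" by (rule I.cmult_r[OF x(3)])
  also have "\<dots> = gF * (x * gE)" by (simp add: mult.assoc)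
  also have "\<dots> \<approx> gF * (gE * x + l \<cdot> gE)" by (rule I.cmult_l[OF xE])
  finally have 2: "x * (gF * gE) \<approx> gF * gE * x + l \<cdot> (gF * gE)" by (simp add: distrib_left mult.assoc)
  have H: "gE * gF - gF * gE \<approx> c0 \<cdot> (gK - Ki)"
    using I.cdiff[OF I.EF I.crefl[of "gF * gE"]] by simp
  have "x * (gE * gF - gF * gE) - (gE * gF - gF * gE) * x
    = x * (gE * gF) - x * (gF * gE) - (gE * gF * x - gF * gE * x)"
    by (simp add: right_diff_distrib left_diff_distrib)
  also have "\<dots> \<approx> (gE * gF * x + l \<cdot> (gE * gF)) - (gF * gE * x + l \<cdot> (gF * gE)) - (gE * gF * x - gF * gE * x)"
    by (intro I.cdiff 1 2 I.crefl)
  also have "\<dots> = l \<cdot> (gE * gF - gF * gE)" by (simp add: smul_diff)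
  also have "\<dots> \<approx> l \<cdot> (c0 \<cdot> (gK - Ki))" by (rule I.csmul[OF H])
  finally have a: "x * (gE * gF - gF * gE) - (gE * gF - gF * gE) * x \<approx> l \<cdot> (c0 \<cdot> (gK - Ki))" .
  have "x * (gE * gF - gF * gE) - (gE * gF - gF * gE) * x
      \<approx> x * (c0 \<cdot> (gK - Ki)) - (c0 \<cdot> (gK - Ki)) * x"
    by (intro I.cdiff I.cmult_l I.cmult_r H)
  also have "\<dots> = c0 \<cdot> ((x * gK - gK * x) - (x * Ki - Ki * x))"
    by (simp add: right_diff_distrib left_diff_distrib smul_diff)
  also have "\<dots> \<approx> c0 \<cdot> ((x * gK - x * gK) - (x * Ki - x * Ki))"
    by (intro I.csmul I.cdiff I.csym[OF x(1)] I.csym[OF x(2)] I.crefl)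
  also have "\<dots> = 0" by simp
  finally have "l \<cdot> (c0 \<cdot> (gK - Ki)) \<approx> 0" using a I.csym I.ctrans by blast
  then have "coord (l \<cdot> (c0 \<cdot> (gK - Ki))) (0, 1, 0) = coord 0 (0, 1, 0)" by (rule coord_cong)
  moreover have B: "(0, 1, 0) \<in> B" using p_ge by simp
  moreover have "coord gK (0, 1, 0) = 1" "coord Ki (0, 1, 0) = 0"
    using coord_pbw[OF B, of 0 1 0] coord_pbw[OF B, of 0 "p - 1" 0] p_ge by (simp_all add: Kinv_def)
  ultimately have "l * c0 = 0"
    unfolding coord_smul[OF B] coord_diff[OF B] coord_zero[OF B] by simp
  then show ?thesis using c0_nz by simp
qed

lemma d1_add: "d1 (\<lambda>s. h s + h' s) s t = d1 h s t + d1 h' s t"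
  by (simp add: d1_def dualmult_add)

lemma invariant_cocycle_is_coboundary:
  assumes coc: "\<And>s t u. s \<in> B \<Longrightarrow> t \<in> B \<Longrightarrow> u \<in> B \<Longrightarrow> d2 c s t u = 0"
    and inv: "\<And>g. pbw_sum2 c * Delta (genr g) \<approx>\<^sub>2 Delta (genr g) * pbw_sum2 c"
  shows "\<exists>x. (\<forall>g. x * genr g \<approx> genr g * x) \<and> pbw_sum2 c \<approx>\<^sub>2 cobd x"
proof -
  define c1 where "c1 = (\<lambda>s t. c s t - d1 (c o0) s t)"
  define h2 where "h2 = (\<lambda>s. c1 s o0)"
  define c2 where "c2 = (\<lambda>s t. c1 s t - d1 h2 s t)"
  define a where "a = (\<lambda>s. c o0 s + h2 s)"
  have norm1: "d2 c2 s t u = 0" if "s \<in> B" "t \<in> B" "u \<in> B" for s t u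
    using normalise_cocycle(1)[of c, OF _ that] coc unfolding c2_def h2_def c1_def by blast
  have norm2: "c2 (0, j, 0) t = 0" and norm3: "c2 t (0, j, 0) = 0" if "j < p" "t \<in> B" for j t
    using normalise_cocycle(2,3)[of c, OF _ that] coc unfolding c2_def h2_def c1_def by blast+
  have oB: "o0 \<in> B" by simp
  have wt: "balanced2 s t" if "s \<in> B" "t \<in> B" "c s t \<noteq> 0" for s t
    by (rule balanced2_of_commute_K[OF inv that])
  have bl: "balanced s" if "s \<in> B" "balanced2 o0 s" for s
    using that by (cases s) auto
  have br: "balanced s" if "s \<in> B" "balanced2 s o0" for s
    using that by (cases s) auto
  have bal1: "balanced s" if "s \<in> B" "c o0 s \<noteq> 0" for s
    by (rule bl[OF that(1) wt[OF oB that]])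
  have wt1: "balanced2 s t" if "s \<in> B" "t \<in> B" "c1 s t \<noteq> 0" for s t
  proof -
    have "c s t \<noteq> 0 \<or> d1 (c o0) s t \<noteq> 0" using that by (auto simp: c1_def)
    then show ?thesis using wt[OF that(1,2)] d1_balanced[of "c o0" s t, OF bal1 that(1,2)] by blast
  qed
  have bal2: "balanced s" if "s \<in> B" "h2 s \<noteq> 0" for s
    using that wt1[OF that(1) oB] br by (simp add: h2_def)
  have wt2: "balanced2 s t" if "s \<in> B" "t \<in> B" "c2 s t \<noteq> 0" for s t
  proof -
    have "c1 s t \<noteq> 0 \<or> d1 h2 s t \<noteq> 0" using that by (auto simp: c2_def)
    then show ?thesis using wt1[OF that(1,2)] d1_balanced[of h2 s t, OF bal2 that(1,2)] by blast
  qed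
  have bal: "balanced s" if "s \<in> B" "a s \<noteq> 0" for s
    using that bal1[of s] bal2[of s] by (cases "h2 s = 0") (auto simp: a_def)
  have supp: "typeF s t \<or> typeE s t" if "s \<in> B" "t \<in> B" "c2 s t \<noteq> 0" for s t
    unfolding typeF_def typeE_def by (rule reduced_support[of c2, OF norm1 norm2 norm3 wt2 that])
  have dec: "pbw_sum2 c \<approx>\<^sub>2 cobd (pbw_sum a) + pbw_sum2 c2"
  proof (rule coord2_eqI)
    fix s t assume st: "s \<in> B" "t \<in> B"
    have "d1 (coord (pbw_sum a)) s t = d1 a s t"
      using st by (simp add: d1_def coord_pbw_sum dualmult_def)
    then show "coord2 (pbw_sum2 c) s t = coord2 (cobd (pbw_sum a) + pbw_sum2 c2) s t"
      using st by (simp add: coord2_add coord2_pbw_sum2 coord2_cobd a_def d1_add c2_def c1_def)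
  qed
  have inv': "(cobd (pbw_sum a) + pbw_sum2 c2) * Delta (genr g) \<approx>\<^sub>2 Delta (genr g) * (cobd (pbw_sum a) + pbw_sum2 c2)" for g
  proof -
    have "(cobd (pbw_sum a) + pbw_sum2 c2) * Delta (genr g) \<approx>\<^sub>2 pbw_sum2 c * Delta (genr g)"
      by (rule I2.cmult_r[OF I2.csym[OF dec]])
    also have "\<dots> \<approx>\<^sub>2 Delta (genr g) * pbw_sum2 c" by (rule inv)
    also have "\<dots> \<approx>\<^sub>2 Delta (genr g) * (cobd (pbw_sum a) + pbw_sum2 c2)" by (rule I2.cmult_l[OF dec])
    finally show ?thesis .
  qed
  have zero: "c2 s t = 0" if "s \<in> B" "t \<in> B" for s t
    using c2_zero[OF bal supp inv' inv' that] by blast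
  obtain l where l: "pbw_sum a * gE - gE * pbw_sum a \<approx> l \<cdot> gE"
    using xE_eq[OF bal supp inv' inv'] xE_def[OF bal supp inv' inv'] by metis
  obtain m where m: "pbw_sum a * gF - gF * pbw_sum a \<approx> m \<cdot> gF"
    using yF_eq[OF bal supp inv' inv'] yF_def[OF bal supp inv' inv'] by metis
  have aK: "pbw_sum a * gK \<approx> gK * pbw_sum a" using commute_pbw_sum[OF bal, where m = 1] by simp
  have aKi: "pbw_sum a * Ki \<approx> Ki * pbw_sum a" unfolding Kinv_def by (rule commute_pbw_sum[OF bal])
  have "m = 0" by (rule F_eigenvalue_zero[OF bal m])
  then have aF: "pbw_sum a * gF \<approx> gF * pbw_sum a" using m by (simp add: cg_def)
  have "l = 0" by (rule E_eigenvalue_zero[OF aK aKi aF l])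
  then have aE: "pbw_sum a * gE \<approx> gE * pbw_sum a" using l by (simp add: cg_def)
  have "pbw_sum a * genr g \<approx> genr g * pbw_sum a" for g using aE aF aK by (cases g) auto
  moreover have "pbw_sum2 c \<approx>\<^sub>2 cobd (pbw_sum a)"
  proof -
    have "pbw_sum2 c2 = 0" using zero by (simp add: pbw_sum2_def)
    then show ?thesis using dec by simp
  qed
  ultimately show ?thesis by blast
qed


section \<open>Cochains as elements of the tensor square\<close>

text \<open>
  The intertwiner applies each monomial to \<open>v\<close>. It commutes with the action because the monomials
  span the algebra modulo the relations, which hold in \<open>X\<close> as well.
\<close>

lemma regular_module_free:
  assumes X: "X \<in> modules p q" and v: "v \<in> carrier_mat (fst X) 1"
  shows "\<exists>\<phi>\<in>mod_hom p q R X. \<forall>x. \<phi> * (LR x * bv o0) = rep X x * v"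
proof -
  note L = alg_rep_rep[OF X]
  note cX = alg_rep_carrier[OF L]
  define \<phi> where "\<phi> = mat (fst X) dimR (\<lambda>(r, s). (rep X (pbw (dec s)) * v) $$ (r, 0))"
  have \<phi>: "\<phi> \<in> carrier_mat (fst X) dimR" by (simp add: \<phi>_def)
  have rv: "rep X x * v \<in> carrier_mat (fst X) 1" for x by (rule mult_carrier_mat[OF cX v])
  have Lb: "LR x * bv s \<in> carrier_mat dimR 1" for x s by (rule mult_carrier_mat[OF LR_carrier bv_carrier])
  have base: "\<phi> * bv s = rep X (pbw s) * v" if s: "s \<in> B" for s
  proof (rule eq_matI)
    fix r c assume "r < dim_row (rep X (pbw s) * v)" "c < dim_col (rep X (pbw s) * v)"
    then have rc: "r < fst X" "c = 0" using rv[of "pbw s"] by auto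
    then show "(\<phi> * bv s) $$ (r, c) = (rep X (pbw s) * v) $$ (r, c)"
      using mult_ucol_index[OF \<phi> rc(1) enc_less[OF s]] enc_less[OF s]
      by (simp add: bv_in_B[OF s] \<phi>_def dec_enc[OF s] del: index_mult_mat(1))
  qed (use rv[of "pbw s"] \<phi> in auto)
  have main: "\<phi> * (LR x * bv o0) = rep X x * v" for x
  proof -
    have z: "\<phi> * (LR 0 * bv o0) = rep X 0 * v"
      using \<phi> v by (simp add: alg_rep_zero[OF alg_rep_LR] alg_rep_zero[OF L]
          left_mult_zero_mat[OF bv_carrier] left_mult_zero_mat[OF v] right_mult_zero_mat[OF \<phi>] del: One_nat_def)
    have add: "\<phi> * (LR (x + y) * bv o0) = rep X (x + y) * v"
      if "\<phi> * (LR x * bv o0) = rep X x * v" "\<phi> * (LR y * bv o0) = rep X y * v" for x y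
      using that by (simp add: alg_rep_add[OF alg_rep_LR] alg_rep_add[OF L]
          add_mult_distrib_mat[OF LR_carrier LR_carrier bv_carrier] add_mult_distrib_mat[OF cX cX v]
          mult_add_distrib_mat[OF \<phi> Lb Lb])
    have sm: "\<phi> * (LR (c \<cdot> pbw s) * bv o0) = rep X (c \<cdot> pbw s) * v" if s: "s \<in> B" for c s
    proof -
      have "LR (pbw s) * bv o0 = bv s" by (cases s) (simp only: LR_pbw)
      then have "\<phi> * (LR (pbw s) * bv o0) = rep X (pbw s) * v" using base[OF s] by simp
      then show ?thesis
        by (simp add: alg_rep_smul[OF alg_rep_LR] alg_rep_smul[OF L]
          mult_smult_assoc_mat[OF LR_carrier bv_carrier] mult_smult_assoc_mat[OF cX v]
          mult_smult_distrib[OF \<phi> Lb])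
    qed
    have "\<phi> * (LR (\<Sum>s\<in>S. coord x s \<cdot> pbw s) * bv o0) = rep X (\<Sum>s\<in>S. coord x s \<cdot> pbw s) * v"
      if "S \<subseteq> B" for S
    proof -
      have "finite S" using that finite_B by (rule finite_subset)
      then show ?thesis using that
        by (induction S rule: finite_induct) (simp_all add: z add sm del: pbw.simps)
    qed
    then have "\<phi> * (LR (pbw_sum (coord x)) * bv o0) = rep X (pbw_sum (coord x)) * v"
      by (simp add: pbw_sum_def)
    then show ?thesis
      using rep_cong[OF expand[of x], of X] rep_cong[OF expand[of x], of R] by (simp add: rep_R)
  qed
  have "\<phi> \<in> mod_hom p q R X"
  proof (rule mod_homI)
    show "\<phi> \<in> carrier_mat (fst X) (fst R)" using \<phi> by simp
    fix x
    show "\<phi> * rep R x = rep X x * \<phi>"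
      unfolding rep_R
    proof (rule mat_eq_bvI)
      fix i j k assume s: "(i, j, k) \<in> B"
      have "\<phi> * LR x * bv (i, j, k) = \<phi> * (LR x * (LR (pbw (i, j, k)) * bv o0))"
        unfolding LR_pbw by (rule assoc_mult_mat[OF \<phi> LR_carrier bv_carrier])
      also have "\<dots> = \<phi> * (LR (x * pbw (i, j, k)) * bv o0)" by (simp only: LR_mult_bv)
      also have "\<dots> = rep X (x * pbw (i, j, k)) * v" by (rule main)
      also have "\<dots> = rep X x * (rep X (pbw (i, j, k)) * v)"
        unfolding alg_rep_mult[OF L] by (rule assoc_mult_mat[OF cX cX v])
      also have "\<dots> = rep X x * (\<phi> * bv (i, j, k))" by (simp only: base[OF s])
      also have "\<dots> = rep X x * \<phi> * bv (i, j, k)"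
        by (rule assoc_mult_mat[OF cX \<phi> bv_carrier, symmetric])
      finally show "\<phi> * LR x * bv (i, j, k) = rep X x * \<phi> * bv (i, j, k)" .
    qed (use \<phi> cX in \<open>auto intro!: mult_carrier_mat[OF \<phi> LR_carrier] mult_carrier_mat[OF cX \<phi>]\<close>)
  qed
  then show ?thesis using main by blast
qed

lemma tuples_1: "Xs \<in> tuples p q 1 \<longleftrightarrow> (\<exists>X\<in>modules p q. Xs = [X])"
  by (auto simp: tuples_def length_Suc_conv)

lemma tuples_2: "Xs \<in> tuples p q 2 \<longleftrightarrow> (\<exists>X\<in>modules p q. \<exists>Y\<in>modules p q. Xs = [X, Y])"
  by (auto simp: tuples_def numeral_2_eq_2 length_Suc_conv)

lemma tuples_3: "Xs \<in> tuples p q 3 \<longleftrightarrow>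
    (\<exists>X\<in>modules p q. \<exists>Y\<in>modules p q. \<exists>Z\<in>modules p q. Xs = [X, Y, Z])"
  by (auto simp: tuples_def numeral_3_eq_3 length_Suc_conv)

lemma kron_list_1: "kron_list [A] = A" and kron_list_2: "kron_list [A, A'] = kron A A'"
  by (simp_all add: kron_list_def kron_unit del: One_nat_def)

lemma DY_cochain1D:
  assumes z: "z \<in> DY_cochains p q 1"
  shows "z \<in> extensional (tuples p q 1)"
    and "X \<in> modules p q \<Longrightarrow> z [X] \<in> mod_hom p q X X"
    and "X \<in> modules p q \<Longrightarrow> Y \<in> modules p q \<Longrightarrow> \<phi> \<in> mod_hom p q X Y \<Longrightarrow> z [Y] * \<phi> = \<phi> * z [X]"
proof -
  show "z \<in> extensional (tuples p q 1)" using z by (auto simp: DY_cochains_def PiE_def)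
  show "z [X] \<in> mod_hom p q X X" if "X \<in> modules p q"
    using z that
    by (auto simp: DY_cochains_def tuples_1[unfolded One_nat_def] dest!: PiE_mem[of _ _ _ "[X]"])
  show "z [Y] * \<phi> = \<phi> * z [X]" if "X \<in> modules p q" "Y \<in> modules p q" "\<phi> \<in> mod_hom p q X Y"
  proof -
    have "\<forall>Xs\<in>tuples p q 1. \<forall>Ys\<in>tuples p q 1. \<forall>\<phi>s. length \<phi>s = 1 \<longrightarrow>
        (\<forall>i<1. \<phi>s ! i \<in> mod_hom p q (Xs ! i) (Ys ! i)) \<longrightarrow> z Ys * kron_list \<phi>s = kron_list \<phi>s * z Xs"
      using z by (simp add: DY_cochains_def)
    from this[rule_format, of "[X]" "[Y]" "[\<phi>]"] show ?thesis
      using that by (simp add: tuples_1[unfolded One_nat_def] tuples_1 kron_list_1)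
  qed
qed

lemma DY_cochain1I:
  assumes "z \<in> extensional (tuples p q 1)" "\<And>X. X \<in> modules p q \<Longrightarrow> z [X] \<in> mod_hom p q X X"
    and nat: "\<And>X Y \<phi>. X \<in> modules p q \<Longrightarrow> Y \<in> modules p q \<Longrightarrow> \<phi> \<in> mod_hom p q X Y \<Longrightarrow> z [Y] * \<phi> = \<phi> * z [X]"
  shows "z \<in> DY_cochains p q 1"
proof -
  have "z Ys * kron_list \<phi>s = kron_list \<phi>s * z Xs"
    if "Xs \<in> tuples p q 1" "Ys \<in> tuples p q 1" "length \<phi>s = 1" "\<forall>i<1. \<phi>s ! i \<in> mod_hom p q (Xs ! i) (Ys ! i)"
    for Xs Ys \<phi>s
  proof -
    obtain \<phi> where "\<phi>s = [\<phi>]" using \<open>length \<phi>s = 1\<close> by (auto simp: length_Suc_conv)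
    then show ?thesis using that nat by (auto simp: tuples_1[unfolded One_nat_def] tuples_1 kron_list_1)
  qed
  then show ?thesis
    using assms(1,2) unfolding DY_cochains_def
    by (auto simp: PiE_def tuples_1[unfolded One_nat_def] tuples_1 Pi_def)
qed

lemma DY_cochain2D:
  assumes f: "f \<in> DY_cochains p q 2"
  shows "f \<in> extensional (tuples p q 2)"
    and "X \<in> modules p q \<Longrightarrow> Y \<in> modules p q \<Longrightarrow> f [X, Y] \<in> mod_hom p q (tensor_mod p q X Y) (tensor_mod p q X Y)"
    and "X \<in> modules p q \<Longrightarrow> Y \<in> modules p q \<Longrightarrow> X' \<in> modules p q \<Longrightarrow> Y' \<in> modules p q \<Longrightarrow>
      \<phi> \<in> mod_hom p q X X' \<Longrightarrow> \<psi> \<in> mod_hom p q Y Y' \<Longrightarrow> f [X', Y'] * kron \<phi> \<psi> = kron \<phi> \<psi> * f [X, Y]"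
proof -
  show "f \<in> extensional (tuples p q 2)" using f by (auto simp: DY_cochains_def PiE_def)
  show "f [X, Y] \<in> mod_hom p q (tensor_mod p q X Y) (tensor_mod p q X Y)"
    if "X \<in> modules p q" "Y \<in> modules p q"
    using f that by (auto simp: DY_cochains_def tuples_2 dest!: PiE_mem[of _ _ _ "[X, Y]"])
  show "f [X', Y'] * kron \<phi> \<psi> = kron \<phi> \<psi> * f [X, Y]"
    if "X \<in> modules p q" "Y \<in> modules p q" "X' \<in> modules p q" "Y' \<in> modules p q"
      "\<phi> \<in> mod_hom p q X X'" "\<psi> \<in> mod_hom p q Y Y'"
  proof -
    have "\<forall>Xs\<in>tuples p q 2. \<forall>Ys\<in>tuples p q 2. \<forall>\<phi>s. length \<phi>s = 2 \<longrightarrow>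
        (\<forall>i<2. \<phi>s ! i \<in> mod_hom p q (Xs ! i) (Ys ! i)) \<longrightarrow> f Ys * kron_list \<phi>s = kron_list \<phi>s * f Xs"
      using f by (simp add: DY_cochains_def)
    moreover have "\<forall>i<2. [\<phi>, \<psi>] ! i \<in> mod_hom p q ([X, Y] ! i) ([X', Y'] ! i)"
      using that by (auto simp: less_2_cases_iff)
    moreover have "[X, Y] \<in> tuples p q 2" "[X', Y'] \<in> tuples p q 2" "length [\<phi>, \<psi>] = 2"
      using that by (simp_all add: tuples_2)
    ultimately have "f [X', Y'] * kron_list [\<phi>, \<psi>] = kron_list [\<phi>, \<psi>] * f [X, Y]" by blast
    then show ?thesis by (simp only: kron_list_2)
  qed
qed

lemma DY_cochain2I:
  assumes "f \<in> extensional (tuples p q 2)"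
    and hom: "\<And>X Y. X \<in> modules p q \<Longrightarrow> Y \<in> modules p q \<Longrightarrow>
      f [X, Y] \<in> mod_hom p q (tensor_mod p q X Y) (tensor_mod p q X Y)"
    and nat: "\<And>X Y X' Y' \<phi> \<psi>. X \<in> modules p q \<Longrightarrow> Y \<in> modules p q \<Longrightarrow> X' \<in> modules p q \<Longrightarrow> Y' \<in> modules p q \<Longrightarrow>
      \<phi> \<in> mod_hom p q X X' \<Longrightarrow> \<psi> \<in> mod_hom p q Y Y' \<Longrightarrow> f [X', Y'] * kron \<phi> \<psi> = kron \<phi> \<psi> * f [X, Y]"
  shows "f \<in> DY_cochains p q 2"
proof -
  have "f Ys * kron_list \<phi>s = kron_list \<phi>s * f Xs"
    if XY: "Xs \<in> tuples p q 2" "Ys \<in> tuples p q 2" and l: "length \<phi>s = 2"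
      and h: "\<forall>i<2. \<phi>s ! i \<in> mod_hom p q (Xs ! i) (Ys ! i)" for Xs Ys \<phi>s
  proof -
    obtain X Y X' Y' where e: "Xs = [X, Y]" "Ys = [X', Y']" and m: "X \<in> modules p q" "Y \<in> modules p q"
      "X' \<in> modules p q" "Y' \<in> modules p q" using XY by (auto simp: tuples_2)
    obtain \<phi> \<psi> where p: "\<phi>s = [\<phi>, \<psi>]" using l by (auto simp: numeral_2_eq_2 length_Suc_conv)
    have "\<phi> \<in> mod_hom p q X X'" "\<psi> \<in> mod_hom p q Y Y'"
      using h[rule_format, of 0] h[rule_format, of 1] by (simp_all add: e p)
    then show ?thesis unfolding e p kron_list_2 by (rule nat[OF m])
  qed
  then show ?thesis
    using assms(1) hom unfolding DY_cochains_def
    by (auto simp: PiE_def tuples_2 Pi_def)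
qed

lemma tensor_square_hom:
  assumes X: "X \<in> modules p q" and Y: "Y \<in> modules p q" and X': "X' \<in> modules p q" and Y': "Y' \<in> modules p q"
    and \<phi>: "\<phi> \<in> mod_hom p q X X'" and \<psi>: "\<psi> \<in> mod_hom p q Y Y'"
  shows "kron \<phi> \<psi> * trep X Y y = trep X' Y' y * kron \<phi> \<psi>"
proof -
  note c = mod_homD(1)[OF \<phi>] mod_homD(1)[OF \<psi>]
  note cX = alg_rep_carrier[OF alg_rep_rep[OF X]] and cY = alg_rep_carrier[OF alg_rep_rep[OF Y]]
  note cX' = alg_rep_carrier[OF alg_rep_rep[OF X']] and cY' = alg_rep_carrier[OF alg_rep_rep[OF Y']]
  note L = alg_rep_trep[OF X Y] and L' = alg_rep_trep[OF X' Y']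
  note k = kron_carrier[OF c]
  show ?thesis
  proof (induction y rule: tens_induct)
    case (tens x x')
    show ?case
      unfolding trep_tens[OF X Y] trep_tens[OF X' Y'] kron_mult[OF c cX cY] kron_mult[OF cX' cY' c]
        mod_homD(2)[OF \<phi>] mod_homD(2)[OF \<psi>] ..
  next
    case (add y y')
    then show ?case
      unfolding alg_rep_add[OF L] alg_rep_add[OF L']
        mult_add_distrib_mat[OF k alg_rep_carrier[OF L] alg_rep_carrier[OF L]]
        add_mult_distrib_mat[OF alg_rep_carrier[OF L'] alg_rep_carrier[OF L'] k] by simp
  qed
qed

lemma kron_mod_hom:
  assumes X: "X \<in> modules p q" and Y: "Y \<in> modules p q" and X': "X' \<in> modules p q" and Y': "Y' \<in> modules p q"
    and \<phi>: "\<phi> \<in> mod_hom p q X X'" and \<psi>: "\<psi> \<in> mod_hom p q Y Y'"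
  shows "kron \<phi> \<psi> \<in> mod_hom p q (tensor_mod p q X Y) (tensor_mod p q X' Y')"
proof (rule mod_homI)
  show "kron \<phi> \<psi> \<in> carrier_mat (fst (tensor_mod p q X' Y')) (fst (tensor_mod p q X Y))"
    using mod_homD(1)[OF \<phi>] mod_homD(1)[OF \<psi>] by simp
  show "kron \<phi> \<psi> * rep (tensor_mod p q X Y) x = rep (tensor_mod p q X' Y') x * kron \<phi> \<psi>" for x
    unfolding rep_tensor_mod[OF X Y] rep_tensor_mod[OF X' Y']
    by (rule tensor_square_hom[OF assms])
qed

lemma one_mod_hom: "X \<in> modules p q \<Longrightarrow> 1\<^sub>m (fst X) \<in> mod_hom p q X X"
proof (rule mod_homI)
  assume X: "X \<in> modules p q"
  show "1\<^sub>m (fst X) * rep X x = rep X x * 1\<^sub>m (fst X)" for x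
    using alg_rep_carrier[OF alg_rep_rep[OF X], of x] by simp
qed simp

lemma mod_hom_add: "\<phi> + \<psi> \<in> mod_hom p q X Y"
  if X: "X \<in> modules p q" and Y: "Y \<in> modules p q" and h: "\<phi> \<in> mod_hom p q X Y" "\<psi> \<in> mod_hom p q X Y"
proof (rule mod_homI)
  note c = mod_homD(1)[OF h(1)] mod_homD(1)[OF h(2)]
  show "\<phi> + \<psi> \<in> carrier_mat (fst Y) (fst X)" using c by simp
  fix x
  note cX = alg_rep_carrier[OF alg_rep_rep[OF X], of x] and cY = alg_rep_carrier[OF alg_rep_rep[OF Y], of x]
  show "(\<phi> + \<psi>) * rep X x = rep Y x * (\<phi> + \<psi>)"
    unfolding add_mult_distrib_mat[OF c cX] mult_add_distrib_mat[OF cY c] mod_homD(2)[OF h(1)] mod_homD(2)[OF h(2)] ..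
qed

lemma mod_hom_diff: "\<phi> - \<psi> \<in> mod_hom p q X Y"
  if X: "X \<in> modules p q" and Y: "Y \<in> modules p q" and h: "\<phi> \<in> mod_hom p q X Y" "\<psi> \<in> mod_hom p q X Y"
proof (rule mod_homI)
  note c = mod_homD(1)[OF h(1)] mod_homD(1)[OF h(2)]
  show "\<phi> - \<psi> \<in> carrier_mat (fst Y) (fst X)" by (rule minus_carrier_mat[OF c(2)])
  fix x
  note cX = alg_rep_carrier[OF alg_rep_rep[OF X], of x] and cY = alg_rep_carrier[OF alg_rep_rep[OF Y], of x]
  show "(\<phi> - \<psi>) * rep X x = rep Y x * (\<phi> - \<psi>)"
    unfolding minus_mult_distrib_mat[OF c cX] mult_minus_distrib_mat[OF cY c] mod_homD(2)[OF h(1)] mod_homD(2)[OF h(2)] ..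
qed

text \<open>
  Naturality reduces a 2-cochain to its value on the cyclic vector of the tensor square of the
  regular module, and hence to an element of the tensor square of the quantum group.
\<close>

definition cvec :: "(hmod list \<Rightarrow> complex mat) \<Rightarrow> expo \<Rightarrow> expo \<Rightarrow> complex" where
  "cvec f s t = (f [R, R] * e00) $$ (enc s * dimR + enc t, 0)"

lemma cochain2_formula:
  assumes f: "f \<in> DY_cochains p q 2" and X: "X \<in> modules p q" and Y: "Y \<in> modules p q"
  shows "f [X, Y] = trep X Y (pbw_sum2 (cvec f))"
proof (rule mat_eq_kron_ucolI)
  let ?y = "pbw_sum2 (cvec f)"
  have fRR: "f [R, R] \<in> carrier_mat (dimR * dimR) (dimR * dimR)"
    using mod_homD(1)[OF DY_cochain2D(2)[OF f R_module R_module]] by simp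
  show "f [X, Y] \<in> carrier_mat (fst X * fst Y) (fst X * fst Y)"
    using mod_homD(1)[OF DY_cochain2D(2)[OF f X Y]] by simp
  show "trep X Y ?y \<in> carrier_mat (fst X * fst Y) (fst X * fst Y)"
    by (rule alg_rep_carrier[OF alg_rep_trep[OF X Y]])
  have e: "f [R, R] * e00 = trep R R ?y * e00"
  proof (rule eq_matI)
    fix r k assume "r < dim_row (trep R R ?y * e00)" "k < dim_col (trep R R ?y * e00)"
    then have r: "r < dimR * dimR" and k: "k = 0" using trep_RR_carrier[of ?y] e00_carrier by auto
    have st: "dec (r div dimR) \<in> B" "dec (r mod dimR) \<in> B"
      using div_mod_less[OF r] by (auto intro: dec_B)
    have "r = enc (dec (r div dimR)) * dimR + enc (dec (r mod dimR))"
      by (simp only: enc_dec div_mult_mod_eq)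
    then show "(f [R, R] * e00) $$ (r, k) = (trep R R ?y * e00) $$ (r, k)"
      using coord2_pbw_sum2[OF st, of "cvec f"] unfolding coord2_def cvec_def k by metis
  qed (use fRR trep_RR_carrier[of ?y] e00_carrier in auto)
  fix i j assume ij: "i < fst X" "j < fst Y"
  obtain \<phi> where \<phi>: "\<phi> \<in> mod_hom p q R X" "\<And>x. \<phi> * (LR x * bv o0) = rep X x * ucol (fst X) i"
    using regular_module_free[OF X ucol_carrier] by blast
  obtain \<psi> where \<psi>: "\<psi> \<in> mod_hom p q R Y" "\<And>x. \<psi> * (LR x * bv o0) = rep Y x * ucol (fst Y) j"
    using regular_module_free[OF Y ucol_carrier] by blast
  have c: "\<phi> \<in> carrier_mat (fst X) dimR" "\<psi> \<in> carrier_mat (fst Y) dimR"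
    using mod_homD(1)[OF \<phi>(1)] mod_homD(1)[OF \<psi>(1)] by simp_all
  note k = kron_carrier[OF c]
  have u: "\<phi> * bv o0 = ucol (fst X) i" "\<psi> * bv o0 = ucol (fst Y) j"
    using \<phi>(2)[of 1] \<psi>(2)[of 1]
    by (simp_all add: alg_rep_one[OF alg_rep_LR] alg_rep_one[OF alg_rep_rep[OF X]]
        alg_rep_one[OF alg_rep_rep[OF Y]] left_mult_one_mat[OF bv_carrier] left_mult_one_mat[OF ucol_carrier]
        del: One_nat_def)
  have w: "kron (ucol (fst X) i) (ucol (fst Y) j) = kron \<phi> \<psi> * e00"
    unfolding kron_mult[OF c bv_carrier bv_carrier] u ..
  have cf: "f [X, Y] \<in> carrier_mat (fst X * fst Y) (fst X * fst Y)" by fact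
  have ct: "trep X Y ?y \<in> carrier_mat (fst X * fst Y) (fst X * fst Y)" by fact
  have "f [X, Y] * (kron \<phi> \<psi> * e00) = (f [X, Y] * kron \<phi> \<psi>) * e00"
    by (rule assoc_mult_mat[OF cf k e00_carrier, symmetric])
  also have "\<dots> = (kron \<phi> \<psi> * f [R, R]) * e00"
    unfolding DY_cochain2D(3)[OF f R_module R_module X Y \<phi>(1) \<psi>(1)] ..
  also have "\<dots> = kron \<phi> \<psi> * (trep R R ?y * e00)"
    unfolding e[symmetric] by (rule assoc_mult_mat[OF k fRR e00_carrier])
  also have "\<dots> = (kron \<phi> \<psi> * trep R R ?y) * e00"
    by (rule assoc_mult_mat[OF k trep_RR_carrier e00_carrier, symmetric])
  also have "\<dots> = (trep X Y ?y * kron \<phi> \<psi>) * e00"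
    unfolding tensor_square_hom[OF R_module R_module X Y \<phi>(1) \<psi>(1)] ..
  also have "\<dots> = trep X Y ?y * (kron \<phi> \<psi> * e00)"
    by (rule assoc_mult_mat[OF ct k e00_carrier])
  finally show "f [X, Y] * kron (ucol (fst X) i) (ucol (fst Y) j)
      = trep X Y ?y * kron (ucol (fst X) i) (ucol (fst Y) j)"
    unfolding w .
qed

lemma cochain2_invariant:
  assumes f: "f \<in> DY_cochains p q 2"
  shows "pbw_sum2 (cvec f) * Delta x \<approx>\<^sub>2 Delta x * pbw_sum2 (cvec f)"
proof (rule coord2_eqI)
  fix s t
  note L = alg_rep_trep[OF R_module R_module]
  have "f [R, R] * rep RR x = rep RR x * f [R, R]"
    by (rule mod_homD(2)[OF DY_cochain2D(2)[OF f R_module R_module]])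
  then have "trep R R (pbw_sum2 (cvec f) * Delta x) = trep R R (Delta x * pbw_sum2 (cvec f))"
    unfolding cochain2_formula[OF f R_module R_module] rep_tensor_mod[OF R_module R_module]
      alg_rep_mult[OF L] .
  then show "coord2 (pbw_sum2 (cvec f) * Delta x) s t = coord2 (Delta x * pbw_sum2 (cvec f)) s t"
    by (simp add: coord2_def)
qed


section \<open>Cocycles and coboundaries\<close>

lemma DY_diff1:
  assumes z: "z \<in> DY_cochains p q 1" and X: "X \<in> modules p q" and Y: "Y \<in> modules p q"
  shows "DY_diff p q 1 z [X, Y]
    = kron (1\<^sub>m (fst X)) (z [Y]) - z [tensor_mod p q X Y] + kron (z [X]) (1\<^sub>m (fst Y))"
proof -
  have t: "[X, Y] \<in> tuples p q (1 + 1)" using X Y tuples_2 by (simp add: one_add_one[symmetric] del: one_add_one)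
  note c = mod_homD(1)[OF DY_cochain1D(2)[OF z X]] mod_homD(1)[OF DY_cochain1D(2)[OF z Y]]
    mod_homD(1)[OF DY_cochain1D(2)[OF z tensor_mod_modules[OF X Y]], simplified]
  have "DY_diff p q 1 z [X, Y] = kron (1\<^sub>m (fst X)) (z [Y])
     + msum (fst X * fst Y) (\<lambda>i. (-1) ^ i \<cdot>\<^sub>m z (merge p q i [X, Y])) {1..1}
     + (-1) ^ (1 + 1) \<cdot>\<^sub>m kron (z [X]) (1\<^sub>m (fst Y))"
    unfolding DY_diff_def restrict_apply'[OF t] by simp
  also have "msum (fst X * fst Y) (\<lambda>i. (-1) ^ i \<cdot>\<^sub>m z (merge p q i [X, Y])) {1..1}
      = - z [tensor_mod p q X Y]"
    using c(3) by (intro eq_matI) (auto simp: msum_def merge_def)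
  also have "kron (1\<^sub>m (fst X)) (z [Y]) + - z [tensor_mod p q X Y]
      + (-1) ^ (1 + 1) \<cdot>\<^sub>m kron (z [X]) (1\<^sub>m (fst Y))
    = kron (1\<^sub>m (fst X)) (z [Y]) - z [tensor_mod p q X Y] + kron (z [X]) (1\<^sub>m (fst Y))"
    using c by (intro eq_matI) auto
  finally show ?thesis .
qed

lemma DY_diff2:
  assumes f: "f \<in> DY_cochains p q 2"
    and X: "X \<in> modules p q" and Y: "Y \<in> modules p q" and Z: "Z \<in> modules p q"
  shows "DY_diff p q 2 f [X, Y, Z] = kron (1\<^sub>m (fst X)) (f [Y, Z]) - f [tensor_mod p q X Y, Z]
     + f [X, tensor_mod p q Y Z] - kron (f [X, Y]) (1\<^sub>m (fst Z))"
proof -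
  let ?N = "fst X * (fst Y * fst Z)"
  have t: "[X, Y, Z] \<in> tuples p q (2 + 1)" using X Y Z tuples_3 by simp
  note hom = DY_cochain2D(2)[OF f]
  have c: "f [X, Y] \<in> carrier_mat (fst X * fst Y) (fst X * fst Y)"
    "f [Y, Z] \<in> carrier_mat (fst Y * fst Z) (fst Y * fst Z)"
    "f [tensor_mod p q X Y, Z] \<in> carrier_mat ?N ?N" "f [X, tensor_mod p q Y Z] \<in> carrier_mat ?N ?N"
    using mod_homD(1)[OF hom[OF X Y]] mod_homD(1)[OF hom[OF Y Z]]
      mod_homD(1)[OF hom[OF tensor_mod_modules[OF X Y] Z]]
      mod_homD(1)[OF hom[OF X tensor_mod_modules[OF Y Z]]] by (simp_all add: mult.assoc)
  have k: "kron (f [X, Y]) (1\<^sub>m (fst Z)) \<in> carrier_mat ?N ?N"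
    "kron (1\<^sub>m (fst X)) (f [Y, Z]) \<in> carrier_mat ?N ?N"
    using kron_carrier[OF c(1) one_carrier_mat[of "fst Z"]] kron_carrier[OF one_carrier_mat[of "fst X"] c(2)]
    by (simp_all add: mult.assoc)
  have "DY_diff p q 2 f [X, Y, Z] = kron (1\<^sub>m (fst X)) (f [Y, Z])
     + msum ?N (\<lambda>i. (-1) ^ i \<cdot>\<^sub>m f (merge p q i [X, Y, Z])) {1..2}
     + (-1) ^ (2 + 1) \<cdot>\<^sub>m kron (f [X, Y]) (1\<^sub>m (fst Z))"
    unfolding DY_diff_def restrict_apply'[OF t] by simp
  also have "msum ?N (\<lambda>i. (-1) ^ i \<cdot>\<^sub>m f (merge p q i [X, Y, Z])) {1..2}
      = f [X, tensor_mod p q Y Z] - f [tensor_mod p q X Y, Z]"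
  proof -
    have "{1..2} = {1, 2::nat}" by auto
    then show ?thesis
      using c by (intro eq_matI) (auto simp: msum_def merge_def)
  qed
  also have "kron (1\<^sub>m (fst X)) (f [Y, Z]) + (f [X, tensor_mod p q Y Z] - f [tensor_mod p q X Y, Z])
     + (-1) ^ (2 + 1) \<cdot>\<^sub>m kron (f [X, Y]) (1\<^sub>m (fst Z))
   = kron (1\<^sub>m (fst X)) (f [Y, Z]) - f [tensor_mod p q X Y, Z]
     + f [X, tensor_mod p q Y Z] - kron (f [X, Y]) (1\<^sub>m (fst Z))"
    using c k by (intro eq_matI) auto
  finally show ?thesis .
qed

lemma bv_o0_entry: "s \<in> B \<Longrightarrow> bv o0 $$ (enc s, 0) = (if s = o0 then 1 else 0)"
  using enc_less[of s] enc_eq_iff[of s o0] by (simp add: bv_in_B)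

lemma cocycle_in_coordinates:
  assumes f: "f \<in> DY_cochains p q 2" and 0: "DY_diff p q 2 f [R, R, R] = 0\<^sub>m (dimR * (dimR * dimR)) (dimR * (dimR * dimR))"
    and s: "s \<in> B" and t: "t \<in> B" and u: "u \<in> B"
  shows "d2 (cvec f) s t u = 0"
proof -
  let ?N = "dimR * (dimR * dimR)"
  let ?F = "f [R, R]" and ?y = "pbw_sum2 (cvec f)"
  let ?A = "kron (1\<^sub>m dimR) ?F" and ?D = "kron ?F (1\<^sub>m dimR)"
  let ?C1 = "trep RR R ?y" and ?C2 = "trep R RR ?y"
  let ?w = "kron (bv o0) e00"
  let ?row = "enc s * (dimR * dimR) + (enc t * dimR + enc u)"
  have F: "?F \<in> carrier_mat (dimR * dimR) (dimR * dimR)"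
    using mod_homD(1)[OF DY_cochain2D(2)[OF f R_module R_module]] by simp
  have Fe: "?F * e00 \<in> carrier_mat (dimR * dimR) 1" by (rule mult_carrier_mat[OF F e00_carrier])
  have cA: "?A \<in> carrier_mat ?N ?N" by (rule kron_carrier[OF one_carrier_mat F])
  have cD: "?D \<in> carrier_mat ?N ?N"
    using kron_carrier[OF F one_carrier_mat[of dimR]] by (simp only: mult.assoc)
  have cC1: "?C1 \<in> carrier_mat ?N ?N"
    using alg_rep_carrier[OF alg_rep_trep[OF RR_module R_module], of ?y]
    by (simp only: fst_tensor_mod fst_R mult.assoc)
  have cC2: "?C2 \<in> carrier_mat ?N ?N"
    using alg_rep_carrier[OF alg_rep_trep[OF R_module RR_module], of ?y]
    by (simp only: fst_tensor_mod fst_R)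
  have w: "?w \<in> carrier_mat ?N 1"
    using kron_carrier[OF bv_carrier e00_carrier, of o0] by (simp only: mult_1_left)
  have w': "?w = kron e00 (bv o0)" by (rule kron_assoc[symmetric])
  have row: "?row < ?N" by (intro mult_add_less[of _ dimR _ "dimR * dimR"] enc2_less enc_less s t u)
  have row': "?row = (enc s * dimR + enc t) * dimR + enc u" by (simp add: algebra_simps)
  have "?A - ?C1 + ?C2 - ?D = 0\<^sub>m ?N ?N"
    using 0 unfolding DY_diff2[OF f R_module R_module R_module] cochain2_formula[OF f RR_module R_module]
      cochain2_formula[OF f R_module RR_module] fst_R .
  then have "(?A - ?C1 + ?C2 - ?D) * ?w = 0\<^sub>m ?N 1"
    using left_mult_zero_mat[OF w, of ?N] by simp
  moreover have "(?A - ?C1 + ?C2 - ?D) * ?w = ?A * ?w - ?C1 * ?w + ?C2 * ?w - ?D * ?w"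
    unfolding minus_mult_distrib_mat[OF add_carrier_mat[OF cC2] cD w]
      add_mult_distrib_mat[OF minus_carrier_mat[OF cC1] cC2 w] minus_mult_distrib_mat[OF cA cC1 w] ..
  ultimately have "(?A * ?w - ?C1 * ?w + ?C2 * ?w - ?D * ?w) $$ (?row, 0) = 0"
    using row by simp
  moreover have entry: "(M1 - M2 + M3 - M4) $$ (r, 0)
      = M1 $$ (r, 0) - M2 $$ (r, 0) + M3 $$ (r, 0) - M4 $$ (r, 0)"
    if "M1 \<in> carrier_mat n 1" "M2 \<in> carrier_mat n 1" "M3 \<in> carrier_mat n 1" "M4 \<in> carrier_mat n 1" "r < n"
    for M1 M2 M3 M4 :: "complex mat" and n r
    using that by auto
  ultimately have sum0: "(?A * ?w) $$ (?row, 0) - (?C1 * ?w) $$ (?row, 0) + (?C2 * ?w) $$ (?row, 0)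
      - (?D * ?w) $$ (?row, 0) = 0"
    using entry[OF mult_carrier_mat[OF cA w] mult_carrier_mat[OF cC1 w] mult_carrier_mat[OF cC2 w]
        mult_carrier_mat[OF cD w] row] by simp
  have "(?A * ?w) $$ (?row, 0) = (if s = o0 then cvec f t u else 0)"
  proof -
    have "?A * ?w = kron (bv o0) (?F * e00)"
      unfolding kron_mult[OF one_carrier_mat F bv_carrier e00_carrier] left_mult_one_mat[OF bv_carrier] ..
    then show ?thesis
      using kron_index_pair[OF bv_carrier Fe enc_less[OF s] enc2_less[OF t u], of o0]
      by (simp add: bv_o0_entry[OF s] cvec_def[symmetric] del: index_mult_mat(1))
  qed
  moreover have "(?D * ?w) $$ (?row, 0) = (if u = o0 then cvec f s t else 0)"
  proof -
    have "?D * ?w = kron (?F * e00) (bv o0)"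
      unfolding w' kron_mult[OF F one_carrier_mat e00_carrier bv_carrier] left_mult_one_mat[OF bv_carrier] ..
    then show ?thesis
      unfolding row'
      using kron_index_pair[OF Fe bv_carrier enc2_less[OF s t] enc_less[OF u], of o0]
      by (simp add: bv_o0_entry[OF u] cvec_def[symmetric] del: index_mult_mat(1))
  qed
  moreover have "(?C1 * ?w) $$ (?row, 0) = dualmult (\<lambda>r. cvec f r u) s t"
    unfolding w' row' trep_RR_R_coord[OF s t u] using u by (intro dualmult_cong) (simp add: coord2_pbw_sum2)
  moreover have "(?C2 * ?w) $$ (?row, 0) = dualmult (\<lambda>r. cvec f s r) t u"
    unfolding trep_R_RR_coord[OF s t u] using s by (intro dualmult_cong) (simp add: coord2_pbw_sum2)
  ultimately show ?thesis using sum0 by (simp add: d2_def)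
qed

definition central :: "free_alg \<Rightarrow> bool" where
  "central x \<longleftrightarrow> (\<forall>g. x * genr g \<approx> genr g * x)"

definition central_cochain :: "free_alg \<Rightarrow> hmod list \<Rightarrow> complex mat" where
  "central_cochain x = (\<lambda>Xs\<in>tuples p q 1. rep (hd Xs) x)"

definition central_coboundary :: "free_alg \<Rightarrow> hmod list \<Rightarrow> complex mat" where
  "central_coboundary x = (\<lambda>Xs\<in>tuples p q 2. trep (hd Xs) (last Xs) (cobd x))"

lemma central_cochain: assumes x: "central x" shows "central_cochain x \<in> DY_cochains p q 1"
proof (rule DY_cochain1I)
  show "central_cochain x \<in> extensional (tuples p q 1)" by (simp add: central_cochain_def)
  have v: "central_cochain x [X] = rep X x" if "X \<in> modules p q" for X
    using that tuples_1[of "[X]"] by (simp add: central_cochain_def)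
  show "central_cochain x [X] \<in> mod_hom p q X X" if X: "X \<in> modules p q" for X
    unfolding v[OF X]
  proof (rule mod_hom_genI[OF X X alg_rep_carrier[OF alg_rep_rep[OF X]]])
    fix g
    show "rep X x * rep X (genr g) = rep X (genr g) * rep X x"
      using rep_cong[of "x * genr g" "genr g * x" X] x
      by (simp add: central_def alg_rep_mult[OF alg_rep_rep[OF X]])
  qed
  show "central_cochain x [Y] * \<phi> = \<phi> * central_cochain x [X]"
    if X: "X \<in> modules p q" and Y: "Y \<in> modules p q" and h: "\<phi> \<in> mod_hom p q X Y" for X Y \<phi>
    unfolding v[OF X] v[OF Y] mod_homD(2)[OF h] ..
qed

lemma trep_cobd:
  assumes X: "X \<in> modules p q" and Y: "Y \<in> modules p q"
  shows "trep X Y (cobd x)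
    = kron (1\<^sub>m (fst X)) (rep Y x) - rep (tensor_mod p q X Y) x + kron (rep X x) (1\<^sub>m (fst Y))"
  unfolding cobd_def alg_rep_add[OF alg_rep_trep[OF X Y]] alg_rep_diff[OF alg_rep_trep[OF X Y]]
    trep_tens[OF X Y] rep_tensor_mod[OF X Y] alg_rep_one[OF alg_rep_rep[OF X]] alg_rep_one[OF alg_rep_rep[OF Y]] ..

lemma DY_diff_extensional: "DY_diff p q 1 z \<in> extensional (tuples p q 2)"
  by (simp add: DY_diff_def one_add_one del: One_nat_def)

lemma DY_diff1_central:
  assumes x: "central x" shows "DY_diff p q 1 (central_cochain x) = central_coboundary x"
proof (rule extensionalityI[OF DY_diff_extensional])
  show "central_coboundary x \<in> extensional (tuples p q 2)" by (simp add: central_coboundary_def)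
  fix Xs assume Xs: "Xs \<in> tuples p q 2"
  then obtain X Y where XY: "Xs = [X, Y]" and X: "X \<in> modules p q" and Y: "Y \<in> modules p q"
    by (auto simp: tuples_2)
  have v: "central_cochain x [X] = rep X x" if "X \<in> modules p q" for X
    using that tuples_1[of "[X]"] by (simp add: central_cochain_def)
  show "DY_diff p q 1 (central_cochain x) Xs = central_coboundary x Xs"
    using Xs unfolding XY DY_diff1[OF central_cochain[OF x] X Y] v[OF X] v[OF Y] v[OF tensor_mod_modules[OF X Y]]
    by (simp add: central_coboundary_def trep_cobd[OF X Y])
qed

lemma cocycle_is_central_coboundary:
  assumes f: "f \<in> DY_cocycles p q 2"
  shows "\<exists>x. central x \<and> f = central_coboundary x"
proof -
  have fc: "f \<in> DY_cochains p q 2"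
    and f0: "DY_diff p q 2 f = \<one>\<^bsub>DY_cochain_group p q (2 + 1)\<^esub>"
    using f by (auto simp: DY_cocycles_def kernel_def DY_cochain_group_def)
  have "[R, R, R] \<in> tuples p q (2 + 1)" using R_module tuples_3 by simp
  then have "DY_diff p q 2 f [R, R, R] = 0\<^sub>m (dimR * (dimR * dimR)) (dimR * (dimR * dimR))"
    unfolding f0 by (simp add: DY_cochain_group_def)
  from invariant_cocycle_is_coboundary[of "cvec f", OF cocycle_in_coordinates[OF fc this] cochain2_invariant[OF fc]]
  obtain x where x: "\<forall>g. x * genr g \<approx> genr g * x" and y: "pbw_sum2 (cvec f) \<approx>\<^sub>2 cobd x" by blast
  have "f = central_coboundary x"
  proof (rule extensionalityI[OF DY_cochain2D(1)[OF fc]])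
    show "central_coboundary x \<in> extensional (tuples p q 2)" by (simp add: central_coboundary_def)
    fix Xs assume Xs: "Xs \<in> tuples p q 2"
    then obtain X Y where XY: "Xs = [X, Y]" and X: "X \<in> modules p q" and Y: "Y \<in> modules p q"
      by (auto simp: tuples_2)
    show "f Xs = central_coboundary x Xs"
      using Xs trep_cong[OF X Y y] unfolding XY cochain2_formula[OF fc X Y]
      by (simp add: central_coboundary_def)
  qed
  then show ?thesis using x by (auto simp: central_def)
qed

lemma coboundary_cochain:
  assumes z: "z \<in> DY_cochains p q 1"
  shows "DY_diff p q 1 z \<in> DY_cochains p q 2"
proof (rule DY_cochain2I[OF DY_diff_extensional])
  note hom = DY_cochain1D(2)[OF z] and nat = DY_cochain1D(3)[OF z]
  fix X Y assume X: "X \<in> modules p q" and Y: "Y \<in> modules p q"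
  note XY = tensor_mod_modules[OF X Y]
  show "DY_diff p q 1 z [X, Y] \<in> mod_hom p q (tensor_mod p q X Y) (tensor_mod p q X Y)"
    unfolding DY_diff1[OF z X Y]
    by (intro mod_hom_add[OF XY XY] mod_hom_diff[OF XY XY] kron_mod_hom[OF X Y X Y] one_mod_hom hom X Y XY)
  fix X' Y' \<phi> \<psi>
  assume X': "X' \<in> modules p q" and Y': "Y' \<in> modules p q"
    and h: "\<phi> \<in> mod_hom p q X X'" "\<psi> \<in> mod_hom p q Y Y'"
  note XY' = tensor_mod_modules[OF X' Y']
  note c = mod_homD(1)[OF h(1)] mod_homD(1)[OF h(2)]
  note zX = mod_homD(1)[OF hom[OF X]] and zY = mod_homD(1)[OF hom[OF Y]]
    and zX' = mod_homD(1)[OF hom[OF X']] and zY' = mod_homD(1)[OF hom[OF Y']]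
    and zXY = mod_homD(1)[OF hom[OF XY], unfolded fst_tensor_mod]
    and zXY' = mod_homD(1)[OF hom[OF XY'], unfolded fst_tensor_mod]
  note k = kron_carrier[OF c]
  note kA = kron_carrier[OF one_carrier_mat[of "fst X"] zY] and kB = kron_carrier[OF zX one_carrier_mat[of "fst Y"]]
    and kA' = kron_carrier[OF one_carrier_mat[of "fst X'"] zY'] and kB' = kron_carrier[OF zX' one_carrier_mat[of "fst Y'"]]
  have "kron (1\<^sub>m (fst X')) (z [Y']) * kron \<phi> \<psi> = kron \<phi> \<psi> * kron (1\<^sub>m (fst X)) (z [Y])"
    unfolding kron_mult[OF one_carrier_mat zY' c] kron_mult[OF c one_carrier_mat zY] nat[OF Y Y' h(2)]
    using c by simp
  moreover have "kron (z [X']) (1\<^sub>m (fst Y')) * kron \<phi> \<psi> = kron \<phi> \<psi> * kron (z [X]) (1\<^sub>m (fst Y))"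
    unfolding kron_mult[OF zX' one_carrier_mat c] kron_mult[OF c zX one_carrier_mat] nat[OF X X' h(1)]
    using c by simp
  moreover have "z [tensor_mod p q X' Y'] * kron \<phi> \<psi> = kron \<phi> \<psi> * z [tensor_mod p q X Y]"
    by (rule nat[OF XY XY' kron_mod_hom[OF X Y X' Y' h]])
  ultimately show "DY_diff p q 1 z [X', Y'] * kron \<phi> \<psi> = kron \<phi> \<psi> * DY_diff p q 1 z [X, Y]"
    unfolding DY_diff1[OF z X Y] DY_diff1[OF z X' Y']
      add_mult_distrib_mat[OF minus_carrier_mat[OF zXY'] kB' k] minus_mult_distrib_mat[OF kA' zXY' k]
      mult_add_distrib_mat[OF k minus_carrier_mat[OF zXY] kB] mult_minus_distrib_mat[OF k kA zXY]
    by simp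
qed

lemma coboundary_cocycle:
  assumes z: "z \<in> DY_cochains p q 1"
  shows "DY_diff p q 1 z \<in> DY_cocycles p q 2"
proof -
  let ?f = "DY_diff p q 1 z"
  note f = coboundary_cochain[OF z]
  note hom = DY_cochain1D(2)[OF z]
  have cancel: "(A - A2 + A3) - (A - M + C) + (A2 - M + D) - (A3 - C + D) = 0\<^sub>m n n"
    if "A \<in> carrier_mat n n" "A2 \<in> carrier_mat n n" "A3 \<in> carrier_mat n n" "M \<in> carrier_mat n n"
      "C \<in> carrier_mat n n" "D \<in> carrier_mat n n" for A A2 A3 M C D :: "complex mat" and n
    using that by (intro eq_matI) auto
  have d0: "DY_diff p q 2 ?f [X, Y, Z] = 0\<^sub>m (fst X * (fst Y * fst Z)) (fst X * (fst Y * fst Z))"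
    if X: "X \<in> modules p q" and Y: "Y \<in> modules p q" and Z: "Z \<in> modules p q" for X Y Z
  proof -
    note XY = tensor_mod_modules[OF X Y] and YZ = tensor_mod_modules[OF Y Z]
    let ?N = "fst X * (fst Y * fst Z)"
    let ?zX = "z [X]" and ?zY = "z [Y]" and ?zZ = "z [Z]"
      and ?zXY = "z [tensor_mod p q X Y]" and ?zYZ = "z [tensor_mod p q Y Z]"
      and ?M = "z [tensor_mod p q X (tensor_mod p q Y Z)]"
    let ?A = "kron (1\<^sub>m (fst X)) (kron (1\<^sub>m (fst Y)) ?zZ)" and ?A2 = "kron (1\<^sub>m (fst X)) ?zYZ"
      and ?A3 = "kron (1\<^sub>m (fst X)) (kron ?zY (1\<^sub>m (fst Z)))"
      and ?C = "kron ?zXY (1\<^sub>m (fst Z))" and ?D = "kron ?zX (kron (1\<^sub>m (fst Y)) (1\<^sub>m (fst Z)))"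
    have c: "?zX \<in> carrier_mat (fst X) (fst X)" "?zY \<in> carrier_mat (fst Y) (fst Y)"
      "?zZ \<in> carrier_mat (fst Z) (fst Z)" "?zXY \<in> carrier_mat (fst X * fst Y) (fst X * fst Y)"
      "?zYZ \<in> carrier_mat (fst Y * fst Z) (fst Y * fst Z)" "?M \<in> carrier_mat ?N ?N"
      using mod_homD(1)[OF hom[OF X]] mod_homD(1)[OF hom[OF Y]] mod_homD(1)[OF hom[OF Z]]
        mod_homD(1)[OF hom[OF XY]] mod_homD(1)[OF hom[OF YZ]]
        mod_homD(1)[OF hom[OF tensor_mod_modules[OF X YZ]]] by simp_all
    have cC: "?C \<in> carrier_mat ?N ?N"
      using kron_carrier[OF c(4) one_carrier_mat[of "fst Z"]] by (simp only: mult.assoc)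
    have 1: "kron (1\<^sub>m (fst X)) (?f [Y, Z]) = ?A - ?A2 + ?A3"
      unfolding DY_diff1[OF z Y Z]
      using c by (subst kron_add_right[of _ "fst Y * fst Z" "fst Y * fst Z"])
        (auto simp: kron_diff_right[of _ "fst Y * fst Z" "fst Y * fst Z"] intro!: minus_carrier_mat)
    have 2: "?f [tensor_mod p q X Y, Z] = ?A - ?M + ?C"
      unfolding DY_diff1[OF z XY Z] tensor_mod_assoc[OF X Y Z]
      by (simp flip: kron_assoc add: kron_one)
    have 3: "?f [X, tensor_mod p q Y Z] = ?A2 - ?M + ?D"
      unfolding DY_diff1[OF z X YZ] by (simp add: kron_one)
    have 4: "kron (?f [X, Y]) (1\<^sub>m (fst Z)) = ?A3 - ?C + ?D"
      unfolding DY_diff1[OF z X Y]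
      using c by (subst kron_add_left[of _ "fst X * fst Y" "fst X * fst Y"])
        (auto simp: kron_diff_left[of _ "fst X * fst Y" "fst X * fst Y"] kron_assoc intro!: minus_carrier_mat)
    show ?thesis
      unfolding DY_diff2[OF f X Y Z] 1 2 3 4
      by (rule cancel) (use c cC in \<open>auto intro!: kron_carrier\<close>)
  qed
  have "DY_diff p q 2 ?f = \<one>\<^bsub>DY_cochain_group p q (2 + 1)\<^esub>"
  proof (rule extensionalityI[of _ "tuples p q (2 + 1)"])
    show "DY_diff p q 2 ?f \<in> extensional (tuples p q (2 + 1))" by (simp add: DY_diff_def)
    show "\<one>\<^bsub>DY_cochain_group p q (2 + 1)\<^esub> \<in> extensional (tuples p q (2 + 1))"
      by (simp add: DY_cochain_group_def)
    fix Xs assume Xs: "Xs \<in> tuples p q (2 + 1)"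
    then obtain X Y Z where XYZ: "Xs = [X, Y, Z]" and m: "X \<in> modules p q" "Y \<in> modules p q" "Z \<in> modules p q"
      using tuples_3[of Xs] by auto
    show "DY_diff p q 2 ?f Xs = \<one>\<^bsub>DY_cochain_group p q (2 + 1)\<^esub> Xs"
      using Xs unfolding XYZ d0[OF m] by (simp add: DY_cochain_group_def)
  qed
  then show ?thesis
    using f by (simp add: DY_cocycles_def kernel_def) (simp add: DY_cochain_group_def)
qed

lemma central_coboundary_cocycle: "central x \<Longrightarrow> central_coboundary x \<in> DY_cocycles p q 2"
  using coboundary_cocycle[OF central_cochain] DY_diff1_central by metis

lemma coboundaries_eq_cocycles: "DY_coboundaries p q 2 = DY_cocycles p q 2"
proof -
  have "DY_coboundaries p q 2 = DY_diff p q 1 ` DY_cochains p q 1"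
    by (simp add: numeral_2_eq_2)
  also have "\<dots> = DY_cocycles p q 2"
  proof (intro equalityI subsetI)
    fix f assume "f \<in> DY_cocycles p q 2"
    then obtain x where "central x" "f = central_coboundary x"
      using cocycle_is_central_coboundary by blast
    then show "f \<in> DY_diff p q 1 ` DY_cochains p q 1"
      using DY_diff1_central central_cochain by (metis image_eqI)
  next
    fix f assume "f \<in> DY_diff p q 1 ` DY_cochains p q 1"
    then obtain z where "z \<in> DY_cochains p q 1" "f = DY_diff p q 1 z" by (rule imageE)
    then show "f \<in> DY_cocycles p q 2" using coboundary_cocycle by (simp only:)
  qed
  finally show ?thesis .
qed

lemma trep_hd_last_rep:
  assumes "Xs \<in> tuples p q 2" shows "alg_rep (fst (tensor_list p q Xs)) (trep (hd Xs) (last Xs))"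
proof -
  obtain X Y where "X \<in> modules p q" "Y \<in> modules p q" "Xs = [X, Y]"
    using assms by (auto simp: tuples_2)
  then show ?thesis using alg_rep_trep[of X Y] by simp
qed

lemma comm_group_cocycles: "comm_group ((DY_cochain_group p q 2)\<lparr>carrier := DY_cocycles p q 2\<rparr>)"
  (is "comm_group ?G")
proof -
  let ?s = central_coboundary
  have cob: "cobd (x + y) = cobd x + cobd y" for x y
    by (simp add: cobd_def Delta_add tens_add_left tens_add_right)
  have cob0: "cobd 0 = 0" by (simp add: cobd_def Delta_zero)
  have add: "?s x \<otimes>\<^bsub>?G\<^esub> ?s y = ?s (x + y)" for x y
  proof -
    have "?s x \<otimes>\<^bsub>?G\<^esub> ?s y = (\<lambda>Xs\<in>tuples p q 2. ?s x Xs + ?s y Xs)"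
      by (simp add: DY_cochain_group_def)
    also have "\<dots> = ?s (x + y)"
      unfolding central_coboundary_def
      by (rule restrict_ext) (simp add: cob alg_rep_add[OF trep_hd_last_rep])
    finally show ?thesis .
  qed
  have one: "\<one>\<^bsub>?G\<^esub> = ?s 0"
  proof -
    have "\<one>\<^bsub>?G\<^esub> = (\<lambda>Xs\<in>tuples p q 2. 0\<^sub>m (fst (tensor_list p q Xs)) (fst (tensor_list p q Xs)))"
      by (simp add: DY_cochain_group_def)
    also have "\<dots> = ?s 0"
      unfolding central_coboundary_def
      by (rule restrict_ext) (simp add: cob0 alg_rep_zero[OF trep_hd_last_rep])
    finally show ?thesis .
  qed
  have car: "f \<in> carrier ?G \<longleftrightarrow> (\<exists>x. central x \<and> f = ?s x)" for f
    using cocycle_is_central_coboundary central_coboundary_cocycle by auto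
  have cadd: "central (x + y)" if "central x" "central y" for x y
    using that I.cadd unfolding central_def by (simp add: distrib_left distrib_right)
  have c0: "central 0" by (simp add: central_def)
  have cneg: "central (- x)" if "central x" for x
    unfolding central_def
  proof
    fix g
    have "- (x * genr g) \<approx> - (genr g * x)"
      by (rule cg_minus[OF I.two_sided]) (use that in \<open>simp add: central_def\<close>)
    then show "- x * genr g \<approx> genr g * - x" by simp
  qed
  have inv: "\<exists>g\<in>carrier ?G. g \<otimes>\<^bsub>?G\<^esub> f = \<one>\<^bsub>?G\<^esub>" if f: "f \<in> carrier ?G" for f
  proof -
    obtain x where x: "central x" "f = ?s x" using car[THEN iffD1, OF f] by blast
    have c: "?s (- x) \<in> carrier ?G" by (rule car[THEN iffD2]) (use cneg[OF x(1)] in blast)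
    have i: "?s (- x) \<otimes>\<^bsub>?G\<^esub> f = \<one>\<^bsub>?G\<^esub>"
      unfolding x(2) by (simp only: add one left_minus)
    show ?thesis by (rule bexI, rule i, rule c)
  qed
  have closed: "f \<otimes>\<^bsub>?G\<^esub> g \<in> carrier ?G" if f: "f \<in> carrier ?G" and g: "g \<in> carrier ?G" for f g
  proof -
    obtain x where x: "central x" "f = ?s x" using car[THEN iffD1, OF f] by blast
    obtain y where y: "central y" "g = ?s y" using car[THEN iffD1, OF g] by blast
    show ?thesis unfolding x(2) y(2) add by (rule car[THEN iffD2]) (use cadd[OF x(1) y(1)] in blast)
  qed
  have comm: "f \<otimes>\<^bsub>?G\<^esub> g = g \<otimes>\<^bsub>?G\<^esub> f" if f: "f \<in> carrier ?G" and g: "g \<in> carrier ?G" for f g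
  proof -
    obtain x where x: "central x" "f = ?s x" using car[THEN iffD1, OF f] by blast
    obtain y where y: "central y" "g = ?s y" using car[THEN iffD1, OF g] by blast
    show ?thesis unfolding x(2) y(2) add by (simp only: add.commute)
  qed
  have assoc: "f \<otimes>\<^bsub>?G\<^esub> g \<otimes>\<^bsub>?G\<^esub> h = f \<otimes>\<^bsub>?G\<^esub> (g \<otimes>\<^bsub>?G\<^esub> h)"
    if f: "f \<in> carrier ?G" and g: "g \<in> carrier ?G" and h: "h \<in> carrier ?G" for f g h
  proof -
    obtain x where x: "central x" "f = ?s x" using car[THEN iffD1, OF f] by blast
    obtain y where y: "central y" "g = ?s y" using car[THEN iffD1, OF g] by blast
    obtain w where w: "central w" "h = ?s w" using car[THEN iffD1, OF h] by blast
    show ?thesis unfolding x(2) y(2) w(2) add by (simp only: add.assoc)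
  qed
  have l_one: "\<one>\<^bsub>?G\<^esub> \<otimes>\<^bsub>?G\<^esub> f = f" if f: "f \<in> carrier ?G" for f
  proof -
    obtain x where x: "central x" "f = ?s x" using car[THEN iffD1, OF f] by blast
    show ?thesis unfolding x(2) one add by (simp only: add_0_left)
  qed
  have one_car: "\<one>\<^bsub>?G\<^esub> \<in> carrier ?G"
    unfolding one by (rule car[THEN iffD2]) (use c0 in blast)
  show ?thesis
    by (rule comm_groupI; fact closed one_car assoc comm l_one inv)
qed

lemma trivial_DY_cohomology: "trivial_group (DY_cohomology p q 2)"
proof -
  let ?G = "(DY_cochain_group p q 2)\<lparr>carrier := DY_cocycles p q 2\<rparr>"
  interpret G: comm_group ?G by (rule comm_group_cocycles)
  have "DY_cohomology p q 2 = ?G Mod carrier ?G"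
    by (simp add: DY_cohomology_def coboundaries_eq_cocycles)
  moreover have "group (?G Mod carrier ?G)"
    by (rule normal.factorgroup_is_group[OF G.subgroup_imp_normal[OF G.subgroup_self]])
  moreover have "carrier (?G Mod carrier ?G) = {\<one>\<^bsub>?G Mod carrier ?G\<^esub>}"
  proof -
    have "carrier ?G #>\<^bsub>?G\<^esub> x = carrier ?G" if "x \<in> carrier ?G" for x
      by (rule G.coset_join2[OF that G.subgroup_self that])
    moreover have "\<one>\<^bsub>?G\<^esub> \<in> carrier ?G" by (rule G.one_closed)
    ultimately show ?thesis unfolding carrier_FactGroup one_FactGroup by blast
  qed
  ultimately show ?thesis by (simp add: trivial_group_def)
qed

end

theorem proposition6p8:
  fixes p :: nat and q :: complex
  assumes "odd p" and "p \<ge> 3"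
    and "q ^ p = 1" and "\<And>k. 0 < k \<Longrightarrow> k < p \<Longrightarrow> q ^ k \<noteq> 1"
  shows "trivial_group (DY_cohomology p q 2)"
proof -
  interpret small_q p q
    by unfold_locales (use assms in auto)
  show ?thesis by (rule trivial_DY_cohomology)
qed


end
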